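(* Let $\alpha>\beta\ge J(K^\star)$, so that $\mathbb{K}_\beta\subset\mathbb{K}_\alpha$, and let $L$ and $M$ be the constants defined in the context for this $\alpha$. Let $$\bar d:=\inf\{\|K-K'\| : K\in\mathbb{K}_\beta,\ K'\in(\mathbb{K}_\alpha^o)^c\},$$ which is positive. Assume that $\mathbb{K}_\beta$ contains a local minimum $K^\#$ of $J$ with $l:=\lambda_{\min}(\nabla^2J(\mathrm{vec}(K^\#)))>0$. Let $\bar r:=2l/M$, and let the initial gain $K_0$ satisfy $$r_0:=\|K_0-K^\#\|_F<\bar r\qquad\text{and}\qquad \frac{\bar r r_0}{\bar r-r_0}\le \bar d .$$ Then for any constant step size $\eta\in(0,1/L]$, the vanilla policy gradient iterates $K_{i+1}=K_i-\eta\nabla J(K_i)$ satisfy, for all $i\ge 0$, $$\|K_i-K^\#\|_F\le\frac{\bar r r_0}{\bar r-r_0}\Big(\frac{1}{1+\eta l}\Big)^i .$$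
   Context: Setting (static output feedback, SOF). $A\in\mathbb{R}^{n\times n}$, $B\in\mathbb{R}^{n\times m}$, $C\in\mathbb{R}^{d\times n}$; $(A,B)$ is controllable, $(C,A)$ is observable, and $C$ has linearly independent rows. $Q\in\mathbb{R}^{n\times n}$ and $R\in\mathbb{R}^{m\times m}$ are symmetric positive definite. $\mathcal{D}$ is a probability distribution on $\mathbb{R}^n$ with $X_0:=\mathbb{E}_{x_0\sim\mathcal{D}}[x_0x_0^\top]\succ 0$, and $\mu:=\sigma_{\min}(X_0)>0$. For $K\in\mathbb{R}^{m\times d}$ put $\mathcal{A}_K:=A-BKC$. The set of stabilizing gains is $\mathbb{K}:=\{K\in\mathbb{R}^{m\times d}:\rho(\mathcal{A}_K)<1\}$ ($\rho$ is the spectral radius), assumed nonempty. For $K\in\mathbb{K}$, $$J(K):=\mathbb{E}_{x_0\sim\mathcal{D}}\Big[\sum_{t=0}^\infty x_t^\top(Q+C^\top K^\top RKC)x_t\Big],\quad x_{t+1}=\mathcal{A}_Kx_t .$$ $K^\star$ is a global minimizer of $J$ over $\mathbb{K}$. For a scalar $a$, $\mathbb{K}_a:=\{K\in\mathbb{K}: J(K)\le a\}$ and $\mathbb{K}_a^o:=\{K\in\mathbb{K}:J(K)<a\}$; the complement $(\cdot)^c$ is taken in $\mathbb{R}^{m\times d}$. $\nabla J(K)\in\mathbb{R}^{m\times d}$ is the gradient with respect to the entries of $K$, and $\nabla^2J(\mathrm{vec}(K))\in\mathbb{R}^{md\times md}$ is the Hessian of $J$ viewed as a function of the vectorization $\mathrm{vec}(K)$.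 Constants (for the given $\alpha$): $\gamma:=\max_{K\in\mathbb{K}_\alpha}\|\mathcal{A}_K\|$, $$\psi:=\frac{\sqrt{\|R\|\alpha+\|B\|^2\alpha^2/\mu}}{\sqrt{\mu}\,\sigma_{\min}(R)}+\frac{\|B\|\|A\|\alpha}{\mu\sigma_{\min}(R)},$$ $$\zeta_1=\frac{1}{\sigma_{\min}(Q)}\left(\frac{\alpha}{\mu}(1+\|B\|^2\|C\|^2)+\|R\|\|C\|^2\right)-1,\qquad \zeta_2=\frac{2\|C\|}{\sigma_{\min}(Q)}\left(\frac{\alpha\gamma}{\mu}\|B\|+\psi\|R\|\right),$$ $$\zeta_3=\frac{2\|C\|}{\sigma_{\min}(Q)}\left(\frac{\alpha}{\mu}(\zeta_1\gamma+\zeta_2\gamma+\|B\|\|C\|)\|B\|+\|R\|\|C\|\right),$$ $$\zeta_4=\frac{2\|C\|}{\sigma_{\min}(Q)}\left(\frac{\alpha}{\mu}(\zeta_1\gamma+\|B\|\|C\|)\|B\|+\|R\|\|C\|\right),$$ $$L=\frac{2\alpha}{\sigma_{\min}(Q)}\left(\|R\|+\frac{\alpha}{\mu}\Big(1+\frac{2\zeta_1}{\|B\|\|C\|}\Big)\|B\|^2\right)\|C\|^2,$$ $$M=\frac{4\alpha^2\sqrt{md}}{\mu\sigma_{\min}(Q)}\left(\Big(\zeta_1+\frac{\zeta_2}{2}\Big)\|B\|\|C\|+\zeta_3+\frac{\zeta_4}{2}\right)\|B\|\|C\|.$$ Notation: $\|\cdot\|$ is the induced 2-norm, $\|\cdot\|_F$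 the Frobenius norm, $\sigma_{\min}$ the minimal singular value, $\lambda_{\min}$ the minimal eigenvalue. *)

theory Defs
  imports "HOL-Probability.Probability"
begin

section \<open>Matrices\<close>

text \<open>A matrix with \<open>k\<close> rows and \<open>l\<close> columns has type \<open>real ^ 'l ^ 'k\<close>. On this type the
  library's \<open>norm\<close> is the Frobenius norm and its inner product the Frobenius inner product.\<close>

lemma norm_eq_frobenius:
  fixes M :: "real ^ 'l ^ 'k"
  shows "norm M = sqrt (\<Sum>i\<in>UNIV. \<Sum>j\<in>UNIV. (M $ i $ j)\<^sup>2)"
  by (simp add: norm_vec_def L2_set_def sum_nonneg)

definition op_norm :: "real ^ 'l ^ 'k \<Rightarrow> real" where
  "op_norm M = onorm (\<lambda>x. M *v x)"

definition pos_def :: "real ^ 'n ^ 'n \<Rightarrow> bool" where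
  "pos_def M \<longleftrightarrow> transpose M = M \<and> (\<forall>x. x \<noteq> 0 \<longrightarrow> 0 < x \<bullet> (M *v x))"

text \<open>\<open>lambda_min\<close> is only used for symmetric matrices, whose set of real eigenvalues is finite
  and nonempty.\<close>

definition real_eigenvalues :: "real ^ 'n ^ 'n \<Rightarrow> real set" where
  "real_eigenvalues M = {c. \<exists>v. v \<noteq> 0 \<and> M *v v = c *\<^sub>R v}"

definition lambda_min :: "real ^ 'n ^ 'n \<Rightarrow> real" where
  "lambda_min M = Min (real_eigenvalues M)"

definition sigma_min :: "real ^ 'n ^ 'n \<Rightarrow> real" where
  "sigma_min M = Min (sqrt ` real_eigenvalues (transpose M ** M))"

definition complex_eigenvalues :: "real ^ 'n ^ 'n \<Rightarrow> complex set" where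
  "complex_eigenvalues M =
     {z. \<exists>v :: complex ^ 'n. v \<noteq> 0 \<and> map_matrix complex_of_real M *v v = z *s v}"

definition spectral_radius :: "real ^ 'n ^ 'n \<Rightarrow> real" where
  "spectral_radius M = Max (cmod ` complex_eigenvalues M)"

text \<open>\<open>rows M\<close> is a set and would merge equal rows, hence the injectivity requirement.\<close>

definition lin_indep_rows :: "real ^ 'l ^ 'k \<Rightarrow> bool" where
  "lin_indep_rows M \<longleftrightarrow> inj (\<lambda>i. row i M) \<and> independent (rows M)"


section \<open>Gradient and Hessian\<close>

definition gradient :: "('a::real_inner \<Rightarrow> real) \<Rightarrow> 'a \<Rightarrow> 'a" where
  "gradient f x = (THE g. GDERIV f x :> g)"

definition hessian :: "(real ^ 'n \<Rightarrow> real) \<Rightarrow> real ^ 'n \<Rightarrow> real ^ 'n ^ 'n" where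
  "hessian f x = jacobian (gradient f) (at x)"

text \<open>The entries of a vectorised matrix are indexed by (column, row).\<close>

definition vectorize :: "real ^ 'd ^ 'm \<Rightarrow> real ^ ('d \<times> 'm)" where
  "vectorize K = (\<chi> p. K $ snd p $ fst p)"

definition unvectorize :: "real ^ ('d \<times> 'm) \<Rightarrow> real ^ 'd ^ 'm" where
  "unvectorize v = (\<chi> i j. v $ (j, i))"

lemma unvectorize_vectorize [simp]: "unvectorize (vectorize K) = K"
  and vectorize_unvectorize [simp]: "vectorize (unvectorize v) = v"
  by (simp_all add: vectorize_def unvectorize_def vec_eq_iff)


section \<open>Linear systems\<close>

primrec state :: "real ^ 'n ^ 'n \<Rightarrow> real ^ 'm ^ 'n \<Rightarrow> (nat \<Rightarrow> real ^ 'm) \<Rightarrow> real ^ 'n \<Rightarrow> nat \<Rightarrow> real ^ 'n"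
where
  "state A B u x0 0 = x0"
| "state A B u x0 (Suc t) = A *v state A B u x0 t + B *v u t"

definition controllable :: "real ^ 'n ^ 'n \<Rightarrow> real ^ 'm ^ 'n \<Rightarrow> bool" where
  "controllable A B \<longleftrightarrow> (\<forall>x0 x1. \<exists>T u. state A B u x0 T = x1)"

text \<open>With zero input: inputs contribute the same known term to both outputs, and do not affect
  whether two initial states can be told apart.\<close>

definition observable :: "real ^ 'n ^ 'd \<Rightarrow> real ^ 'n ^ 'n \<Rightarrow> bool" where
  "observable C A \<longleftrightarrow>
     (\<forall>x0 x1. (\<forall>t. C *v (((\<lambda>x. A *v x) ^^ t) x0) = C *v (((\<lambda>x. A *v x) ^^ t) x1)) \<longrightarrow> x0 = x1)"


section \<open>Static output feedback\<close>

definition closed_loop ::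
  "real ^ 'n ^ 'n \<Rightarrow> real ^ 'm ^ 'n \<Rightarrow> real ^ 'n ^ 'd \<Rightarrow> real ^ 'd ^ 'm \<Rightarrow> real ^ 'n ^ 'n"
where
  "closed_loop A B C K = A - B ** K ** C"

definition stabilizing ::
  "real ^ 'n ^ 'n \<Rightarrow> real ^ 'm ^ 'n \<Rightarrow> real ^ 'n ^ 'd \<Rightarrow> (real ^ 'd ^ 'm) set"
where
  "stabilizing A B C = {K. spectral_radius (closed_loop A B C K) < 1}"

definition outer :: "real ^ 'n \<Rightarrow> real ^ 'n ^ 'n" where
  "outer x = (\<chi> i j. x $ i * x $ j)"

definition second_moment :: "(real ^ 'n) measure \<Rightarrow> real ^ 'n ^ 'n" where
  "second_moment D = (\<integral>x. outer x \<partial>D)"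

text \<open>Only meaningful for stabilizing gains, where the series converges; all uses below are at
  stabilizing gains or are local at such a gain, the set of these being open.\<close>

definition cost ::
  "real ^ 'n ^ 'n \<Rightarrow> real ^ 'm ^ 'n \<Rightarrow> real ^ 'n ^ 'd \<Rightarrow> real ^ 'n ^ 'n \<Rightarrow> real ^ 'm ^ 'm
    \<Rightarrow> (real ^ 'n) measure \<Rightarrow> real ^ 'd ^ 'm \<Rightarrow> real"
where
  "cost A B C Q R D K =
     (\<integral>x0. (\<Sum>t. let x = ((\<lambda>x. closed_loop A B C K *v x) ^^ t) x0
                in x \<bullet> ((Q + transpose C ** transpose K ** R ** K ** C) *v x)) \<partial>D)"

definition sublevel ::
  "real ^ 'n ^ 'n \<Rightarrow> real ^ 'm ^ 'n \<Rightarrow> real ^ 'n ^ 'd \<Rightarrow> real ^ 'n ^ 'n \<Rightarrow> real ^ 'm ^ 'm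
    \<Rightarrow> (real ^ 'n) measure \<Rightarrow> real \<Rightarrow> (real ^ 'd ^ 'm) set"
where
  "sublevel A B C Q R D a = {K \<in> stabilizing A B C. cost A B C Q R D K \<le> a}"

definition strict_sublevel ::
  "real ^ 'n ^ 'n \<Rightarrow> real ^ 'm ^ 'n \<Rightarrow> real ^ 'n ^ 'd \<Rightarrow> real ^ 'n ^ 'n \<Rightarrow> real ^ 'm ^ 'm
    \<Rightarrow> (real ^ 'n) measure \<Rightarrow> real \<Rightarrow> (real ^ 'd ^ 'm) set"
where
  "strict_sublevel A B C Q R D a = {K \<in> stabilizing A B C. cost A B C Q R D K < a}"

definition d_bar ::
  "real ^ 'n ^ 'n \<Rightarrow> real ^ 'm ^ 'n \<Rightarrow> real ^ 'n ^ 'd \<Rightarrow> real ^ 'n ^ 'n \<Rightarrow> real ^ 'm ^ 'm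
    \<Rightarrow> (real ^ 'n) measure \<Rightarrow> real \<Rightarrow> real \<Rightarrow> real"
where
  "d_bar A B C Q R D \<alpha> \<beta> =
     Inf {op_norm (K - K') | K K'.
            K \<in> sublevel A B C Q R D \<beta> \<and> K' \<in> - strict_sublevel A B C Q R D \<alpha>}"


section \<open>Constants\<close>

definition mu :: "(real ^ 'n) measure \<Rightarrow> real" where
  "mu D = sigma_min (second_moment D)"

text \<open>A maximum, since the sublevel set is compact. \<open>Max\<close> is only defined on finite sets.\<close>

definition gam ::
  "real ^ 'n ^ 'n \<Rightarrow> real ^ 'm ^ 'n \<Rightarrow> real ^ 'n ^ 'd \<Rightarrow> real ^ 'n ^ 'n \<Rightarrow> real ^ 'm ^ 'm
    \<Rightarrow> (real ^ 'n) measure \<Rightarrow> real \<Rightarrow> real"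
where
  "gam A B C Q R D \<alpha> = (SUP K \<in> sublevel A B C Q R D \<alpha>. op_norm (closed_loop A B C K))"

definition psi ::
  "real ^ 'n ^ 'n \<Rightarrow> real ^ 'm ^ 'n \<Rightarrow> real ^ 'm ^ 'm \<Rightarrow> (real ^ 'n) measure \<Rightarrow> real \<Rightarrow> real"
where
  "psi A B R D \<alpha> =
     sqrt (op_norm R * \<alpha> + (op_norm B)\<^sup>2 * \<alpha>\<^sup>2 / mu D) / (sqrt (mu D) * sigma_min R)
     + op_norm B * op_norm A * \<alpha> / (mu D * sigma_min R)"

definition zeta1 ::
  "real ^ 'm ^ 'n \<Rightarrow> real ^ 'n ^ 'd \<Rightarrow> real ^ 'n ^ 'n \<Rightarrow> real ^ 'm ^ 'm
    \<Rightarrow> (real ^ 'n) measure \<Rightarrow> real \<Rightarrow> real"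
where
  "zeta1 B C Q R D \<alpha> =
     1 / sigma_min Q
       * (\<alpha> / mu D * (1 + (op_norm B)\<^sup>2 * (op_norm C)\<^sup>2) + op_norm R * (op_norm C)\<^sup>2) - 1"

definition zeta2 ::
  "real ^ 'n ^ 'n \<Rightarrow> real ^ 'm ^ 'n \<Rightarrow> real ^ 'n ^ 'd \<Rightarrow> real ^ 'n ^ 'n \<Rightarrow> real ^ 'm ^ 'm
    \<Rightarrow> (real ^ 'n) measure \<Rightarrow> real \<Rightarrow> real"
where
  "zeta2 A B C Q R D \<alpha> =
     2 * op_norm C / sigma_min Q
       * (\<alpha> * gam A B C Q R D \<alpha> / mu D * op_norm B + psi A B R D \<alpha> * op_norm R)"

definition zeta3 ::
  "real ^ 'n ^ 'n \<Rightarrow> real ^ 'm ^ 'n \<Rightarrow> real ^ 'n ^ 'd \<Rightarrow> real ^ 'n ^ 'n \<Rightarrow> real ^ 'm ^ 'm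
    \<Rightarrow> (real ^ 'n) measure \<Rightarrow> real \<Rightarrow> real"
where
  "zeta3 A B C Q R D \<alpha> =
     2 * op_norm C / sigma_min Q
       * (\<alpha> / mu D
            * (zeta1 B C Q R D \<alpha> * gam A B C Q R D \<alpha> + zeta2 A B C Q R D \<alpha> * gam A B C Q R D \<alpha>
               + op_norm B * op_norm C) * op_norm B
          + op_norm R * op_norm C)"

definition zeta4 ::
  "real ^ 'n ^ 'n \<Rightarrow> real ^ 'm ^ 'n \<Rightarrow> real ^ 'n ^ 'd \<Rightarrow> real ^ 'n ^ 'n \<Rightarrow> real ^ 'm ^ 'm
    \<Rightarrow> (real ^ 'n) measure \<Rightarrow> real \<Rightarrow> real"
where
  "zeta4 A B C Q R D \<alpha> =
     2 * op_norm C / sigma_min Q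
       * (\<alpha> / mu D
            * (zeta1 B C Q R D \<alpha> * gam A B C Q R D \<alpha> + op_norm B * op_norm C) * op_norm B
          + op_norm R * op_norm C)"

definition L_const ::
  "real ^ 'm ^ 'n \<Rightarrow> real ^ 'n ^ 'd \<Rightarrow> real ^ 'n ^ 'n \<Rightarrow> real ^ 'm ^ 'm
    \<Rightarrow> (real ^ 'n) measure \<Rightarrow> real \<Rightarrow> real"
where
  "L_const B C Q R D \<alpha> =
     2 * \<alpha> / sigma_min Q
       * (op_norm R
          + \<alpha> / mu D * (1 + 2 * zeta1 B C Q R D \<alpha> / (op_norm B * op_norm C)) * (op_norm B)\<^sup>2)
       * (op_norm C)\<^sup>2"

definition M_const ::
  "real ^ 'n ^ 'n \<Rightarrow> real ^ 'm ^ 'n \<Rightarrow> real ^ 'n ^ 'd \<Rightarrow> real ^ 'n ^ 'n \<Rightarrow> real ^ 'm ^ 'm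
    \<Rightarrow> (real ^ 'n) measure \<Rightarrow> real \<Rightarrow> real"
where
  "M_const (A :: real ^ 'n ^ 'n) (B :: real ^ 'm ^ 'n) (C :: real ^ 'n ^ 'd) Q R D \<alpha> =
     4 * \<alpha>\<^sup>2 * sqrt (real (CARD('m) * CARD('d))) / (mu D * sigma_min Q)
       * ((zeta1 B C Q R D \<alpha> + zeta2 A B C Q R D \<alpha> / 2) * op_norm B * op_norm C
          + zeta3 A B C Q R D \<alpha> + zeta4 A B C Q R D \<alpha> / 2)
       * op_norm B * op_norm C"

end

theory Submission
  imports Defs "HOL-Complex_Analysis.Cauchy_Integral_Formula"
    "HOL-Computational_Algebra.Fundamental_Theorem_Algebra"
begin

text \<open>On stabilizing gains \<open>J(K) = \<langle>P\<^sub>K, X\<^sub>0\<rangle>\<close>, where \<open>P\<^sub>K\<close> solves a discrete Lyapunov equation whose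
  coefficients are polynomial in \<open>K\<close>. Differentiating the equation shows that every derivative of
  \<open>P\<^sub>K\<close> solves a Lyapunov equation with the same closed-loop matrix, so each derivative of \<open>J\<close> is the
  value of one positive linear functional \<open>\<Phi>\<^sub>K\<close> at an explicit matrix. Cauchy--Schwarz for \<open>\<Phi>\<^sub>K\<close> and
  bounds between quadratic forms give \<open>\<bar>J''[Z,Z]\<bar> \<le> L \<parallel>Z\<parallel>\<^sup>2\<close> and
  \<open>\<bar>J'''[Z,Z,W]\<bar> \<le> M \<parallel>Z\<parallel>\<^sup>2 \<parallel>W\<parallel>\<close> on the \<open>\<alpha>\<close>-sublevel set.
  The sublevel sets are compact, which makes \<open>d_bar\<close> positive and keeps the segments from the local
  minimum to the iterates inside the \<open>\<alpha>\<close>-sublevel set. One gradient step then satisfies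
  \<open>r' \<le> (1 - \<eta> l + \<eta> M r / 2) r\<close>, and this recursion for the distances gives the claimed rate.\<close>

text \<open>\<open>L\<close> and \<open>M\<close> are prescribed, so the difficulty is to find
  estimates sharp enough to stay below them. Two devices achieve this. Inside
  \<open>\<Phi>\<^sub>K\<close> a factor of the closed-loop matrix costs 1 instead of its norm
  \<gamma>; this matches the absence of \<gamma> in \<open>L\<close>. For the first derivative of
  \<open>P\<^sub>K\<close> two bounds are kept. One has the factor \<open>\<zeta>1\<close>. The
  other is compared with \<open>\<zeta>2\<close> only after multiplication by the fraction of
  \<alpha> that the state cost is guaranteed to consume; that fraction is available because every
  term of the third derivative carries it. In the recursion put \<open>q = \<eta> * l\<close>. The
  number \<open>rbar = 2 * l / M\<close> is the nonzero fixed point of the map sending r to (1 - q +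
  q r / rbar) r, and for 0 < r < rbar this map enlarges 1/r - 1/rbar by a factor of at least 1 + q.
  This explains both the rate 1 / (1 + q) and the prefactor, which is the reciprocal of 1/r0 -
  1/rbar when r0 > 0.\<close>

declare transpose_matrix_vector [simp del]

section \<open>Matrix norms and matrix algebra\<close>

lemma norm_matrix_vector_le:
  fixes M :: "real ^ 'l ^ 'k"
  shows "norm (M *v x) \<le> norm M * norm x"
proof -
  have "norm (M *v x) = L2_set (\<lambda>i. \<bar>(M *v x) $ i\<bar>) UNIV"
    by (simp add: norm_vec_def)
  also have "\<dots> \<le> L2_set (\<lambda>i. norm (M $ i) * norm x) UNIV"
    by (intro L2_set_mono) (simp_all add: matrix_vector_mul_component Cauchy_Schwarz_ineq2)
  also have "\<dots> = norm M * norm x"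
    by (simp add: norm_vec_def[of M] L2_set_left_distrib)
  finally show ?thesis .
qed

lemma norm_le_op_norm: "norm (M *v x) \<le> op_norm M * norm x"
  unfolding op_norm_def by (rule onorm) simp

lemma op_norm_nonneg: "0 \<le> op_norm M"
  unfolding op_norm_def by (rule onorm_pos_le) simp

lemma op_norm_le_norm: "op_norm M \<le> norm M"
  unfolding op_norm_def by (rule onorm_bound) (auto simp: norm_matrix_vector_le)

lemma inner_transpose_vec: 
  fixes M :: "real ^ 'l ^ 'k"
  shows "(transpose M *v x) \<bullet> y = x \<bullet> (M *v y)"
  by (simp add: dot_lmul_matrix transpose_matrix_vector)

lemma norm_transpose [simp]: 
  fixes M :: "real ^ 'l ^ 'k"
  shows "norm (transpose M) = norm M"
  unfolding norm_eq_frobenius transpose_def by (simp, subst sum.swap) simp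

lemma inner_transpose [simp]: 
  fixes M :: "real ^ 'l ^ 'k"
  shows "transpose M \<bullet> transpose N = M \<bullet> N"
  unfolding inner_vec_def transpose_def by (simp, subst sum.swap) simp

lemma norm_matrix_mult_le:
  fixes M :: "real ^ 'l ^ 'k" and N :: "real ^ 'j ^ 'l"
  shows "norm (M ** N) \<le> norm M * norm N"
proof -
  have r: "(M ** N) $ i = transpose N *v (M $ i)" for i
    by (simp add: vec_eq_iff matrix_matrix_mult_def matrix_vector_mult_def transpose_def mult.commute)
  have "norm (M ** N) \<le> L2_set (\<lambda>i. norm (M $ i) * norm N) UNIV"
    unfolding norm_vec_def[of "M ** N"]
    by (intro L2_set_mono) (use norm_matrix_vector_le[of "transpose N"] in \<open>simp_all add: r mult.commute[of "norm (M $ _)"]\<close>)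
  also have "\<dots> = norm M * norm N"
    by (simp add: norm_vec_def[of M] L2_set_left_distrib)
  finally show ?thesis .
qed

lemma bounded_bilinear_matrix_mult:
  "bounded_bilinear ((**) :: real ^ 'l ^ 'k \<Rightarrow> real ^ 'j ^ 'l \<Rightarrow> real ^ 'j ^ 'k)"
proof
  fix a a' :: "real ^ 'l ^ 'k" and b b' :: "real ^ 'j ^ 'l" and r :: real
  show "(a + a') ** b = a ** b + a' ** b"
    by (simp add: vec_eq_iff matrix_matrix_mult_def algebra_simps sum.distrib)
  show "a ** (b + b') = a ** b + a ** b'" by (rule matrix_add_ldistrib)
  show "(r *\<^sub>R a) ** b = r *\<^sub>R (a ** b)" "a ** (r *\<^sub>R b) = r *\<^sub>R (a ** b)"
    by (simp_all add: vec_eq_iff matrix_matrix_mult_def algebra_simps sum_distrib_left)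
  show "\<exists>K. \<forall>(a :: real ^ 'l ^ 'k) (b :: real ^ 'j ^ 'l). norm (a ** b) \<le> norm a * norm b * K"
    by (rule exI[of _ 1]) (simp add: norm_matrix_mult_le)
qed

interpretation matrix_mult: bounded_bilinear "(**) :: real ^ 'l ^ 'k \<Rightarrow> real ^ 'j ^ 'l \<Rightarrow> real ^ 'j ^ 'k"
  by (rule bounded_bilinear_matrix_mult)

lemma bounded_linear_transpose: "bounded_linear (transpose :: real ^ 'l ^ 'k \<Rightarrow> real ^ 'k ^ 'l)"
  by (rule bounded_linear_intro[where K = 1]) (auto simp: transpose_def vec_eq_iff norm_transpose[unfolded transpose_def])

lemmas transpose_add = linear_add[OF bounded_linear.linear[OF bounded_linear_transpose]]
  and transpose_diff = linear_diff[OF bounded_linear.linear[OF bounded_linear_transpose]]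
  and transpose_minus = linear_neg[OF bounded_linear.linear[OF bounded_linear_transpose]]
  and transpose_zero = linear_0[OF bounded_linear.linear[OF bounded_linear_transpose]]

text \<open>Normal form for matrix identities: sums of left-associated products, with transposes
  pushed onto the factors.\<close>

lemmas matrix_simps = matrix_mult.add_left matrix_mult.add_right matrix_mult.diff_left matrix_mult.diff_right
  matrix_mult.scaleR_left matrix_mult.scaleR_right matrix_mult.minus_left matrix_mult.minus_right
  transpose_add transpose_diff transpose_scalar transpose_minus
  matrix_mult.zero_left matrix_mult.zero_right transpose_zero
  matrix_mul_assoc matrix_transpose_mul

lemma matrix_vector_scaleR: "(r *\<^sub>R (M :: real ^ _ ^ _)) *v x = r *\<^sub>R (M *v x)"
  by (rule scaleR_matrix_vector_assoc[symmetric])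

lemma matrix_vector_minus: "(- M) *v x = - (M *v (x::real^_))"
  by (simp add: vec_eq_iff matrix_vector_mult_def sum_negf)

text \<open>Makes a quadratic form linear in its matrix, so that expectations of forms become inner
  products with the second moment.\<close>

lemma inner_outer: "M \<bullet> outer x = x \<bullet> (M *v x)"
  by (simp add: inner_vec_def outer_def matrix_vector_mult_def sum_distrib_left algebra_simps)

lemma inner_mult_vec:
  fixes M :: "real ^ 'l ^ 'k" and N :: "real ^ 'j ^ 'k"
  shows "x \<bullet> ((transpose M ** N) *v y) = (M *v x) \<bullet> (N *v y)"
  unfolding matrix_vector_mul_assoc[symmetric] by (metis inner_transpose_vec inner_commute)

lemma inner_conj_vec:
  fixes M :: "real ^ 'l ^ 'k" and N :: "real ^ 'j ^ 'i"
  shows "x \<bullet> ((transpose M ** S ** N) *v y) = (M *v x) \<bullet> (S *v (N *v y))"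
  unfolding matrix_mul_assoc[symmetric] inner_mult_vec by (simp add: matrix_vector_mul_assoc)

section \<open>Symmetric forms\<close>

text \<open>The form \<open>s\<close> may be indefinite. Polarization writes
  \<open>4 * s u v\<close> as a difference of two diagonal values, and the parallelogram law for
  \<open>q\<close> bounds it. Scaling one argument by \<open>r\<close> gives a quadratic inequality
  in \<open>r\<close>, used at its optimum \<open>s x y / q x x\<close>, or at a large
  \<open>r\<close> if \<open>q x x = 0\<close>.\<close>

lemma form_Cauchy_Schwarz:
  fixes s q :: "'a::real_vector \<Rightarrow> 'a \<Rightarrow> real"
  assumes s: "bilinear s" "\<And>x y. s x y = s y x" and q: "bilinear q" "\<And>x y. q x y = q y x"
    and le: "\<And>x. \<bar>s x x\<bar> \<le> q x x"
  shows "(s x y)\<^sup>2 \<le> q x x * q y y"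
proof -
  have polar: "2 * s u v \<le> q u u + q v v" for u v
  proof -
    have "4 * s u v = s (u + v) (u + v) - s (u - v) (u - v)"
      by (simp add: bilinear_ladd[OF s(1)] bilinear_radd[OF s(1)] bilinear_lsub[OF s(1)]
          bilinear_rsub[OF s(1)] s(2)[of v u])
    also have "\<dots> \<le> q (u + v) (u + v) + q (u - v) (u - v)"
      using le[of "u + v"] le[of "u - v"] by linarith
    also have "\<dots> = 2 * q u u + 2 * q v v"
      by (simp add: bilinear_ladd[OF q(1)] bilinear_radd[OF q(1)] bilinear_lsub[OF q(1)]
          bilinear_rsub[OF q(1)] q(2)[of v u])
    finally show ?thesis by simp
  qed
  have quad: "2 * r * s x y \<le> r\<^sup>2 * q x x + q y y" for r
    using polar[of "r *\<^sub>R x" y]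
    by (simp add: bilinear_lmul[OF s(1)] bilinear_lmul[OF q(1)] bilinear_rmul[OF q(1)] power2_eq_square)
  show ?thesis
  proof (cases "q x x = 0")
    case True
    have "s x y = 0"
    proof (rule ccontr)
      assume "s x y \<noteq> 0"
      with quad[of "(q y y + 1) / (2 * s x y)"] True show False by simp
    qed
    then show ?thesis using True by simp
  next
    case False
    then have "q x x > 0" using le[of x] by linarith
    with quad[of "s x y / q x x"] show ?thesis
      by (simp add: field_simps power2_eq_square)
  qed
qed

definition psd :: "real ^ 'n ^ 'n \<Rightarrow> bool" where
  "psd S \<longleftrightarrow> transpose S = S \<and> (\<forall>x. 0 \<le> x \<bullet> (S *v x))"

lemma inner_symmetric:
  assumes "transpose S = (S :: real ^ 'n ^ 'n)"
  shows "x \<bullet> (S *v y) = y \<bullet> (S *v x)"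
  using inner_transpose_vec[of S x y] assms by (simp add: inner_commute)

lemma bilinear_matrix: "bilinear (\<lambda>x y. x \<bullet> ((S :: real ^ 'n ^ 'n) *v y))"
  unfolding bilinear_def
  by (auto intro!: linearI simp: inner_add algebra_simps)

lemma symmetric_Cauchy_Schwarz:
  fixes S T :: "real ^ 'n ^ 'n"
  assumes "transpose S = S" "transpose T = T" "\<And>x. \<bar>x \<bullet> (S *v x)\<bar> \<le> x \<bullet> (T *v x)"
  shows "(x \<bullet> (S *v y))\<^sup>2 \<le> (x \<bullet> (T *v x)) * (y \<bullet> (T *v y))"
  by (rule form_Cauchy_Schwarz[OF bilinear_matrix _ bilinear_matrix])
    (use assms in \<open>auto intro: inner_symmetric\<close>)

lemma psd_Cauchy_Schwarz:
  assumes "psd P"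
  shows "(x \<bullet> (P *v y))\<^sup>2 \<le> (x \<bullet> (P *v x)) * (y \<bullet> (P *v y))"
  by (rule symmetric_Cauchy_Schwarz) (use assms in \<open>auto simp: psd_def\<close>)

text \<open>Cauchy--Schwarz against \<open>c *\<^sub>R mat 1\<close> at the pair
  \<open>S *v x\<close>, \<open>x\<close> bounds the fourth power of the norm of
  \<open>S *v x\<close>; two of its factors cancel.\<close>

lemma symmetric_norm_le:
  fixes S :: "real ^ 'n ^ 'n"
  assumes sym: "transpose S = S" and le: "\<And>x. \<bar>x \<bullet> (S *v x)\<bar> \<le> c * (norm x)\<^sup>2"
  shows "norm (S *v x) \<le> c * norm x"
proof -
  have c: "c * (norm x)\<^sup>2 \<ge> 0" for x :: "real ^ 'n"
    using le[of x] by (rule order_trans[OF abs_ge_zero])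
  have "0 \<le> c * (norm (axis undefined 1 :: real ^ 'n))\<^sup>2" by (rule c)
  then have c0: "c \<ge> 0" by simp
  have "((S *v x) \<bullet> (S *v x))\<^sup>2 \<le> ((S *v x) \<bullet> ((c *\<^sub>R mat 1) *v (S *v x))) * (x \<bullet> ((c *\<^sub>R mat 1) *v x))"
    by (rule symmetric_Cauchy_Schwarz)
      (use sym le in \<open>auto simp: transpose_scalar matrix_vector_scaleR power2_norm_eq_inner\<close>)
  then have "(norm (S *v x))\<^sup>2 * (norm (S *v x))\<^sup>2 \<le> (norm (S *v x))\<^sup>2 * (c * norm x)\<^sup>2"
    by (simp add: matrix_vector_scaleR power2_norm_eq_inner[symmetric] power2_eq_square algebra_simps)
  then have "norm (S *v x) = 0 \<or> (norm (S *v x))\<^sup>2 \<le> (c * norm x)\<^sup>2"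
    by (metis mult_le_cancel_left_pos norm_eq_zero norm_ge_zero zero_less_power order_le_less)
  then show ?thesis
    using c0 by (auto intro: power2_le_imp_le)
qed

section \<open>The discrete Lyapunov operator\<close>

primrec mpow :: "'a::semiring_1 ^ 'n ^ 'n \<Rightarrow> nat \<Rightarrow> 'a ^ 'n ^ 'n" where
  "mpow M 0 = mat 1"
| "mpow M (Suc t) = mpow M t ** M"

lemma mpow_Suc_left: "mpow M (Suc t) = M ** mpow M t"
  by (induction t) (simp_all, metis matrix_mul_assoc)

lemma funpow_matrix: "((\<lambda>x. M *v x) ^^ t) x = mpow M t *v x"
  by (induction t) (simp_all add: mpow_Suc_left matrix_vector_mul_assoc del: mpow.simps(2))

text \<open>Square summability is exactly what makes the Lyapunov series converge absolutely, and it
  can be read off from bounded costs. Its equivalence with Schur stability is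
  \<open>stable_iff_spectral_radius\<close>.\<close>

definition stable :: "real ^ 'n ^ 'n \<Rightarrow> bool" where
  "stable M \<longleftrightarrow> summable (\<lambda>t. (norm (mpow M t))\<^sup>2)"

definition lyap :: "real ^ 'n ^ 'n \<Rightarrow> real ^ 'n ^ 'n \<Rightarrow> real ^ 'n ^ 'n" where
  "lyap M S = (\<Sum>t. transpose (mpow M t) ** S ** mpow M t)"

lemma norm_conj_le: "norm (transpose M ** S ** M) \<le> norm S * (norm (M :: real ^ 'n ^ 'n))\<^sup>2"
proof -
  have "norm (transpose M ** S ** M) \<le> norm (transpose M ** S) * norm M"
    by (rule norm_matrix_mult_le)
  also have "\<dots> \<le> (norm (transpose M) * norm S) * norm M"
    by (intro mult_right_mono norm_matrix_mult_le) simp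
  finally show ?thesis by (simp add: power2_eq_square algebra_simps)
qed

lemma summable_lyap_norm:
  assumes "stable M"
  shows "summable (\<lambda>t. norm (transpose (mpow M t) ** S ** mpow M t))"
proof (rule summable_comparison_test'[where N = 0])
  show "summable (\<lambda>t. norm S * (norm (mpow M t))\<^sup>2)"
    using assms unfolding stable_def by (rule summable_mult)
qed (simp add: norm_conj_le)

lemma summable_lyap:
  assumes "stable M"
  shows "summable (\<lambda>t. transpose (mpow M t) ** S ** mpow M t)"
  by (rule summable_norm_cancel[OF summable_lyap_norm[OF assms]])

lemma lyap_eq:
  assumes "stable M"
  shows "lyap M S = S + transpose M ** lyap M S ** M"
proof -
  let ?f = "\<lambda>t. transpose (mpow M t) ** S ** mpow M t"
  have bl: "bounded_linear (\<lambda>X. transpose M ** X ** M)"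
    by (intro matrix_mult.bounded_linear_left[THEN bounded_linear_compose] matrix_mult.bounded_linear_right)
  have "lyap M S = ?f 0 + (\<Sum>t. ?f (Suc t))"
    unfolding lyap_def using suminf_split_head[OF summable_lyap[OF assms, of S]] by simp
  also have "(\<Sum>t. ?f (Suc t)) = (\<Sum>t. transpose M ** ?f t ** M)"
    by (simp add: matrix_simps)
  also have "\<dots> = transpose M ** (\<Sum>t. ?f t) ** M"
    by (rule bounded_linear.suminf[OF bl summable_lyap[OF assms], symmetric])
  finally show ?thesis by (simp add: lyap_def)
qed

text \<open>Substituting the equation into itself telescopes: a partial sum of the series is
  \<open>X\<close> minus its conjugate by \<open>mpow M T\<close>, and the powers tend to 0.
  Uniqueness is the way in which linearity and the perturbation formula are obtained later.\<close>

lemma lyap_unique: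
  assumes "stable M" and X: "X = S + transpose M ** X ** M"
  shows "lyap M S = X"
proof -
  let ?f = "\<lambda>t. transpose (mpow M t) ** S ** mpow M t"
  have part: "sum ?f {..<T} = X - transpose (mpow M T) ** X ** mpow M T" for T
  proof (induction T)
    case (Suc T)
    have "?f T = transpose (mpow M T) ** X ** mpow M T - transpose (mpow M T) ** (transpose M ** X ** M) ** mpow M T"
      by (subst X) (simp add: matrix_simps)
    also have "transpose (mpow M T) ** (transpose M ** X ** M) ** mpow M T = transpose (mpow M (Suc T)) ** X ** mpow M (Suc T)"
      unfolding mpow_Suc_left by (simp add: matrix_simps)
    finally show ?case using Suc by (simp del: mpow.simps)
  qed simp
  have lim: "(\<lambda>T. (norm (mpow M T))\<^sup>2) \<longlonglongrightarrow> 0"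
    using assms(1) unfolding stable_def by (rule summable_LIMSEQ_zero)
  have "(\<lambda>T. transpose (mpow M T) ** X ** mpow M T) \<longlonglongrightarrow> 0"
    by (rule Lim_null_comparison[where g = "\<lambda>T. norm X * (norm (mpow M T))\<^sup>2"])
      (use tendsto_mult_left[OF lim, of "norm X"] in \<open>simp_all add: norm_conj_le\<close>)
  then have "(\<lambda>T. sum ?f {..<T}) \<longlonglongrightarrow> X - 0"
    unfolding part by (rule tendsto_diff[OF tendsto_const])
  then have "?f sums X" by (simp add: sums_def)
  then show ?thesis unfolding lyap_def by (rule sums_unique[symmetric])
qed

lemma lyap_add:
  assumes "stable M" shows "lyap M (S + T) = lyap M S + lyap M T"
proof (rule lyap_unique[OF assms])
  have "lyap M S + lyap M T = (S + transpose M ** lyap M S ** M) + (T + transpose M ** lyap M T ** M)"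
    using lyap_eq[OF assms, of S] lyap_eq[OF assms, of T] by simp
  also have "\<dots> = S + T + transpose M ** (lyap M S + lyap M T) ** M"
    by (simp add: matrix_mult.add_left matrix_mult.add_right)
  finally show "lyap M S + lyap M T = S + T + transpose M ** (lyap M S + lyap M T) ** M" .
qed

lemma lyap_scaleR:
  assumes "stable M" shows "lyap M (r *\<^sub>R S) = r *\<^sub>R lyap M S"
proof (rule lyap_unique[OF assms])
  have "r *\<^sub>R lyap M S = r *\<^sub>R (S + transpose M ** lyap M S ** M)"
    using lyap_eq[OF assms, of S] by simp
  also have "\<dots> = r *\<^sub>R S + transpose M ** (r *\<^sub>R lyap M S) ** M"
    by (simp add: matrix_mult.scaleR_left matrix_mult.scaleR_right scaleR_add_right)
  finally show "r *\<^sub>R lyap M S = r *\<^sub>R S + transpose M ** (r *\<^sub>R lyap M S) ** M" .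
qed

lemma norm_lyap_le:
  assumes "stable M"
  shows "norm (lyap M S) \<le> (\<Sum>t. (norm (mpow M t))\<^sup>2) * norm S"
proof -
  have "norm (lyap M S) \<le> (\<Sum>t. norm (transpose (mpow M t) ** S ** mpow M t))"
    unfolding lyap_def by (rule summable_norm[OF summable_lyap_norm[OF assms]])
  also have "\<dots> \<le> (\<Sum>t. norm S * (norm (mpow M t))\<^sup>2)"
    by (intro suminf_le summable_lyap_norm[OF assms] norm_conj_le summable_mult)
      (use assms in \<open>simp add: stable_def\<close>)
  finally show ?thesis
    using assms by (simp add: stable_def suminf_mult mult.commute)
qed

lemma bounded_linear_lyap:
  assumes "stable M" shows "bounded_linear (lyap M)"
proof (rule bounded_linear_intro[where K = "\<Sum>t. (norm (mpow M t))\<^sup>2"])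
  show "norm (lyap M S) \<le> norm S * (\<Sum>t. (norm (mpow M t))\<^sup>2)" for S
    using norm_lyap_le[OF assms, of S] by (simp add: mult.commute)
qed (use assms in \<open>simp_all add: lyap_add lyap_scaleR\<close>)

lemmas lyap_diff = linear_diff[OF bounded_linear.linear[OF bounded_linear_lyap]]

lemma lyap_transpose:
  assumes "stable M" shows "lyap M (transpose S) = transpose (lyap M S)"
proof (rule lyap_unique[OF assms])
  have "transpose (lyap M S) = transpose (S + transpose M ** lyap M S ** M)"
    using lyap_eq[OF assms, of S] by simp
  also have "\<dots> = transpose S + transpose M ** transpose (lyap M S) ** M"
    by (simp add: matrix_simps)
  finally show "transpose (lyap M S) = transpose S + transpose M ** transpose (lyap M S) ** M" .
qed

lemma bounded_linear_quadratic_form: "bounded_linear (\<lambda>S :: real ^ 'n ^ 'n. x \<bullet> (S *v x))"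
  unfolding inner_outer[symmetric] by (rule bounded_linear_inner_left)

lemma lyap_quadratic_form:
  assumes "stable M"
  shows "(\<lambda>t. (mpow M t *v x) \<bullet> (S *v (mpow M t *v x))) sums (x \<bullet> (lyap M S *v x))"
proof -
  have "(\<lambda>t. x \<bullet> ((transpose (mpow M t) ** S ** mpow M t) *v x)) sums (x \<bullet> (lyap M S *v x))"
    using bounded_linear.sums[OF bounded_linear_quadratic_form summable_sums[OF summable_lyap[OF assms]]]
    unfolding lyap_def by blast
  then show ?thesis
    by (simp add: inner_conj_vec)
qed

lemma psd_lyap:
  assumes "stable M" "psd S" shows "psd (lyap M S)"
  unfolding psd_def
proof (intro conjI allI)
  show "transpose (lyap M S) = lyap M S"
    using lyap_transpose[OF assms(1), of S] assms(2) by (simp add: psd_def)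
  show "0 \<le> x \<bullet> (lyap M S *v x)" for x
    using assms(2) by (intro sums_le[OF _ sums_zero lyap_quadratic_form[OF assms(1)]]) (auto simp: psd_def)
qed

lemma psd_conj: "psd S \<Longrightarrow> psd (transpose M ** S ** M)"
  unfolding psd_def 
  by (auto simp: inner_conj_vec) (simp add: matrix_transpose_mul matrix_mul_assoc)

lemma psd_add: "psd S \<Longrightarrow> psd T \<Longrightarrow> psd (S + T)"
  unfolding psd_def by (auto simp: transpose_add matrix_vector_mult_add_rdistrib inner_add_right)

lemma norm_sq_columns:
  fixes M :: "real ^ 'l ^ 'k"
  shows "(norm M)\<^sup>2 = (\<Sum>j\<in>UNIV. (norm (M *v axis j 1))\<^sup>2)"
proof -
  have "(norm M)\<^sup>2 = (norm (transpose M))\<^sup>2" by simp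
  also have "\<dots> = (\<Sum>j\<in>UNIV. (norm (transpose M $ j))\<^sup>2)"
    unfolding norm_vec_def[of "transpose M"] L2_set_def by (simp add: sum_nonneg)
  also have "\<dots> = (\<Sum>j\<in>UNIV. (norm (M *v axis j 1))\<^sup>2)"
    by (simp add: matrix_vector_mult_basis column_def transpose_def)
  finally show ?thesis .
qed

section \<open>Stability and the Lyapunov solution under perturbation of the matrix\<close>

lemma stableI:
  fixes M :: "real ^ 'n ^ 'n"
  assumes "\<And>T x. (\<Sum>t<T. (norm (mpow M t *v x))\<^sup>2) \<le> c * (norm x)\<^sup>2"
  shows "stable M" "(\<Sum>t. (norm (mpow M t))\<^sup>2) \<le> real CARD('n) * c"
proof -
  have le: "(\<Sum>t<T. (norm (mpow M t))\<^sup>2) \<le> real CARD('n) * c" for T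
  proof -
    have "(\<Sum>t<T. (norm (mpow M t))\<^sup>2) = (\<Sum>j\<in>UNIV. \<Sum>t<T. (norm (mpow M t *v axis j 1))\<^sup>2)"
      by (subst sum.swap) (simp add: norm_sq_columns)
    also have "\<dots> \<le> (\<Sum>j\<in>(UNIV :: 'n set). c * (norm (axis j 1 :: real ^ 'n))\<^sup>2)"
      by (intro sum_mono assms)
    finally show ?thesis by simp
  qed
  show "stable M"
    unfolding stable_def by (rule summableI_nonneg_bounded[OF _ le]) simp
  then show "(\<Sum>t. (norm (mpow M t))\<^sup>2) \<le> real CARD('n) * c"
    unfolding stable_def by (intro suminf_le_const le)
qed

text \<open>The solution \<open>X\<close> with source \<open>mat 1\<close> is a Lyapunov function.
  Along \<open>M\<close> its form drops by the squared norm of the state, hence by continuity along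
  any nearby \<open>N\<close> by at least half of it. Summing the drops bounds all trajectories of
  \<open>N\<close> uniformly.\<close>

lemma stable_locally_uniform:
  fixes M :: "real ^ 'n ^ 'n"
  assumes "stable M"
  obtains e c where "e > 0" "c \<ge> 0"
    "\<And>N. dist N M < e \<Longrightarrow> stable N" "\<And>N S. dist N M < e \<Longrightarrow> norm (lyap N S) \<le> c * norm S"
proof -
  define X where "X = lyap M (mat 1)"
  have psdX: "psd X" unfolding X_def
    by (rule psd_lyap[OF assms]) (simp add: psd_def)
  have "continuous (at M) (\<lambda>N. transpose N ** X ** N)"
    by (intro continuous_intros matrix_mult.isCont bounded_linear.isCont[OF bounded_linear_transpose])
  then have "\<exists>e>0. \<forall>N. dist N M < e \<longrightarrow> dist (transpose N ** X ** N) (transpose M ** X ** M) < 1/2"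
    unfolding continuous_at_eps_delta by (rule allE[where x = "1/2"]) simp
  then obtain e where e: "e > 0" "\<And>N. dist N M < e \<Longrightarrow> dist (transpose N ** X ** N) (transpose M ** X ** M) < 1/2"
    by blast
  have *: "(\<Sum>t<T. (norm (mpow N t *v x))\<^sup>2) \<le> 2 * norm X * (norm x)\<^sup>2" if N: "dist N M < e" for N T x
  proof -
    have dec: "(norm y)\<^sup>2 / 2 \<le> y \<bullet> (X *v y) - (N *v y) \<bullet> (X *v (N *v y))" for y
    proof -
      let ?D = "transpose N ** X ** N - transpose M ** X ** M"
      have "y \<bullet> (?D *v y) \<le> norm y * norm (?D *v y)"
        using Cauchy_Schwarz_ineq2 abs_le_D1 by blast
      also have "\<dots> \<le> norm y * (norm ?D * norm y)"
        by (intro mult_left_mono norm_matrix_vector_le) simp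
      also have "\<dots> \<le> norm y * (1/2 * norm y)"
        using e(2)[OF N] by (intro mult_left_mono mult_right_mono) (auto simp: dist_norm)
      finally have D: "y \<bullet> (?D *v y) \<le> (norm y)\<^sup>2 / 2" by (simp add: power2_eq_square)
      have "X = mat 1 + transpose M ** X ** M"
        unfolding X_def by (rule lyap_eq[OF assms])
      then have "y \<bullet> (X *v y) = y \<bullet> (mat 1 *v y) + y \<bullet> ((transpose M ** X ** M) *v y)"
        by (metis inner_add_right matrix_vector_mult_add_rdistrib)
      moreover have "y \<bullet> ((transpose N ** X ** N) *v y) = (N *v y) \<bullet> (X *v (N *v y))"
        by (rule inner_conj_vec)
      ultimately show ?thesis
        using D by (simp add: matrix_vector_mult_diff_rdistrib inner_diff_right power2_norm_eq_inner)
    qed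
    have "(\<Sum>t<T. (norm (mpow N t *v x))\<^sup>2) \<le> 2 * (x \<bullet> (X *v x)) - 2 * ((mpow N T *v x) \<bullet> (X *v (mpow N T *v x)))"
    proof (induction T)
      case (Suc T)
      then show ?case using dec[of "mpow N T *v x"]
        by (simp add: mpow_Suc_left matrix_vector_mul_assoc del: mpow.simps(2))
    qed simp
    also have "\<dots> \<le> 2 * (x \<bullet> (X *v x))" using psdX by (simp add: psd_def)
    also have "x \<bullet> (X *v x) \<le> norm x * (norm X * norm x)"
      by (meson Cauchy_Schwarz_ineq2 abs_le_D1 mult_left_mono norm_ge_zero norm_matrix_vector_le order_trans)
    finally show ?thesis by (simp add: power2_eq_square algebra_simps)
  qed
  show ?thesis
  proof (rule that[OF e(1), of "real CARD('n) * (2 * norm X)"])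
    show "stable N" if "dist N M < e" for N
      using stableI(1)[OF *[OF that]] .
    show "norm (lyap N S) \<le> real CARD('n) * (2 * norm X) * norm S" if N: "dist N M < e" for N S
      using norm_lyap_le[OF stableI(1)[OF *[OF N]], of S] stableI(2)[OF *[OF N]]
      by (meson mult_right_mono norm_ge_zero order_trans)
  qed simp
qed

lemma open_stable: "open {M :: real ^ 'n ^ 'n. stable M}"
  unfolding open_dist using stable_locally_uniform by (metis mem_Collect_eq)

text \<open>The change of matrix is absorbed into the source, so differences of solutions are
  controlled by the locally bounded operator \<open>lyap N\<close>.\<close>

lemma lyap_diff_left:
  assumes M: "stable M" and N: "stable N"
  shows "lyap N T - lyap M S = lyap N (T - S + (transpose N ** lyap M S ** N - transpose M ** lyap M S ** M))"
proof (rule lyap_unique[OF N, symmetric])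
  have "lyap N T - lyap M S = (T + transpose N ** lyap N T ** N) - (S + transpose M ** lyap M S ** M)"
    using lyap_eq[OF N, of T] lyap_eq[OF M, of S] by simp
  also have "\<dots> =     T - S + (transpose N ** lyap M S ** N - transpose M ** lyap M S ** M) +
    transpose N ** (lyap N T - lyap M S) ** N"
    by (simp add: matrix_mult.diff_left matrix_mult.diff_right)
  finally show "lyap N T - lyap M S =     T - S + (transpose N ** lyap M S ** N - transpose M ** lyap M S ** M) +
    transpose N ** (lyap N T - lyap M S) ** N" .
qed

text \<open>With the solution \<open>L\<close> at \<open>x\<close> frozen, the increment is exactly
  \<open>lyap (M y) (F y)\<close>, where \<open>F\<close> is differentiable and vanishes at
  \<open>x\<close>. Replacing \<open>lyap (M y)\<close> by \<open>lyap (M x)\<close> on the linear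
  part of \<open>F\<close> is an error of higher order.\<close>

lemma has_derivative_lyap:
  fixes M S :: "'a::real_normed_vector \<Rightarrow> real ^ 'n ^ 'n"
  assumes M: "(M has_derivative M') (at x)" and S: "(S has_derivative S') (at x)"
    and st: "stable (M x)"
  shows "((\<lambda>y. lyap (M y) (S y)) has_derivative
    (\<lambda>h. lyap (M x) (S' h + (transpose (M' h) ** lyap (M x) (S x) ** M x
                           + transpose (M x) ** lyap (M x) (S x) ** M' h)))) (at x)"
proof -
  define L where "L = lyap (M x) (S x)"
  define F where "F y = S y - S x + (transpose (M y) ** L ** M y - transpose (M x) ** L ** M x)" for y
  define F' where "F' h = S' h + (transpose (M' h) ** L ** M x + transpose (M x) ** L ** M' h)" for h
  have F: "(F has_derivative F') (at x)"
    unfolding F_def[abs_def] F'_def[abs_def]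
    by (rule has_derivative_eq_rhs)
      ((rule derivative_intros S M matrix_mult.FDERIV bounded_linear.has_derivative[OF bounded_linear_transpose])+,
       simp add: fun_eq_iff matrix_simps add_ac)
  then have blF: "bounded_linear F'" by (rule has_derivative_bounded_linear)
  have blL: "bounded_linear (\<lambda>h. lyap (M x) (F' h))"
    by (rule bounded_linear_compose[OF bounded_linear_lyap[OF st] blF])
  obtain k where k: "k > 0" "\<And>h. norm (F' h) \<le> norm h * k"
    using bounded_linear.pos_bounded[OF blF] by blast
  obtain \<epsilon> c where \<epsilon>: "\<epsilon> > 0" and c: "c \<ge> 0" and stN: "\<And>N. dist N (M x) < \<epsilon> \<Longrightarrow> stable N"
    and leN: "\<And>N S. dist N (M x) < \<epsilon> \<Longrightarrow> norm (lyap N S) \<le> c * norm S"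
    using stable_locally_uniform[OF st] by blast
  have contM: "continuous (at x) M" using M by (rule has_derivative_continuous)
  \<comment> \<open>The first term is the linearization error of \<open>F\<close>; the second is the
    change of the operator, a product of the small \<open>norm (M y - M x)\<close> with a quantity
    linear in \<open>h\<close>.\<close>
  have key: "norm (lyap (M y) (S y) - L - lyap (M x) (F' h)) \<le>
     c * norm (F y - F x - F' h) + c * (norm (M y - M x) * (norm (M y) + norm (M x)) * (c * norm (F' h)))"
    if y: "dist (M y) (M x) < \<epsilon>" for y h
  proof -
    note stN[OF y, intro]
    define X where "X = lyap (M x) (F' h)"
    have "norm X \<le> c * norm (F' h)" unfolding X_def by (rule leN) (use \<epsilon> in simp)
    have eq: "transpose (M y) ** X ** M y - transpose (M x) ** X ** M x
      = transpose (M y - M x) ** (X ** M y) + transpose (M x) ** (X ** (M y - M x))"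
      by (simp add: matrix_simps)
    have "norm (transpose (M y) ** X ** M y - transpose (M x) ** X ** M x)
        \<le> norm (M y - M x) * (norm X * norm (M y)) + norm (M x) * (norm X * norm (M y - M x))"
      unfolding eq
      by (intro norm_triangle_mono order_trans[OF norm_matrix_mult_le]) 
         (auto intro!: mult_left_mono norm_matrix_mult_le)
    also have "\<dots> = norm (M y - M x) * (norm (M y) + norm (M x)) * norm X"
      by (simp add: algebra_simps)
    also have "\<dots> \<le> norm (M y - M x) * (norm (M y) + norm (M x)) * (c * norm (F' h))"
      by (intro mult_left_mono) (use \<open>norm X \<le> _\<close> in auto)
    finally have 1: "norm (transpose (M y) ** X ** M y - transpose (M x) ** X ** M x)
       \<le> norm (M y - M x) * (norm (M y) + norm (M x)) * (c * norm (F' h))" .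
    have "lyap (M y) (S y) - L = lyap (M y) (F y)"
      unfolding L_def F_def using lyap_diff_left[OF st stN[OF y], of "S y" "S x"] by simp
    moreover have "lyap (M y) (F' h) - X = lyap (M y) (transpose (M y) ** X ** M y - transpose (M x) ** X ** M x)"
      unfolding X_def using lyap_diff_left[OF st stN[OF y], of "F' h" "F' h"] by simp
    moreover have "lyap (M y) (F y - F x - F' h) = lyap (M y) (F y) - lyap (M y) (F' h)"
      by (simp add: F_def lyap_diff[OF stN[OF y]])
    ultimately have "lyap (M y) (S y) - L - X = lyap (M y) (F y - F x - F' h)
        + lyap (M y) (transpose (M y) ** X ** M y - transpose (M x) ** X ** M x)"
      by (simp only:) (simp add: algebra_simps)
    also have "norm \<dots> \<le> c * norm (F y - F x - F' h) 
        + c * norm (transpose (M y) ** X ** M y - transpose (M x) ** X ** M x)"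
      by (intro norm_triangle_mono leN y)
    also have "\<dots> \<le> c * norm (F y - F x - F' h)
        + c * (norm (M y - M x) * (norm (M y) + norm (M x)) * (c * norm (F' h)))"
      using 1 c by (simp add: mult_left_mono)
    finally show ?thesis unfolding X_def .
  qed
  have "((\<lambda>y. lyap (M y) (S y)) has_derivative (\<lambda>h. lyap (M x) (F' h))) (at x)"
    unfolding has_derivative_at_alt
  proof (intro conjI allI impI blL)
    fix e :: real assume "e > 0"
    \<comment> \<open>\<open>a\<close> collects the constants of the second error once
      \<open>norm (M y)\<close> is at most \<open>norm (M x) + 1\<close>. Each error receives half
      of \<open>e\<close>; adding 1 to \<open>a\<close> and \<open>c\<close> keeps the denominators
      positive.\<close>
    define a where "a = c * ((2 * norm (M x) + 1) * (c * k))"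
    have a: "a \<ge> 0" using c k by (auto simp: a_def)
    have "e / (2 * (c + 1)) > 0" using c \<open>e > 0\<close> by simp
    then obtain d1 where d1: "d1 > 0"
      "\<And>y. norm (y - x) < d1 \<Longrightarrow> norm (F y - F x - F' (y - x)) \<le> e / (2 * (c + 1)) * norm (y - x)"
      using F unfolding has_derivative_at_alt by blast
    have "min (min \<epsilon> 1) (e / (2 * (a + 1))) > 0" using \<epsilon> a \<open>e > 0\<close> by simp
    then obtain d2 where d2: "d2 > 0" "\<And>y. dist y x < d2 \<Longrightarrow> dist (M y) (M x) < min (min \<epsilon> 1) (e / (2 * (a + 1)))"
      using contM unfolding continuous_at_eps_delta by metis
    show "\<exists>d>0. \<forall>y. norm (y - x) < d \<longrightarrow>
      norm (lyap (M y) (S y) - lyap (M x) (S x) - lyap (M x) (F' (y - x))) \<le> e * norm (y - x)"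
    proof (intro exI[of _ "min d1 d2"] conjI allI impI)
      show "min d1 d2 > 0" using d1 d2 by simp
      fix y assume y: "norm (y - x) < min d1 d2"
      then have My: "norm (M y - M x) < \<epsilon>" "norm (M y - M x) < 1" "norm (M y - M x) < e / (2 * (a + 1))"
        using d2(2)[of y] by (auto simp: dist_norm)
      have "norm (M y) \<le> norm (M x) + 1"
        using norm_triangle_ineq2[of "M y" "M x"] My(2) by linarith
      then have "c * (norm (M y - M x) * (norm (M y) + norm (M x)) * (c * norm (F' (y - x))))
         \<le> c * (norm (M y - M x) * (2 * norm (M x) + 1) * (c * (norm (y - x) * k)))"
        using c k(2)[of "y - x"] by (intro mult_left_mono mult_mono) auto
      also have "\<dots> = norm (M y - M x) * a * norm (y - x)"
        by (simp add: a_def algebra_simps)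
      also have "\<dots> \<le> e / 2 * norm (y - x)"
      proof (rule mult_right_mono)
        have "norm (M y - M x) * a \<le> e / (2 * (a + 1)) * (a + 1)"
          using My(3) a \<open>e > 0\<close> by (intro mult_mono) auto
        also have "\<dots> = e / 2" using a by (simp add: field_simps)
        finally show "norm (M y - M x) * a \<le> e / 2" .
      qed simp
      finally have 2: "c * (norm (M y - M x) * (norm (M y) + norm (M x)) * (c * norm (F' (y - x)))) \<le> e / 2 * norm (y - x)" .
      have "c * norm (F y - F x - F' (y - x)) \<le> (c + 1) * (e / (2 * (c + 1)) * norm (y - x))"
        using d1(2)[of y] y c by (intro mult_mono) auto
      also have "\<dots> = e / 2 * norm (y - x)" using c by (simp add: field_simps)
      finally show "norm (lyap (M y) (S y) - lyap (M x) (S x) - lyap (M x) (F' (y - x))) \<le> e * norm (y - x)"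
        using key[of y "y - x"] My(1) 2 unfolding L_def dist_norm by (auto simp: algebra_simps)
    qed
  qed
  then show ?thesis unfolding F'_def L_def .
qed

section \<open>Spectral radius and stability\<close>

lemma complex_eigenvalue_iff:
  "z \<in> complex_eigenvalues M \<longleftrightarrow> det (mat z - map_matrix complex_of_real M) = 0"
proof -
  let ?A = "map_matrix complex_of_real M"
  have mz: "mat z *v v = z *s v" for v :: "complex ^ 'n"
    by (simp add: vec_eq_iff matrix_vector_mult_def mat_def if_distrib[where f = "\<lambda>x. x * _"] cong: if_cong)
  have "det (mat z - ?A) \<noteq> 0 \<longleftrightarrow> (\<forall>v. (mat z - ?A) *v v = 0 \<longrightarrow> v = 0)"
    by (simp flip: invertible_det_nz matrix_left_invertible_ker add: invertible_left_inverse)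
  also have "\<dots> \<longleftrightarrow> z \<notin> complex_eigenvalues M"
    unfolding complex_eigenvalues_def matrix_vector_mult_diff_rdistrib mz by auto
  finally show ?thesis by blast
qed

text \<open>Away from 0, the zeros of det (1 - w A) are the reciprocals of the nonzero eigenvalues.
  Near \<open>w = 0\<close> the identity shows the characteristic polynomial at infinity.\<close>

lemma det_reciprocal:
  fixes A :: "complex ^ 'n ^ 'n"
  assumes "w \<noteq> 0"
  shows "det (\<chi> i j. (if i = j then 1 else 0) - w * A $ i $ j) = w ^ CARD('n) * det (mat (1 / w) - A)"
proof -
  have "(\<chi> i j. (if i = j then 1 else 0) - w * A $ i $ j) = (\<chi> i. w *s (mat (1 / w) - A) $ i)"
    using assms by (simp add: vec_eq_iff mat_def algebra_simps)
  then show ?thesis using det_rows_mul[of "\<lambda>i. w" "\<lambda>i. (mat (1 / w) - A) $ i"]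
    by (simp only: prod_constant vec_lambda_eta)
qed

text \<open>Makes the \<open>Max\<close> in \<open>spectral_radius\<close> meaningful. The reversed
  characteristic polynomial \<open>g\<close> tends to 1 at 0, because the characteristic polynomial
  \<open>p\<close> is monic of degree \<open>CARD('n)\<close>; if \<open>p\<close> were zero or
  constant, \<open>g\<close> would tend to 0.\<close>

lemma
  fixes M :: "real ^ 'n ^ 'n"
  shows finite_complex_eigenvalues: "finite (complex_eigenvalues M)"
    and complex_eigenvalues_nonempty: "complex_eigenvalues M \<noteq> {}"
proof -
  let ?A = "map_matrix complex_of_real M"
  define p :: "complex poly" where "p = det (\<chi> i j. [: - (?A $ i $ j), if i = j then 1 else 0 :])"
  define g where "g w = det (\<chi> i j. (if i = j then 1 else 0) - w * ?A $ i $ j)" for w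
  have p: "poly p z = det (mat z - ?A)" for z
    unfolding p_def det_def
    by (auto simp: poly_sum poly_prod mat_def intro!: sum.cong prod.cong)
  have eig: "complex_eigenvalues M = {z. poly p z = 0}"
    by (auto simp: p complex_eigenvalue_iff)
  have g: "g w = w ^ CARD('n) * poly p (1 / w)" if "w \<noteq> 0" for w
    using det_reciprocal[OF that, of ?A] by (simp add: g_def p)
  have "isCont g 0"
    unfolding g_def det_def by (simp, intro continuous_intros)
  then have lim: "(g \<longlongrightarrow> 1) (at 0)"
  proof -
    have "g 0 = det (mat 1 :: complex ^ 'n ^ 'n)" by (simp add: g_def mat_def)
    then show ?thesis using \<open>isCont g 0\<close> by (simp add: isCont_def)
  qed
  show "finite (complex_eigenvalues M)"
    unfolding eig
  proof (rule poly_roots_finite)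
    show "p \<noteq> 0"
    proof
      assume "p = 0"
      then have "eventually (\<lambda>w. g w = 0) (at 0)"
        by (auto simp: eventually_at_filter g)
      then have "(g \<longlongrightarrow> 0) (at 0)" by (rule tendsto_eventually)
      from tendsto_unique[OF _ lim this] show False by simp
    qed
  qed
  show "complex_eigenvalues M \<noteq> {}"
  proof
    assume "complex_eigenvalues M = {}"
    then have "constant (poly p)" using Fundamental_Theorem_Algebra.fundamental_theorem_of_algebra[of p] by (auto simp: eig)
    then have const: "poly p z = poly p 0" for z unfolding constant_def by simp
    have "eventually (\<lambda>w. w ^ CARD('n) * poly p 0 = g w) (at 0)"
      unfolding eventually_at_filter by (intro always_eventually allI impI) (simp add: g const[of "1 / _"])
    moreover have "((\<lambda>w :: complex. w ^ CARD('n) * poly p 0) \<longlongrightarrow> 0 ^ CARD('n) * poly p 0) (at 0)"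
      by (intro tendsto_intros)
    ultimately have "(g \<longlongrightarrow> 0 ^ CARD('n) * poly p 0) (at 0)"
      by (rule Lim_transform_eventually[rotated])
    from tendsto_unique[OF _ lim this] show False by (simp add: zero_power)
  qed
qed

lemma spectral_radius_less_iff: "spectral_radius M < r \<longleftrightarrow> (\<forall>z \<in> complex_eigenvalues M. cmod z < r)"
  unfolding spectral_radius_def
  by (simp add: finite_complex_eigenvalues complex_eigenvalues_nonempty)

lemma finite_real_eigenvalues: "finite (real_eigenvalues (M :: real ^ 'n ^ 'n))"
proof (rule finite_imageD[where f = complex_of_real])
  have "of_real c \<in> complex_eigenvalues M" if c: "c \<in> real_eigenvalues M" for c
  proof -
    from c obtain v where v: "v \<noteq> 0" "M *v v = c *\<^sub>R v" unfolding real_eigenvalues_def by blast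
    let ?v = "\<chi> i. complex_of_real (v $ i)"
    have "map_matrix complex_of_real M *v ?v = of_real c *s ?v"
      using arg_cong[OF v(2), of "\<lambda>u. \<chi> i. complex_of_real (u $ i)"]
      by (simp add: vec_eq_iff matrix_vector_mult_def)
    moreover have "?v \<noteq> 0" using v(1) by (auto simp: vec_eq_iff)
    ultimately show ?thesis unfolding complex_eigenvalues_def by blast
  qed
  then show "finite (complex_of_real ` real_eigenvalues M)"
    using finite_complex_eigenvalues[of M] by (meson finite_subset image_subsetI)
qed (simp add: inj_on_def)

lemma map_matrix_mpow:
  "mpow (map_matrix complex_of_real M) t = map_matrix complex_of_real (mpow M t)"
  by (induction t) (auto simp: vec_eq_iff matrix_matrix_mult_def mat_def)

text \<open>A nonzero coefficient of positive index would make 0 an isolated zero of the sum, but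
  the sum vanishes on a disc.\<close>

lemma powser_zero_coeff:
  fixes a :: "nat \<Rightarrow> complex"
  assumes r: "r > 0" and s: "\<And>w. norm w < r \<Longrightarrow> (\<lambda>n. a n * w ^ n) sums 0"
  shows "a m = 0"
proof (cases "m = 0")
  case True
  have "(\<lambda>n. a n * 0 ^ n) sums 0" using s[of 0] r by simp
  then show ?thesis using powser_sums_zero_iff[of a 0] True by simp
next
  case False
  show ?thesis
  proof (rule ccontr)
    assume am: "a m \<noteq> 0"
    show False
    proof (rule powser_0_nonzero[OF r, of 0 a "\<lambda>_. 0" m])
      show "(\<lambda>n. a n * (w - 0) ^ n) sums 0" if "norm (w - 0) < r" for w
        using s that by simp
      fix e :: real
      assume "0 < e" "\<And>z :: complex. z \<in> cball 0 e - {0} \<Longrightarrow> (0 :: complex) \<noteq> 0"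
      from this(2)[of "of_real e"] this(1) show False by simp
    qed (use am False in auto)
  qed
qed

text \<open>By Cramer's rule the entries of \<open>(1 - w A)\<inverse>\<close> are holomorphic on the disc of radius \<open>R\<close>, and their
  Taylor coefficients are the entries of the powers of \<open>A\<close>.\<close>

lemma summable_mpow_component:
  fixes A :: "complex ^ 'n ^ 'n"
  assumes R: "R > 1" and nz: "\<And>w. norm w < R \<Longrightarrow> det (\<chi> i j. (if i = j then 1 else 0) - w * A $ i $ j) \<noteq> 0"
  shows "summable (\<lambda>t. norm (mpow A t $ i $ j))"
proof -
  define T where "T w = (\<chi> i j. (if i = j then 1 else 0) - w * A $ i $ j)" for w
  define f where "f k w = det (\<chi> i l. if l = k then (axis j 1 :: complex ^ 'n) $ i else T w $ i $ l) / det (T w)" for k w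
  define a where "a k t = (deriv ^^ t) (f k) 0 / fact t" for k t
  have cont: "(\<lambda>w. if P then c else (if Q then 1 else 0) - w * d) holomorphic_on X" for P Q X and c d :: complex
    by (cases P; cases Q) (auto intro!: holomorphic_intros)
  have "f k holomorphic_on ball 0 R" for k
    unfolding f_def
  proof (rule holomorphic_on_divide)
    show "(\<lambda>w. det (\<chi> i l. if l = k then (axis j 1 :: complex ^ 'n) $ i else T w $ i $ l)) holomorphic_on ball 0 R"
      unfolding det_def T_def by (simp cong: if_cong, intro holomorphic_intros cont)
    have "(\<lambda>w. det (T w)) holomorphic_on ball 0 R"
      unfolding det_def T_def using cont[where P = False] by (simp, intro holomorphic_intros)
    then show "(\<lambda>w. det (T w)) holomorphic_on ball 0 R" .
    show "\<And>w. w \<in> ball 0 R \<Longrightarrow> det (T w) \<noteq> 0" using nz by (simp add: T_def)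
  qed
  then have sums: "(\<lambda>t. a k t * w ^ t) sums f k w" if "norm w < R" for k w
    using holomorphic_power_series[of "f k" 0 R w] that by (simp add: a_def)
  have sol: "f k w - w * (\<Sum>l\<in>UNIV. A $ k $ l * f l w) = axis j 1 $ k" if "norm w < R" for k w
  proof -
    have "T w *v (\<chi> k. f k w) = axis j 1"
      using cramer[of "T w" "\<chi> k. f k w" "axis j 1"] nz[OF that] by (simp add: f_def flip: T_def)
    then have "(T w *v (\<chi> k. f k w)) $ k = axis j 1 $ k" by simp
    then show ?thesis
      by (simp add: T_def matrix_vector_mult_def left_diff_distrib sum_subtractf sum_distrib_left
          if_distrib[where f = "\<lambda>x. x * _"] mult.assoc cong: if_cong)
  qed
  \<comment> \<open>\<open>b\<close> lists the Taylor coefficients of (1 - w A) f - e_j. Their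
    vanishing is the recursion satisfied by the j-th columns of the powers of
    \<open>A\<close>.\<close>
  define b where "b k t = (case t of 0 \<Rightarrow> a k 0 - axis j 1 $ k | Suc t \<Rightarrow> a k (Suc t) - (\<Sum>l\<in>UNIV. A $ k $ l * a l t))" for k t
  have "b k m = 0" for k m
  proof (rule powser_zero_coeff[of R])
    fix w :: complex assume w: "norm w < R"
    have "(\<lambda>t. \<Sum>l\<in>UNIV. A $ k $ l * (a l t * w ^ t)) sums (\<Sum>l\<in>UNIV. A $ k $ l * f l w)"
      by (intro sums_sum sums_mult sums w)
    then have "(\<lambda>t. w * (\<Sum>l\<in>UNIV. A $ k $ l * (a l t * w ^ t))) sums (w * (\<Sum>l\<in>UNIV. A $ k $ l * f l w))"
      by (rule sums_mult)
    moreover have "(\<lambda>t. a k (Suc t) * w ^ (Suc t)) sums (f k w - a k 0)"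
      using sums[OF w, of k] by (subst sums_Suc_iff) simp
    ultimately have "(\<lambda>t. a k (Suc t) * w ^ (Suc t) - w * (\<Sum>l\<in>UNIV. A $ k $ l * (a l t * w ^ t)))
       sums (f k w - a k 0 - w * (\<Sum>l\<in>UNIV. A $ k $ l * f l w))"
      by (rule sums_diff[rotated])
    also have "(\<lambda>t. a k (Suc t) * w ^ (Suc t) - w * (\<Sum>l\<in>UNIV. A $ k $ l * (a l t * w ^ t))) = (\<lambda>t. b k (Suc t) * w ^ Suc t)"
      by (simp add: fun_eq_iff b_def sum_distrib_left sum_distrib_right algebra_simps)
    also have "f k w - a k 0 - w * (\<Sum>l\<in>UNIV. A $ k $ l * f l w) = 0 - b k 0 * w ^ 0"
      using sol[OF w, of k] by (simp add: b_def)
    finally show "(\<lambda>t. b k t * w ^ t) sums 0"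
      by (subst (asm) sums_Suc_iff) simp
  qed (use R in simp)
  then have b0: "b k t = 0" for k t by blast
  have "a k t = mpow A t $ k $ j" for k t
  proof (induction t arbitrary: k)
    case 0
    show ?case using b0[of k 0] by (simp add: b_def mat_def axis_def)
  next
    case (Suc t)
    show ?case using b0[of k "Suc t"]
      by (simp add: b_def mpow_Suc_left matrix_matrix_mult_def Suc del: mpow.simps)
  qed
  \<comment> \<open>Convergence at a point \<open>r\<close> beyond 1 gives absolute convergence at
    1.\<close>
  moreover obtain r where r: "1 < r" "r < R" using R dense by blast
  have "summable (\<lambda>t. a i t * of_real r ^ t)"
    using sums[of "of_real r" i] r by (auto intro: sums_summable)
  then have "summable (\<lambda>t. norm (a i t * 1 ^ t))"
    by (rule powser_insidea) (use r in simp)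
  ultimately show ?thesis by simp
qed

text \<open>If the powers tend to 0, they do so on every eigenvector, which forces the eigenvalue
  into the open unit disc. Conversely the resolvent is holomorphic on a disc of radius greater than
  1, so the powers are absolutely summable and, being eventually below 1 in norm, also square
  summable.\<close>

lemma stable_iff_spectral_radius: "stable M \<longleftrightarrow> spectral_radius M < 1" for M :: "real ^ 'n ^ 'n"
proof
  let ?A = "map_matrix complex_of_real M"
  assume "stable M"
  then have "(\<lambda>t. (norm (mpow M t))\<^sup>2) \<longlonglongrightarrow> 0"
    unfolding stable_def by (rule summable_LIMSEQ_zero)
  then have "(\<lambda>t. mpow M t) \<longlonglongrightarrow> 0"
    using tendsto_real_sqrt[of "\<lambda>t. (norm (mpow M t))\<^sup>2" 0] by (simp add: tendsto_norm_zero_iff)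
  then have lim: "(\<lambda>t. complex_of_real (mpow M t $ i $ j)) \<longlonglongrightarrow> 0" for i j
    using tendsto_of_real[OF tendsto_vec_nth[OF tendsto_vec_nth]] by fastforce
  show "spectral_radius M < 1"
    unfolding spectral_radius_less_iff
  proof (intro ballI)
    fix z assume "z \<in> complex_eigenvalues M"
    then obtain v where v: "v \<noteq> 0" "?A *v v = z *s v" unfolding complex_eigenvalues_def by blast
    then obtain i where i: "v $ i \<noteq> 0" by (auto simp: vec_eq_iff)
    have pow: "mpow ?A t *v v = z ^ t *s v" for t
    proof (induction t)
      case (Suc t)
      have "mpow ?A (Suc t) *v v = ?A *v (mpow ?A t *v v)"
        unfolding mpow_Suc_left by (simp add: matrix_vector_mul_assoc)
      then show ?case using Suc v(2) by (simp add: vector_scalar_commute vector_smult_assoc)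
    qed simp
    have "(\<lambda>t. \<Sum>j\<in>UNIV. complex_of_real (mpow M t $ i $ j) * v $ j) \<longlonglongrightarrow> (\<Sum>j\<in>UNIV. 0 * v $ j)"
      by (intro tendsto_sum tendsto_mult lim tendsto_const)
    then have "(\<lambda>t. (mpow ?A t *v v) $ i) \<longlonglongrightarrow> 0"
      unfolding map_matrix_mpow matrix_vector_mult_def by simp
    then have "(\<lambda>t. norm (z ^ t * v $ i)) \<longlonglongrightarrow> 0"
      unfolding pow by (simp add: tendsto_norm_zero)
    then have "eventually (\<lambda>t. norm (z ^ t * v $ i) < norm (v $ i)) sequentially"
      by (rule order_tendstoD) (use i in simp)
    then obtain t where "norm (z ^ t * v $ i) < norm (v $ i)"
      by (meson eventually_sequentially order_refl)
    then have "cmod z ^ t < 1" using i by (simp add: norm_mult norm_power)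
    then show "cmod z < 1" using one_le_power[of "cmod z" t] by linarith
  qed
next
  let ?A = "map_matrix complex_of_real M"
  assume \<rho>: "spectral_radius M < 1"
  have \<rho>0: "spectral_radius M \<ge> 0"
    using \<rho> complex_eigenvalues_nonempty[of M] spectral_radius_less_iff[of M 0]
    by (meson equals0I norm_ge_zero not_less)
  \<comment> \<open>\<open>1 / R\<close> is the midpoint between the spectral radius and 1.\<close>
  define R where "R = 2 / (1 + spectral_radius M)"
  have R: "R > 1" "spectral_radius M < 1 / R" using \<rho> \<rho>0 by (auto simp: R_def field_simps)
  have "det (\<chi> i j. (if i = j then 1 else 0) - w * ?A $ i $ j) \<noteq> 0" if w: "norm w < R" for w
  proof (cases "w = 0")
    case True
    have "det (mat 1 :: complex ^ 'n ^ 'n) \<noteq> 0" by simp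
    then show ?thesis using True by (simp add: mat_def)
  next
    case False
    have "1 / w \<notin> complex_eigenvalues M"
    proof
      assume "1 / w \<in> complex_eigenvalues M"
      then have "cmod (1 / w) < 1 / R" using R(2) unfolding spectral_radius_less_iff by blast
      then show False using w False R(1) by (simp add: norm_divide field_simps)
    qed
    then show ?thesis using det_reciprocal[OF False, of ?A] False by (simp add: complex_eigenvalue_iff)
  qed
  then have "summable (\<lambda>t. norm (mpow ?A t $ i $ j))" for i j
    by (rule summable_mpow_component[OF R(1)])
  then have "summable (\<lambda>t. \<Sum>i\<in>UNIV. \<Sum>j\<in>UNIV. \<bar>mpow M t $ i $ j\<bar>)"
    unfolding map_matrix_mpow by (intro summable_sum) simp
  then have s: "summable (\<lambda>t. norm (mpow M t))"
  proof (rule summable_comparison_test'[where N = 0])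
    show "norm (norm (mpow M t)) \<le> (\<Sum>i\<in>UNIV. \<Sum>j\<in>UNIV. \<bar>mpow M t $ i $ j\<bar>)" for t
    proof -
      have "norm (mpow M t) \<le> (\<Sum>i\<in>UNIV. norm (mpow M t $ i))"
        unfolding norm_vec_def[of "mpow M t"] by (rule L2_set_le_sum) simp
      also have "\<dots> \<le> (\<Sum>i\<in>UNIV. \<Sum>j\<in>UNIV. \<bar>mpow M t $ i $ j\<bar>)"
        by (intro sum_mono norm_le_l1_cart)
      finally show ?thesis by simp
    qed
  qed
  have "eventually (\<lambda>t. norm (mpow M t) < 1) sequentially"
    using summable_LIMSEQ_zero[OF s] by (rule order_tendstoD) simp
  then have "eventually (\<lambda>t. norm ((norm (mpow M t))\<^sup>2) \<le> norm (mpow M t)) sequentially"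
    by (rule eventually_mono) (simp add: power2_eq_square mult_left_le)
  then show "stable M"
    unfolding stable_def by (rule summable_comparison_test_ev[OF _ s])
qed

section \<open>Smallest eigenvalues\<close>

text \<open>Take a minimizer \<open>v\<close> of the form on the unit sphere, with value
  \<open>c\<close>. Then \<open>S - c *\<^sub>R mat 1\<close> is positive semidefinite and its form
  vanishes at \<open>v\<close>; Cauchy--Schwarz turns this into the eigenvector equation.\<close>

lemma symmetric_min_eigenvalue:
  fixes S :: "real ^ 'n ^ 'n"
  assumes sym: "transpose S = S"
  obtains c v where "norm v = 1" "S *v v = c *\<^sub>R v" "\<And>x. c * (norm x)\<^sup>2 \<le> x \<bullet> (S *v x)"
proof -
  have "axis undefined 1 \<in> (sphere 0 1 :: (real ^ 'n) set)" by simp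
  then have "sphere 0 1 \<noteq> ({} :: (real ^ 'n) set)" by blast
  moreover have "continuous_on (sphere 0 1) (\<lambda>x. x \<bullet> (S *v x))"
    by (intro continuous_intros)
  ultimately obtain v where v: "v \<in> sphere 0 1" "\<And>x. x \<in> sphere 0 1 \<Longrightarrow> v \<bullet> (S *v v) \<le> x \<bullet> (S *v x)"
    using continuous_attains_inf[OF compact_sphere, of 0 1 "\<lambda>x. x \<bullet> (S *v x)"] by blast
  define c where "c = v \<bullet> (S *v v)"
  have le: "c * (norm x)\<^sup>2 \<le> x \<bullet> (S *v x)" for x
  proof (cases "x = 0")
    case False
    then have "c \<le> (x /\<^sub>R norm x) \<bullet> (S *v (x /\<^sub>R norm x))"
      unfolding c_def by (intro v) simp
    then show ?thesis using False 
      by (simp add: matrix_vector_mult_scaleR field_simps power2_eq_square)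
  qed simp
  define T where "T = S - c *\<^sub>R mat 1"
  have Tv: "T *v x = S *v x - c *\<^sub>R x" for x
    by (simp add: T_def matrix_vector_mult_diff_rdistrib matrix_vector_scaleR)
  have "psd T"
    unfolding psd_def using sym le
    by (auto simp: T_def transpose_diff transpose_scalar matrix_vector_mult_diff_rdistrib
        matrix_vector_scaleR inner_diff_right power2_norm_eq_inner)
  then have "((T *v v) \<bullet> (T *v v))\<^sup>2 \<le> ((T *v v) \<bullet> (T *v (T *v v))) * (v \<bullet> (T *v v))"
    by (rule psd_Cauchy_Schwarz)
  also have "v \<bullet> (T *v v) = 0"
    using v(1) by (simp add: Tv inner_diff_right c_def flip: power2_norm_eq_inner)
  finally have "T *v v = 0" by simp
  then show ?thesis using v(1) le by (intro that[of v c]) (auto simp: Tv)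
qed

lemma lambda_min_le:
  fixes S :: "real ^ 'n ^ 'n"
  assumes "transpose S = S"
  shows "lambda_min S * (norm x)\<^sup>2 \<le> x \<bullet> (S *v x)"
proof -
  obtain c v where c: "norm v = 1" "S *v v = c *\<^sub>R v" "\<And>x. c * (norm x)\<^sup>2 \<le> x \<bullet> (S *v x)"
    using symmetric_min_eigenvalue[OF assms] by blast
  have "c \<in> real_eigenvalues S" using c(1,2) unfolding real_eigenvalues_def by (intro CollectI exI[of _ v]) auto
  then have "lambda_min S \<le> c" unfolding lambda_min_def by (simp add: finite_real_eigenvalues)
  then have "lambda_min S * (norm x)\<^sup>2 \<le> c * (norm x)\<^sup>2" by (rule mult_right_mono) simp
  then show ?thesis using c(3)[of x] by linarith
qed

text \<open>The least eigenvalue \<open>c\<close> of \<open>S\<close> has its square among the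
  eigenvalues of \<open>transpose S ** S\<close>, whence \<open>sigma_min S \<le> c\<close>; this
  inequality suffices for the lower bound on the form.\<close>

lemma
  fixes S :: "real ^ 'n ^ 'n"
  assumes "pos_def S"
  shows sigma_min_pos: "0 < sigma_min S"
    and sigma_min_le: "sigma_min S * (norm x)\<^sup>2 \<le> x \<bullet> (S *v x)"
proof -
  have sym: "transpose S = S" using assms by (simp add: pos_def_def)
  obtain c v where c: "norm v = 1" "S *v v = c *\<^sub>R v" "\<And>x. c * (norm x)\<^sup>2 \<le> x \<bullet> (S *v x)"
    using symmetric_min_eigenvalue[OF sym] by blast
  have "v \<noteq> 0" using c(1) by auto
  then have "0 < v \<bullet> (S *v v)" using assms by (simp add: pos_def_def)
  then have "c > 0" using c(1,2) by (simp flip: power2_norm_eq_inner)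
  let ?E = "real_eigenvalues (transpose S ** S)"
  have "(transpose S ** S) *v v = c\<^sup>2 *\<^sub>R v"
    using c(2) by (simp add: sym matrix_vector_mult_scaleR power2_eq_square flip: matrix_vector_mul_assoc)
  then have mem: "c\<^sup>2 \<in> ?E" using c(1) unfolding real_eigenvalues_def by (intro CollectI exI[of _ v]) auto
  then have "c \<in> sqrt ` ?E" using \<open>c > 0\<close> by (intro image_eqI[of _ _ "c\<^sup>2"]) simp_all
  then have "sigma_min S \<le> c"
    unfolding sigma_min_def by (simp add: finite_real_eigenvalues)
  then have "sigma_min S * (norm x)\<^sup>2 \<le> c * (norm x)\<^sup>2" by (rule mult_right_mono) simp
  then show "sigma_min S * (norm x)\<^sup>2 \<le> x \<bullet> (S *v x)" using c(3)[of x] by linarith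
  have "0 < e" if e: "e \<in> ?E" for e
  proof -
    obtain u where u: "u \<noteq> 0" "(transpose S ** S) *v u = e *\<^sub>R u"
      using e unfolding real_eigenvalues_def by auto
    have "0 < u \<bullet> (S *v u)" using assms u(1) by (simp add: pos_def_def)
    then have "S *v u \<noteq> 0" by auto
    then have "0 < (S *v u) \<bullet> (S *v u)" by simp
    also have "\<dots> = u \<bullet> (e *\<^sub>R u)" unfolding inner_mult_vec[symmetric] u(2) ..
    finally show ?thesis using inner_ge_zero[of u] by (simp add: zero_less_mult_iff not_less[symmetric] del: inner_ge_zero)
  qed
  then show "0 < sigma_min S"
    unfolding sigma_min_def using mem by (subst Min_gr_iff) (auto simp: finite_real_eigenvalues)
qed

section \<open>The cost and its derivatives\<close>

text \<open>Differentiating \<open>transpose M ** S ** M\<close> produces a term together with its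
  transpose; \<open>symm\<close> groups the two.\<close>

definition symm :: "real ^ 'n ^ 'n \<Rightarrow> real ^ 'n ^ 'n" where
  "symm S = S + transpose S"

lemma transpose_symm [simp]: "transpose (symm S) = symm S"
  by (simp add: symm_def transpose_add add.commute)

lemma quadratic_form_symm: "x \<bullet> (symm S *v x) = 2 * (x \<bullet> (S *v x))"
proof -
  have "x \<bullet> (transpose S *v x) = x \<bullet> (S *v x)"
    by (metis inner_commute inner_transpose_vec)
  then show ?thesis by (simp add: symm_def matrix_vector_mult_add_rdistrib inner_add_right)
qed

locale sof =
  fixes A :: "real ^ 'n ^ 'n" and B :: "real ^ 'm ^ 'n" and C :: "real ^ 'n ^ 'd"
    and Q :: "real ^ 'n ^ 'n" and R :: "real ^ 'm ^ 'm" and D :: "(real ^ 'n) measure"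
  assumes Q: "pos_def Q" and R: "pos_def R"
    and outer: "integrable D outer" and X0: "pos_def (second_moment D)"
begin

abbreviation "X \<equiv> second_moment D"
abbreviation "J \<equiv> cost A B C Q R D"
abbreviation "cl \<equiv> closed_loop A B C"

definition "QK K = Q + transpose C ** transpose K ** R ** K ** C"
definition "P K = lyap (cl K) (QK K)"
definition "Y Z = B ** Z ** C"
text \<open>For stable \<open>cl K\<close> this is the expected sum of
  \<open>x_t \<bullet> (S *v x_t)\<close> along the closed loop; \<open>\<Phi> K (mat 1)\<close> is
  the total expected energy of the state.\<close>

definition "\<Phi> K S = lyap (cl K) S \<bullet> X"

text \<open>\<open>P1 K Z\<close> and \<open>P2 K Z W\<close> are the first two derivatives of \<open>P\<close> at \<open>K\<close> in the directions \<open>Z\<close> and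
  \<open>Z, W\<close>. The sources \<open>S1\<close>, \<open>S2\<close>, \<open>S3\<close> come from differentiating \<open>P = QK + cl\<^sup>T P cl\<close>, where \<open>cl\<close> has
  derivative \<open>-Y\<close>; \<open>S3 K Z W\<close> is only needed for the directions \<open>Z, Z, W\<close>.\<close>

definition "S1 K Z = symm (transpose C ** transpose Z ** R ** K ** C - transpose (Y Z) ** P K ** cl K)"
definition "P1 K Z = lyap (cl K) (S1 K Z)"
definition "S2 K Z W = symm (transpose C ** transpose Z ** R ** W ** C + transpose (Y Z) ** P K ** Y W
  - transpose (Y Z) ** P1 K W ** cl K - transpose (Y W) ** P1 K Z ** cl K)"
definition "P2 K Z W = lyap (cl K) (S2 K Z W)"
definition "S3 K Z W = symm (transpose (Y Z) ** P1 K W ** Y Z - 2 *\<^sub>R (transpose (Y Z) ** P2 K Z W ** cl K)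
  + 2 *\<^sub>R (transpose (Y Z) ** P1 K Z ** Y W) - transpose (Y W) ** P2 K Z Z ** cl K)"

lemma stabilizing_iff: "K \<in> stabilizing A B C \<longleftrightarrow> stable (cl K)"
  by (simp add: stabilizing_def stable_iff_spectral_radius)

lemma Q_sym [simp]: "transpose Q = Q" and R_sym [simp]: "transpose R = R" and X_sym [simp]: "transpose X = X"
  using Q R X0 by (auto simp: pos_def_def)

lemma psd_Q: "psd Q" and psd_R: "psd R"
  using Q R unfolding pos_def_def psd_def by (metis inner_zero_left less_imp_le order_refl)+

lemma psd_QK: "psd (QK K)"
proof -
  have "transpose (K ** C) ** R ** (K ** C) = transpose C ** transpose K ** R ** K ** C"
    by (simp add: matrix_simps)
  then show ?thesis unfolding QK_def using psd_add[OF psd_Q psd_conj[OF psd_R, of "K ** C"]] by simp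
qed

lemma QK_sym [simp]: "transpose (QK K) = QK K"
  using psd_QK by (simp add: psd_def)

lemma quadratic_form_QK: "x \<bullet> (QK K *v x) = x \<bullet> (Q *v x) + (K *v (C *v x)) \<bullet> (R *v (K *v (C *v x)))"
proof -
  have "transpose (K ** C) ** R ** (K ** C) = transpose C ** transpose K ** R ** K ** C"
    by (simp add: matrix_simps)
  then show ?thesis
    unfolding QK_def using inner_conj_vec[of x "K ** C" R "K ** C" x]
    by (simp add: matrix_vector_mult_add_rdistrib inner_add_right matrix_vector_mul_assoc)
qed

lemma cl_has_derivative: "(cl has_derivative (\<lambda>W. - Y W)) (at K)"
proof -
  have "((\<lambda>K. A - B ** K ** C) has_derivative (\<lambda>W. 0 - B ** W ** C)) (at K)"
    by (intro derivative_intros bounded_linear_imp_has_derivative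
        bounded_linear_compose[OF matrix_mult.bounded_linear_left matrix_mult.bounded_linear_right])
  then show ?thesis by (simp add: Y_def closed_loop_def[abs_def])
qed

lemma continuous_cl: "continuous_on UNIV cl"
  by (simp add: continuous_on_eq_continuous_within has_derivative_continuous[OF cl_has_derivative])

lemma open_stabilizing: "open (stabilizing A B C)"
proof -
  have "stabilizing A B C = cl -` {M. stable M}" by (auto simp: stabilizing_iff)
  then show ?thesis using open_vimage[OF open_stable continuous_cl] by simp
qed

lemma integral_quadratic_form: "(\<integral>x. x \<bullet> (S *v x) \<partial>D) = S \<bullet> X"
  and integrable_quadratic_form: "integrable D (\<lambda>x. x \<bullet> (S *v x))"
  unfolding inner_outer[symmetric] second_moment_def using outer by auto

lemma cost_eq:
  assumes "stable (cl K)"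
  shows "J K = P K \<bullet> X"
proof -
  have "(\<Sum>t. let x = ((\<lambda>x. cl K *v x) ^^ t) x0 in x \<bullet> ((Q + transpose C ** transpose K ** R ** K ** C) *v x))
     = x0 \<bullet> (P K *v x0)" for x0
    unfolding P_def QK_def[symmetric] Let_def funpow_matrix
    by (rule sums_unique[OF lyap_quadratic_form[OF assms], symmetric])
  then show ?thesis unfolding cost_def by (simp add: integral_quadratic_form)
qed

lemma cost_eq_Phi: "stable (cl K) \<Longrightarrow> J K = \<Phi> K (QK K)"
  by (simp add: cost_eq P_def \<Phi>_def)

lemma inner_X_nonneg: "psd S \<Longrightarrow> 0 \<le> S \<bullet> X"
  unfolding integral_quadratic_form[symmetric] by (rule Bochner_Integration.integral_nonneg) (simp add: psd_def)

lemma mu_pos: "0 < mu D"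
  unfolding mu_def by (rule sigma_min_pos[OF X0])

text \<open>Integrate \<open>(x \<bullet> S y)\<^sup>2 \<le> (x \<bullet> S x) (y \<bullet> S y)\<close> over \<open>y\<close>.\<close>

lemma mu_le_inner_X:
  assumes "psd S"
  shows "mu D * (x \<bullet> (S *v x)) \<le> (S \<bullet> X) * (norm x)\<^sup>2"
proof -
  define u where "u = S *v x"
  define s where "s = x \<bullet> u"
  have s0: "s \<ge> 0" using assms by (simp add: psd_def s_def u_def)
  have sym: "transpose S = S" using assms by (simp add: psd_def)
  have outer_u: "outer u \<bullet> outer y = (u \<bullet> y)\<^sup>2" for y
    unfolding inner_outer outer_def
    by (simp add: inner_vec_def matrix_vector_mult_def power2_eq_square sum_product sum_distrib_left algebra_simps)
  have "mu D * (norm u)\<^sup>2 \<le> u \<bullet> (X *v u)"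
    unfolding mu_def by (rule sigma_min_le[OF X0])
  also have "\<dots> = outer u \<bullet> X" by (simp add: inner_outer[symmetric] inner_commute)
  also have "\<dots> = (\<integral>y. outer u \<bullet> outer y \<partial>D)" unfolding inner_outer integral_quadratic_form ..
  also have "\<dots> \<le> (\<integral>y. s * (y \<bullet> (S *v y)) \<partial>D)"
  proof (rule integral_mono)
    show "integrable D (\<lambda>y. outer u \<bullet> outer y)" unfolding inner_outer by (rule integrable_quadratic_form)
    show "integrable D (\<lambda>y. s * (y \<bullet> (S *v y)))" using integrable_quadratic_form[of S] by simp
    show "outer u \<bullet> outer y \<le> s * (y \<bullet> (S *v y))" for y
      using psd_Cauchy_Schwarz[OF assms, of x y]
      unfolding outer_u by (simp add: s_def u_def inner_symmetric[OF sym, of x y] inner_commute)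
  qed
  also have "\<dots> = s * (S \<bullet> X)" by (simp add: integral_quadratic_form)
  finally have 1: "mu D * (norm u)\<^sup>2 \<le> s * (S \<bullet> X)" .
  have "s\<^sup>2 \<le> (norm x)\<^sup>2 * (norm u)\<^sup>2"
    unfolding s_def using Cauchy_Schwarz_ineq[of x u] by (simp add: power2_norm_eq_inner)
  then have "mu D * s\<^sup>2 \<le> (norm x)\<^sup>2 * (mu D * (norm u)\<^sup>2)"
    using mu_pos by (simp add: algebra_simps)
  also have "\<dots> \<le> (norm x)\<^sup>2 * (s * (S \<bullet> X))" by (rule mult_left_mono[OF 1]) simp
  finally have "s * (mu D * s) \<le> s * ((S \<bullet> X) * (norm x)\<^sup>2)" by (simp add: power2_eq_square algebra_simps)
  then have "s = 0 \<or> mu D * s \<le> (S \<bullet> X) * (norm x)\<^sup>2"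
    using s0 mult_le_cancel_left_pos[of s] by (auto simp: order_le_less)
  then show ?thesis
    using inner_X_nonneg[OF assms] by (auto simp: s_def u_def)
qed

lemma has_derivative_QK:
  "(QK has_derivative (\<lambda>Z. symm (transpose C ** transpose Z ** R ** K ** C))) (at K)"
  unfolding QK_def[abs_def]
  by (rule has_derivative_eq_rhs)
    ((rule derivative_intros matrix_mult.FDERIV bounded_linear.has_derivative[OF bounded_linear_transpose])+,
      simp add: fun_eq_iff symm_def matrix_simps add_ac)

context
  fixes K :: "real ^ 'd ^ 'm"
  assumes stable: "stable (cl K)"
begin

lemma P_sym [simp]: "transpose (P K) = P K"
  unfolding P_def lyap_transpose[OF stable, symmetric] by simp

lemma P1_sym [simp]: "transpose (P1 K Z) = P1 K Z"
  unfolding P1_def lyap_transpose[OF stable, symmetric] by (simp add: S1_def)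

lemma P2_sym [simp]: "transpose (P2 K Z W) = P2 K Z W"
  unfolding P2_def lyap_transpose[OF stable, symmetric] by (simp add: S2_def)

lemma has_derivative_P: "(P has_derivative P1 K) (at K)"
proof -
  have "symm (transpose C ** transpose Z ** R ** K ** C) 
    + (transpose (- Y Z) ** P K ** cl K + transpose (cl K) ** P K ** (- Y Z)) = S1 K Z" for Z
    by (simp add: S1_def symm_def matrix_simps)
  then show ?thesis
    using has_derivative_lyap[OF cl_has_derivative has_derivative_QK stable]
    unfolding P_def[symmetric] P1_def[abs_def] by simp
qed

lemma has_derivative_P1: "((\<lambda>K. P1 K Z) has_derivative P2 K Z) (at K)"
proof -
  \<comment> \<open>\<open>S'\<close> differentiates the explicit source. The remaining term of
    \<open>S2\<close> comes from varying the closed-loop matrix inside \<open>lyap\<close>.\<close>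
  define S' where "S' W = symm (transpose C ** transpose Z ** R ** W ** C + transpose (Y Z) ** P K ** Y W
     - transpose (Y Z) ** P1 K W ** cl K)" for W
  have "((\<lambda>K. S1 K Z) has_derivative S') (at K)"
    unfolding S1_def symm_def S'_def[abs_def]
    by (rule has_derivative_eq_rhs)
      ((rule derivative_intros matrix_mult.FDERIV bounded_linear.has_derivative[OF bounded_linear_transpose]
         has_derivative_P cl_has_derivative)+,
      simp add: fun_eq_iff symm_def matrix_simps)
  moreover have "S' W + (transpose (- Y W) ** P1 K Z ** cl K + transpose (cl K) ** P1 K Z ** (- Y W)) = S2 K Z W" for W
    by (simp add: S2_def S'_def symm_def matrix_simps)
  ultimately show ?thesis
    using has_derivative_lyap[OF cl_has_derivative _ stable, of "\<lambda>K. S1 K Z" S']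
    unfolding P1_def[symmetric] P2_def[abs_def] by simp
qed

end

lemma has_derivative_P2:
  assumes stable: "stable (cl K)"
  shows "((\<lambda>K. P2 K Z Z) has_derivative (\<lambda>W. lyap (cl K) (S3 K Z W))) (at K)"
proof -
  \<comment> \<open>The factors 2 arise because the last two terms of \<open>S2\<close> coincide
    when both directions are \<open>Z\<close>.\<close>
  define S' where "S' W = symm (transpose (Y Z) ** P1 K W ** Y Z - 2 *\<^sub>R (transpose (Y Z) ** P2 K Z W ** cl K)
     + 2 *\<^sub>R (transpose (Y Z) ** P1 K Z ** Y W))" for W
  have "((\<lambda>K. S2 K Z Z) has_derivative S') (at K)"
    unfolding S2_def symm_def S'_def[abs_def]
    by (rule has_derivative_eq_rhs)
      ((rule derivative_intros matrix_mult.FDERIV bounded_linear.has_derivative[OF bounded_linear_transpose]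
         has_derivative_P[OF stable] has_derivative_P1[OF stable] cl_has_derivative)+,
      simp add: fun_eq_iff symm_def matrix_simps scaleR_2)
  moreover have "S' W + (transpose (- Y W) ** P2 K Z Z ** cl K + transpose (cl K) ** P2 K Z Z ** (- Y W)) = S3 K Z W" for W
    by (simp add: S3_def S'_def symm_def matrix_simps P2_sym[OF stable])
  ultimately show ?thesis
    using has_derivative_lyap[OF cl_has_derivative _ stable, of "\<lambda>K. S2 K Z Z" S']
    unfolding P2_def[symmetric] by simp
qed

lemma S2_commute: "stable (cl K) \<Longrightarrow> S2 K Z W = S2 K W Z"
  by (simp add: S2_def symm_def matrix_simps P_sym P1_sym add_ac)

end

section \<open>Bounds on the second and third derivatives\<close>

lemma psd_AM_GM:
  assumes "psd S" shows "2 * \<bar>x \<bullet> (S *v y)\<bar> \<le> x \<bullet> (S *v x) + y \<bullet> (S *v y)"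
proof -
  have sym: "y \<bullet> (S *v x) = x \<bullet> (S *v y)"
    using assms by (intro inner_symmetric) (simp add: psd_def)
  have "0 \<le> (x + y) \<bullet> (S *v (x + y))" "0 \<le> (x - y) \<bullet> (S *v (x - y))"
    using assms by (simp_all add: psd_def)
  then show ?thesis
    by (simp add: matrix_vector_right_distrib matrix_vector_mult_diff_distrib inner_add inner_diff sym)
qed

lemma norm_mult_vec_le:
  assumes "\<And>x. norm (M *v x) \<le> a * norm x" "\<And>x. norm (N *v x) \<le> b * norm x" "0 \<le> a"
  shows "norm ((M ** N) *v x) \<le> a * b * norm x"
proof -
  have "norm ((M ** N) *v x) \<le> a * norm (N *v x)"
    using assms(1)[of "N *v x"] by (simp add: matrix_vector_mul_assoc)
  also have "\<dots> \<le> a * (b * norm x)" by (intro mult_left_mono assms)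
  finally show ?thesis by (simp add: mult.assoc)
qed

lemma inner_transpose_mult_vec:
  fixes M :: "real ^ 'l ^ 'k"
  shows "x \<bullet> (transpose M *v y) = (M *v x) \<bullet> y"
  by (metis inner_commute inner_transpose_vec)

lemma norm_axis: "norm (axis i x) = norm (x :: 'a::real_inner)"
  by (simp add: norm_eq_sqrt_inner inner_axis_axis)

lemmas quadratic_simps = quadratic_form_symm matrix_vector_mult_diff_rdistrib matrix_vector_mult_add_rdistrib
  inner_add_right inner_diff_right inner_transpose_mult_vec matrix_transpose_mul
  matrix_vector_mul_assoc[symmetric]

lemma lyap_mono:
  assumes "stable M" "\<And>x. x \<bullet> (S *v x) \<le> x \<bullet> (T *v x)"
  shows "x \<bullet> (lyap M S *v x) \<le> x \<bullet> (lyap M T *v x)"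
  by (rule sums_le[OF _ lyap_quadratic_form lyap_quadratic_form]) (use assms in auto)

lemma abs_lyap_le:
  assumes "stable M" "\<And>x. \<bar>x \<bullet> (S *v x)\<bar> \<le> c * (x \<bullet> (T *v x))"
  shows "\<bar>x \<bullet> (lyap M S *v x)\<bar> \<le> c * (x \<bullet> (lyap M T *v x))"
proof -
  have "x \<bullet> (lyap M S *v x) \<le> x \<bullet> (lyap M (c *\<^sub>R T) *v x)"
    by (rule lyap_mono[OF assms(1)]) (use assms(2) abs_le_D1 in \<open>auto simp: matrix_vector_scaleR\<close>)
  moreover have "x \<bullet> (lyap M ((-c) *\<^sub>R T) *v x) \<le> x \<bullet> (lyap M S *v x)"
    by (rule lyap_mono[OF assms(1)]) (use assms(2) in \<open>auto simp: matrix_vector_scaleR matrix_vector_minus abs_le_iff minus_le_iff\<close>)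
  ultimately show ?thesis
    by (simp add: lyap_scaleR[OF assms(1)] matrix_vector_scaleR abs_le_iff del: scaleR_minus_left)
qed

text \<open>Keeps the value of the form on the right, so that a bound on the control cost of
  \<open>K\<close> bounds \<open>R *v (K *v (C *v x))\<close>. It is Cauchy--Schwarz at
  \<open>S *v x\<close> and \<open>x\<close> with the common factor cancelled.\<close>

lemma pos_def_norm_le:
  fixes S :: "real ^ 'n ^ 'n"
  assumes "pos_def S" shows "(norm (S *v x))\<^sup>2 \<le> op_norm S * (x \<bullet> (S *v x))"
proof -
  have psd: "psd S" using assms unfolding pos_def_def psd_def by (metis inner_zero_left less_imp_le order_refl)
  let ?y = "S *v x"
  have "(norm ?y)\<^sup>2 * (norm ?y)\<^sup>2 = (?y \<bullet> (S *v x))\<^sup>2"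
    unfolding power2_norm_eq_inner by (rule power2_eq_square[symmetric])
  also have "\<dots> \<le> (?y \<bullet> (S *v ?y)) * (x \<bullet> (S *v x))" by (rule psd_Cauchy_Schwarz[OF psd])
  also have "\<dots> \<le> (op_norm S * (norm ?y)\<^sup>2) * (x \<bullet> (S *v x))"
  proof (rule mult_right_mono)
    have "?y \<bullet> (S *v ?y) \<le> norm ?y * norm (S *v ?y)" using Cauchy_Schwarz_ineq2 abs_le_D1 by blast
    also have "\<dots> \<le> norm ?y * (op_norm S * norm ?y)" by (intro mult_left_mono norm_le_op_norm) simp
    finally show "?y \<bullet> (S *v ?y) \<le> op_norm S * (norm ?y)\<^sup>2" by (simp add: power2_eq_square algebra_simps)
  qed (use psd in \<open>simp add: psd_def\<close>)
  finally have "(norm ?y)\<^sup>2 * (norm ?y)\<^sup>2 \<le> (norm ?y)\<^sup>2 * (op_norm S * (x \<bullet> (S *v x)))"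
    by (simp add: algebra_simps)
  then have "norm ?y = 0 \<or> (norm ?y)\<^sup>2 \<le> op_norm S * (x \<bullet> (S *v x))"
    using mult_left_le_imp_le[of "(norm ?y)\<^sup>2"] by (metis norm_ge_zero order_le_less zero_less_power)
  moreover have "0 \<le> op_norm S * (x \<bullet> (S *v x))" using psd op_norm_nonneg[of S] by (simp add: psd_def)
  ultimately show ?thesis by auto
qed

context sof begin

context
  fixes K :: "real ^ 'd ^ 'm"
  assumes stable: "stable (cl K)"
begin

lemma bounded_linear_Phi: "bounded_linear (\<Phi> K)"
  unfolding \<Phi>_def
  by (rule bounded_linear_compose[OF bounded_linear_inner_left bounded_linear_lyap[OF stable]])

lemmas Phi_add = linear_add[OF bounded_linear.linear[OF bounded_linear_Phi]]
  and Phi_diff = linear_diff[OF bounded_linear.linear[OF bounded_linear_Phi]]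
  and Phi_scaleR = linear_scale[OF bounded_linear.linear[OF bounded_linear_Phi]]

lemma Phi_mono:
  assumes "\<And>x. x \<bullet> (S *v x) \<le> x \<bullet> (T *v x)" shows "\<Phi> K S \<le> \<Phi> K T"
  unfolding \<Phi>_def integral_quadratic_form[symmetric]
  by (intro integral_mono integrable_quadratic_form lyap_mono stable assms)

lemma Phi_ge: 
  assumes "psd S" shows "S \<bullet> X \<le> \<Phi> K S"
proof -
  have "\<Phi> K S = S \<bullet> X + (transpose (cl K) ** lyap (cl K) S ** cl K) \<bullet> X"
    unfolding \<Phi>_def by (subst lyap_eq[OF stable]) (rule inner_add_left)
  then show ?thesis
    using inner_X_nonneg[OF psd_conj[OF psd_lyap[OF stable assms], of "cl K"]] by simp
qed

lemma Phi_nonneg: "psd S \<Longrightarrow> 0 \<le> \<Phi> K S"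
  using Phi_ge[of S] inner_X_nonneg[of S] by linarith

lemma Phi_transpose: "\<Phi> K (transpose S) = \<Phi> K S"
  unfolding \<Phi>_def lyap_transpose[OF stable] using inner_transpose[of "lyap (cl K) S" X] by simp

lemma Phi_symm: "\<Phi> K (symm S) = 2 * \<Phi> K S"
  by (simp add: symm_def Phi_add Phi_transpose)

text \<open>\<open>\<Phi> K (transpose U ** V)\<close> is a semi-inner product of \<open>U\<close>
  and \<open>V\<close>. The number of rows is left free: factors such as \<open>Z ** C\<close> live
  in the input space, factors such as \<open>Y Z\<close> in the state space.\<close>

lemma Phi_Cauchy_Schwarz:
  fixes U V :: "real ^ 'n ^ 'k"
  shows "(\<Phi> K (transpose U ** V))\<^sup>2 \<le> \<Phi> K (transpose U ** U) * \<Phi> K (transpose V ** V)"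
proof -
  have bl: "bilinear (\<lambda>U V :: real ^ 'n ^ 'k. \<Phi> K (transpose U ** V))"
    unfolding bilinear_def
    by (auto intro!: linearI simp: Phi_add Phi_scaleR transpose_add transpose_scalar
        matrix_mult.add_left matrix_mult.add_right matrix_mult.scaleR_left matrix_mult.scaleR_right)
  have sym: "\<Phi> K (transpose U ** V) = \<Phi> K (transpose V ** U)" for U V :: "real ^ 'n ^ 'k"
    using Phi_transpose[of "transpose U ** V"] by (simp add: matrix_transpose_mul)
  have "psd (transpose U ** U)" for U :: "real ^ 'n ^ 'k"
    unfolding psd_def by (simp add: matrix_transpose_mul inner_mult_vec)
  then have "\<bar>\<Phi> K (transpose U ** U)\<bar> \<le> \<Phi> K (transpose U ** U)" for U :: "real ^ 'n ^ 'k"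
    using Phi_nonneg by simp
  then show ?thesis by (rule form_Cauchy_Schwarz[OF bl sym bl sym])
qed

lemma Phi_id_nonneg: "0 \<le> \<Phi> K (mat 1)"
  by (rule Phi_nonneg) (simp add: psd_def)

lemma Phi_square_le:
  fixes U :: "real ^ 'n ^ 'k"
  assumes "\<And>x. norm (U *v x) \<le> u * norm x"
  shows "\<Phi> K (transpose U ** U) \<le> u\<^sup>2 * \<Phi> K (mat 1)"
proof -
  have "\<Phi> K (transpose U ** U) \<le> \<Phi> K (u\<^sup>2 *\<^sub>R mat 1)"
  proof (rule Phi_mono)
    fix x
    have "(norm (U *v x))\<^sup>2 \<le> (u * norm x)\<^sup>2" by (intro power_mono assms) simp
    then show "x \<bullet> ((transpose U ** U) *v x) \<le> x \<bullet> ((u\<^sup>2 *\<^sub>R mat 1) *v x)"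
      by (simp add: inner_mult_vec matrix_vector_scaleR power_mult_distrib flip: power2_norm_eq_inner)
  qed
  then show ?thesis by (simp add: Phi_scaleR)
qed

text \<open>This bound does not involve the norm of the closed-loop matrix: with \<open>\<Phi> K S = tr (S \<Sigma>)\<close> it
  says that \<open>cl \<Sigma> cl\<^sup>T = \<Sigma> - X \<le> \<Sigma>\<close>.\<close>

lemma Phi_closed_loop_le: "\<Phi> K (transpose (cl K) ** cl K) \<le> \<Phi> K (mat 1)"
proof -
  have "lyap (cl K) (transpose (cl K) ** cl K) = lyap (cl K) (mat 1) - mat 1"
  proof (rule lyap_unique[OF stable])
    have "lyap (cl K) (mat 1) - mat 1 = (mat 1 + transpose (cl K) ** lyap (cl K) (mat 1) ** cl K) - mat 1"
      using lyap_eq[OF stable, of "mat 1"] by simp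
    also have "\<dots> = transpose (cl K) ** cl K + transpose (cl K) ** (lyap (cl K) (mat 1) - mat 1) ** cl K"
      by (simp add: matrix_mult.diff_left matrix_mult.diff_right)
    finally show "lyap (cl K) (mat 1) - mat 1 = \<dots>" .
  qed
  moreover have "0 \<le> mat 1 \<bullet> X" by (rule inner_X_nonneg) (simp add: psd_def)
  ultimately show ?thesis by (simp add: \<Phi>_def inner_diff_left)
qed

text \<open>The hypotheses bound averages and not operator norms, so that \<open>cl K\<close> can
  enter with constant 1 through \<open>Phi_closed_loop_le\<close>.\<close>

lemma abs_Phi_le:
  fixes U V :: "real ^ 'n ^ 'k"
  assumes "\<Phi> K (transpose U ** U) \<le> u\<^sup>2 * \<Phi> K (mat 1)" "\<Phi> K (transpose V ** V) \<le> v\<^sup>2 * \<Phi> K (mat 1)"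
    and "0 \<le> u" "0 \<le> v"
  shows "\<bar>\<Phi> K (transpose U ** V)\<bar> \<le> u * v * \<Phi> K (mat 1)"
proof (rule power2_le_imp_le)
  have "psd (transpose V ** V)" unfolding psd_def by (simp add: matrix_transpose_mul inner_mult_vec)
  then have "\<Phi> K (transpose U ** U) * \<Phi> K (transpose V ** V) \<le> (u\<^sup>2 * \<Phi> K (mat 1)) * (v\<^sup>2 * \<Phi> K (mat 1))"
    using assms Phi_id_nonneg Phi_nonneg by (intro mult_mono) auto
  then show "\<bar>\<Phi> K (transpose U ** V)\<bar>\<^sup>2 \<le> (u * v * \<Phi> K (mat 1))\<^sup>2"
    using Phi_Cauchy_Schwarz[of U V] by (simp add: power2_eq_square algebra_simps)
qed (use assms Phi_id_nonneg in simp)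

lemma abs_Phi_prod_le:
  fixes U V :: "real ^ 'n ^ 'k"
  assumes "\<And>x. norm (U *v x) \<le> u * norm x" "\<And>x. norm (V *v x) \<le> v * norm x" "0 \<le> u" "0 \<le> v"
  shows "\<bar>\<Phi> K (transpose U ** V)\<bar> \<le> u * v * \<Phi> K (mat 1)"
  by (intro abs_Phi_le Phi_square_le assms)

lemma abs_Phi_closed_loop_le:
  assumes "\<And>x. norm (U *v x) \<le> u * norm x" "0 \<le> u"
  shows "\<bar>\<Phi> K (transpose U ** cl K)\<bar> \<le> u * \<Phi> K (mat 1)"
  using abs_Phi_le[of U u "cl K" 1] Phi_square_le[OF assms(1)] Phi_closed_loop_le assms(2) by simp

lemma P_eq: "x \<bullet> (P K *v x) = x \<bullet> (QK K *v x) + (cl K *v x) \<bullet> (P K *v (cl K *v x))"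
  unfolding inner_conj_vec[symmetric] P_def
  by (subst lyap_eq[OF stable]) (simp add: matrix_vector_mult_add_rdistrib inner_add_right)

lemma psd_P: "psd (P K)"
  unfolding P_def by (rule psd_lyap[OF stable psd_QK])

lemma quadratic_form_S1:
  "x \<bullet> (S1 K Z *v x) = 2 * ((Z *v (C *v x)) \<bullet> (R *v (K *v (C *v x)))
     - (B *v (Z *v (C *v x))) \<bullet> (P K *v (cl K *v x)))"
  unfolding S1_def Y_def by (simp only: quadratic_simps)

lemma quadratic_form_S2:
  "x \<bullet> (S2 K Z W *v x) = 2 * ((Z *v (C *v x)) \<bullet> (R *v (W *v (C *v x)))
     + (B *v (Z *v (C *v x))) \<bullet> (P K *v (B *v (W *v (C *v x))))
     - (B *v (Z *v (C *v x))) \<bullet> (P1 K W *v (cl K *v x))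
     - (B *v (W *v (C *v x))) \<bullet> (P1 K Z *v (cl K *v x)))"
  unfolding S2_def Y_def by (simp only: quadratic_simps)

end

end

text \<open>The bound of \<open>cl K\<close> by \<open>gam\<close> is an assumption here because its
  proof, \<open>gam_bound\<close>, rests on compactness of the sublevel set, shown later.\<close>

locale sof_sublevel = sof A B C Q R D
  for A :: "real ^ 'n ^ 'n" and B :: "real ^ 'm ^ 'n" and C :: "real ^ 'n ^ 'd"
    and Q :: "real ^ 'n ^ 'n" and R :: "real ^ 'm ^ 'm" and D :: "(real ^ 'n) measure" +
  fixes K :: "real ^ 'd ^ 'm" and \<alpha> :: real
  assumes stable: "stable (cl K)" and cost_le: "J K \<le> \<alpha>"
    and gam: "\<And>x. norm (cl K *v x) \<le> gam A B C Q R D \<alpha> * norm x"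
begin

definition "p = \<alpha> / mu D"
abbreviation "\<sigma> \<equiv> sigma_min Q"
abbreviation "nB \<equiv> op_norm B"
abbreviation "nC \<equiv> op_norm C"
abbreviation "nR \<equiv> op_norm R"
abbreviation "\<gamma> \<equiv> gam A B C Q R D \<alpha>"
abbreviation "\<zeta>1 \<equiv> zeta1 B C Q R D \<alpha>"
abbreviation "\<tau> \<equiv> \<Phi> K (mat 1)"

lemma sigma_pos: "0 < \<sigma>"
  by (rule sigma_min_pos[OF Q])

text \<open>Splits the budget \<alpha> between state and control. What the state leaves over,
  \<open>\<alpha> - \<sigma> * \<tau>\<close>, is the factor that reappears in
  \<open>control_le\<close> and \<open>\<epsilon>\<close>.\<close>

lemma Phi_QK_le: "\<sigma> * \<tau> + \<Phi> K (QK K - Q) \<le> \<alpha>"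
proof -
  have "\<sigma> * \<tau> = \<Phi> K (\<sigma> *\<^sub>R mat 1)" by (simp add: Phi_scaleR[OF stable])
  also have "\<dots> \<le> \<Phi> K Q"
    using sigma_min_le[OF Q] by (intro Phi_mono[OF stable]) (simp add: matrix_vector_scaleR power2_norm_eq_inner)
  finally show ?thesis
    using cost_le by (simp add: cost_eq_Phi[OF stable] Phi_diff[OF stable])
qed

lemma psd_control: "psd (QK K - Q)"
  using psd_conj[OF psd_R, of "K ** C"] by (simp add: QK_def matrix_simps)

lemma trace_bound: "\<sigma> * \<tau> \<le> \<alpha>"
  using Phi_QK_le Phi_nonneg[OF stable psd_control] by linarith

lemma alpha_pos: "0 < \<alpha>"
proof -
  have psd1: "psd (mat 1 :: real ^ 'n ^ 'n)" by (simp add: psd_def)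
  have "0 < mu D * ((axis undefined 1 :: real ^ 'n) \<bullet> (mat 1 *v axis undefined 1))"
    using mu_pos by (simp add: inner_axis_axis)
  also have "\<dots> \<le> (mat 1 \<bullet> X) * (norm (axis undefined 1 :: real ^ 'n))\<^sup>2" by (rule mu_le_inner_X[OF psd1])
  also have "\<dots> \<le> \<tau>" using Phi_ge[OF stable psd1] by simp
  finally show ?thesis using trace_bound sigma_pos by (meson less_le_trans mult_pos_pos)
qed

lemma p_pos: "0 < p"
  using alpha_pos mu_pos by (simp add: p_def)

lemma gam_nonneg: "0 \<le> \<gamma>"
  using order_trans[OF norm_ge_zero gam[of "axis undefined 1"]] by simp

lemma control_le: "(K *v (C *v x)) \<bullet> (R *v (K *v (C *v x))) \<le> (\<alpha> - \<sigma> * \<tau>) / mu D * (norm x)\<^sup>2"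
proof -
  have "mu D * (x \<bullet> ((QK K - Q) *v x)) \<le> ((QK K - Q) \<bullet> X) * (norm x)\<^sup>2"
    by (rule mu_le_inner_X[OF psd_control])
  also have "\<dots> \<le> (\<alpha> - \<sigma> * \<tau>) * (norm x)\<^sup>2"
    using Phi_ge[OF stable psd_control] Phi_QK_le by (intro mult_right_mono) auto
  finally show ?thesis
    using mu_pos by (simp add: quadratic_form_QK matrix_vector_mult_diff_rdistrib inner_diff_right field_simps)
qed

lemma P_le: "x \<bullet> (P K *v x) \<le> p * (norm x)\<^sup>2"
proof -
  have "mu D * (x \<bullet> (P K *v x)) \<le> (P K \<bullet> X) * (norm x)\<^sup>2"
    by (rule mu_le_inner_X[OF psd_P[OF stable]])
  also have "\<dots> \<le> \<alpha> * (norm x)\<^sup>2"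
    using cost_le cost_eq[OF stable] by (intro mult_right_mono) auto
  finally show ?thesis using mu_pos by (simp add: p_def field_simps)
qed

lemma P_nonneg: "0 \<le> x \<bullet> (P K *v x)"
  using psd_P[OF stable] by (simp add: psd_def)

lemma norm_P_le: "norm (P K *v x) \<le> p * norm x"
  by (rule symmetric_norm_le) (use P_sym[OF stable] P_le P_nonneg in auto)

lemma control_nonneg: "0 \<le> (v :: real ^ 'm) \<bullet> (R *v v)"
  using psd_R by (simp add: psd_def)

lemma Q_le_QK: "x \<bullet> (Q *v x) \<le> x \<bullet> (QK K *v x)"
  using control_nonneg by (simp add: quadratic_form_QK)

lemma sigma_le_QK: "\<sigma> * (norm x)\<^sup>2 \<le> x \<bullet> (QK K *v x)"
  using sigma_min_le[OF Q, of x] Q_le_QK[of x] by linarith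

lemma norm_Z_le: "norm (Z *v (C *v x)) \<le> norm Z * nC * norm x" for Z :: "real ^ 'd ^ 'm"
  using norm_mult_vec_le[OF norm_matrix_vector_le norm_le_op_norm, of Z C x] by (simp add: matrix_vector_mul_assoc)

lemma norm_Y_le: "norm (Y Z *v x) \<le> nB * nC * norm Z * norm x"
proof -
  have "norm (Y Z *v x) \<le> nB * norm (Z *v (C *v x))"
    unfolding Y_def matrix_vector_mul_assoc[symmetric] by (rule norm_le_op_norm)
  also have "\<dots> \<le> nB * (norm Z * nC * norm x)" by (intro mult_left_mono norm_Z_le op_norm_nonneg)
  finally show ?thesis by (simp add: algebra_simps)
qed

lemma norm_BZ_le: "norm (B *v (Z *v (C *v x))) \<le> nB * nC * norm Z * norm x"
  using norm_Y_le[of Z x] unfolding Y_def matrix_vector_mul_assoc[symmetric] .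

lemma zeta1_plus_1: "(\<zeta>1 + 1) * \<sigma> = p * (1 + nB\<^sup>2 * nC\<^sup>2) + nR * nC\<^sup>2"
  using sigma_pos by (simp add: zeta1_def p_def)

text \<open>The normalisation \<open>norm Z = 1\<close> is needed because the AM--GM step is not homogeneous in \<open>Z\<close>.\<close>

lemma S1_le_unit:
  assumes Z: "norm Z = 1"
  shows "\<bar>x \<bullet> (S1 K Z *v x)\<bar> \<le> \<zeta>1 * (x \<bullet> (Q *v x))"
proof -
  let ?z = "Z *v (C *v x)" and ?k = "K *v (C *v x)" and ?a = "cl K *v x"
  let ?b = "B *v ?z"
  have "\<bar>2 * (r - s)\<bar> \<le> 2 * \<bar>r\<bar> + 2 * \<bar>s\<bar>" for r s :: real
    using abs_triangle_ineq4[of r s] by (simp add: abs_mult)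
  then have "\<bar>x \<bullet> (S1 K Z *v x)\<bar> \<le> 2 * \<bar>?z \<bullet> (R *v ?k)\<bar> + 2 * \<bar>?b \<bullet> (P K *v ?a)\<bar>"
    unfolding quadratic_form_S1[OF stable] by blast
  also have "\<dots> \<le> (?z \<bullet> (R *v ?z) + ?k \<bullet> (R *v ?k)) + (?b \<bullet> (P K *v ?b) + ?a \<bullet> (P K *v ?a))"
    by (intro add_mono psd_AM_GM psd_R psd_P stable)
  \<comment> \<open>The Lyapunov equation replaces the quadratic terms in \<open>?k\<close> and
    \<open>?a\<close> by the form of \<open>P K\<close> minus that of \<open>Q\<close>. This
    subtracted form is the \<open>- 1\<close> in \<open>zeta1\<close>.\<close>
  also have "\<dots> = ?z \<bullet> (R *v ?z) + ?b \<bullet> (P K *v ?b) + (x \<bullet> (P K *v x) - x \<bullet> (Q *v x))"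
    using P_eq[OF stable, of x] quadratic_form_QK[of x K] by linarith
  also have "\<dots> \<le> nR * (nC * norm x)\<^sup>2 + p * (nB * nC * norm x)\<^sup>2 + (p * (norm x)\<^sup>2 - x \<bullet> (Q *v x))"
  proof (intro add_mono diff_right_mono P_le)
    have "?z \<bullet> (R *v ?z) \<le> norm ?z * norm (R *v ?z)" using Cauchy_Schwarz_ineq2 abs_le_D1 by blast
    also have "\<dots> \<le> norm ?z * (nR * norm ?z)" by (intro mult_left_mono norm_le_op_norm) simp
    also have "\<dots> = nR * (norm ?z)\<^sup>2" by (simp add: power2_eq_square)
    also have "\<dots> \<le> nR * (nC * norm x)\<^sup>2"
      using norm_Z_le[of Z x] Z by (intro mult_left_mono power_mono op_norm_nonneg) auto
    finally show "?z \<bullet> (R *v ?z) \<le> nR * (nC * norm x)\<^sup>2" .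
    have "?b \<bullet> (P K *v ?b) \<le> p * (norm ?b)\<^sup>2" by (rule P_le)
    also have "\<dots> \<le> p * (nB * nC * norm x)\<^sup>2"
      using norm_BZ_le[of Z x] Z p_pos by (intro mult_left_mono power_mono) auto
    finally show "?b \<bullet> (P K *v ?b) \<le> p * (nB * nC * norm x)\<^sup>2" .
  qed
  also have "\<dots> = (\<zeta>1 + 1) * (\<sigma> * (norm x)\<^sup>2) - x \<bullet> (Q *v x)"
    unfolding mult.assoc[symmetric] zeta1_plus_1 by (simp add: algebra_simps power_mult_distrib)
  also have "\<dots> \<le> (\<zeta>1 + 1) * (x \<bullet> (Q *v x)) - x \<bullet> (Q *v x)"
  proof (intro diff_right_mono mult_left_mono sigma_min_le Q)
    have "0 \<le> (\<zeta>1 + 1) * \<sigma>" unfolding zeta1_plus_1 using p_pos by (simp add: op_norm_nonneg)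
    then show "0 \<le> \<zeta>1 + 1" using sigma_pos by (simp add: zero_le_mult_iff)
  qed
  finally show ?thesis by (simp add: algebra_simps)
qed

lemma norm_scaled_unit:
  assumes "\<And>Z. norm Z = 1 \<Longrightarrow> \<bar>x \<bullet> (S1 K Z *v x)\<bar> \<le> c"
  shows "\<bar>x \<bullet> (S1 K Z *v x)\<bar> \<le> norm Z * c"
proof (cases "Z = 0")
  case False
  have "x \<bullet> (S1 K (norm Z *\<^sub>R sgn Z) *v x) = norm Z * (x \<bullet> (S1 K (sgn Z) *v x))"
    unfolding quadratic_form_S1[OF stable] matrix_vector_scaleR matrix_vector_mult_scaleR inner_scaleR_left
    by (simp add: algebra_simps)
  then have "\<bar>x \<bullet> (S1 K Z *v x)\<bar> = norm Z * \<bar>x \<bullet> (S1 K (sgn Z) *v x)\<bar>"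
    using False by (simp add: sgn_div_norm abs_mult)
  also have "\<dots> \<le> norm Z * c" using assms[of "sgn Z"] False by (intro mult_left_mono) (auto simp: norm_sgn)
  finally show ?thesis .
qed (simp add: quadratic_form_S1[OF stable])

text \<open>The formula of \<open>zeta1\<close> ends in \<open>- 1\<close> and does not show its
  sign; the sign is read off from \<open>S1_le_unit\<close> at a matrix with a single entry
  1.\<close>

lemma zeta1_nonneg: "0 \<le> \<zeta>1"
proof -
  let ?x = "axis undefined 1 :: real ^ 'n" and ?Z = "axis undefined (axis undefined 1) :: real ^ 'd ^ 'm"
  have "0 \<le> \<zeta>1 * (?x \<bullet> (Q *v ?x))" using S1_le_unit[of ?Z ?x] by (simp add: norm_axis)
  moreover have "0 < ?x \<bullet> (Q *v ?x)" using Q by (simp add: pos_def_def axis_eq_0_iff)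
  ultimately show ?thesis by (simp add: zero_le_mult_iff)
qed

lemma S1_le_zeta1: "\<bar>x \<bullet> (S1 K Z *v x)\<bar> \<le> \<zeta>1 * norm Z * (x \<bullet> (QK K *v x))"
proof -
  have "\<bar>x \<bullet> (S1 K Z *v x)\<bar> \<le> norm Z * (\<zeta>1 * (x \<bullet> (Q *v x)))"
    by (rule norm_scaled_unit[OF S1_le_unit])
  also have "\<dots> \<le> norm Z * (\<zeta>1 * (x \<bullet> (QK K *v x)))"
    by (intro mult_left_mono Q_le_QK zeta1_nonneg norm_ge_zero)
  finally show ?thesis by (simp add: algebra_simps)
qed

text \<open>The two terms bound \<open>R K C\<close> and \<open>B\<^sup>T P cl\<close>. The second has norm at most \<open>nB p \<gamma>\<close> and, by
  \<open>cl\<^sup>T P cl \<le> P\<close>, at most \<open>nB p\<close>; the weights \<open>2/3\<close> and \<open>1/3\<close> are chosen such that the comparison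
  with \<open>\<zeta>\<^sub>2\<close> in \<open>epsilon_zeta2\<close> goes through. The first term keeps the slack \<open>\<alpha> - \<sigma> \<tau>\<close>, because a
  large gain makes \<open>\<tau>\<close> small.\<close>

definition "\<epsilon> = 2 * nC * (sqrt (nR * ((\<alpha> - \<sigma> * \<tau>) / mu D)) + nB * p * (2 * \<gamma> + 1) / 3)"

lemma S1_le_eps: "\<bar>x \<bullet> (S1 K Z *v x)\<bar> \<le> \<epsilon> / \<sigma> * norm Z * (x \<bullet> (QK K *v x))"
proof -
  let ?z = "Z *v (C *v x)" and ?k = "K *v (C *v x)" and ?a = "cl K *v x"
  let ?b = "B *v ?z"
  define \<omega> where "\<omega> = (\<alpha> - \<sigma> * \<tau>) / mu D"
  have \<omega>: "0 \<le> \<omega>" using trace_bound mu_pos by (simp add: \<omega>_def)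
  have "(norm (R *v ?k))\<^sup>2 \<le> nR * (?k \<bullet> (R *v ?k))" by (rule pos_def_norm_le[OF R])
  also have "\<dots> \<le> nR * (\<omega> * (norm x)\<^sup>2)"
    unfolding \<omega>_def by (intro mult_left_mono control_le op_norm_nonneg)
  also have "\<dots> = (sqrt (nR * \<omega>) * norm x)\<^sup>2"
    using \<omega> op_norm_nonneg[of R] by (simp add: power_mult_distrib)
  finally have Rk: "norm (R *v ?k) \<le> sqrt (nR * \<omega>) * norm x"
    by (rule power2_le_imp_le) (use \<omega> op_norm_nonneg[of R] in simp)
  have zRk: "\<bar>?z \<bullet> (R *v ?k)\<bar> \<le> norm Z * nC * norm x * (sqrt (nR * \<omega>) * norm x)"
    by (rule order_trans[OF Cauchy_Schwarz_ineq2 mult_mono[OF norm_Z_le Rk]]) (simp_all add: op_norm_nonneg)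
  have bPa1: "\<bar>?b \<bullet> (P K *v ?a)\<bar> \<le> nB * nC * norm Z * norm x * (p * (\<gamma> * norm x))"
    by (rule order_trans[OF Cauchy_Schwarz_ineq2
          mult_mono[OF norm_BZ_le order_trans[OF norm_P_le mult_left_mono[OF gam]]]])
      (use p_pos in \<open>auto simp: op_norm_nonneg\<close>)
  have "(?b \<bullet> (P K *v ?a))\<^sup>2 \<le> (?b \<bullet> (P K *v ?b)) * (?a \<bullet> (P K *v ?a))"
    by (rule psd_Cauchy_Schwarz[OF psd_P[OF stable]])
  also have "\<dots> \<le> (p * (nB * nC * norm Z * norm x)\<^sup>2) * (p * (norm x)\<^sup>2)"
  proof (rule mult_mono)
    show "?b \<bullet> (P K *v ?b) \<le> p * (nB * nC * norm Z * norm x)\<^sup>2"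
      using p_pos by (intro order_trans[OF P_le] mult_left_mono power_mono norm_BZ_le) auto
    show "?a \<bullet> (P K *v ?a) \<le> p * (norm x)\<^sup>2"
      using P_eq[OF stable, of x] P_le[of x] psd_QK[of K] unfolding psd_def by (smt (verit))
  qed (simp_all add: P_nonneg p_pos less_imp_le)
  also have "\<dots> = (nB * nC * norm Z * norm x * (p * norm x))\<^sup>2"
    by (simp only: power2_eq_square mult_ac)
  finally have "\<bar>?b \<bullet> (P K *v ?a)\<bar> \<le> \<bar>nB * nC * norm Z * norm x * (p * norm x)\<bar>"
    by (simp only: abs_le_square_iff)
  also have "\<dots> = nB * nC * norm Z * norm x * (p * norm x)"
    by (intro abs_of_nonneg mult_nonneg_nonneg op_norm_nonneg norm_ge_zero less_imp_le[OF p_pos])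
  finally have bPa2: "\<bar>?b \<bullet> (P K *v ?a)\<bar> \<le> nB * nC * norm Z * norm x * (p * norm x)" .
  have "\<bar>2 * (r - s)\<bar> \<le> 2 * \<bar>r\<bar> + (4/3) * \<bar>s\<bar> + (2/3) * \<bar>s\<bar>" for r s :: real
    using abs_triangle_ineq4[of r s] by (simp add: abs_mult)
  then have "\<bar>x \<bullet> (S1 K Z *v x)\<bar> \<le> 2 * \<bar>?z \<bullet> (R *v ?k)\<bar> + (4/3) * \<bar>?b \<bullet> (P K *v ?a)\<bar> + (2/3) * \<bar>?b \<bullet> (P K *v ?a)\<bar>"
    unfolding quadratic_form_S1[OF stable] by blast
  also have "\<dots> \<le> 2 * (norm Z * nC * norm x * (sqrt (nR * \<omega>) * norm x))
      + (4/3) * (nB * nC * norm Z * norm x * (p * (\<gamma> * norm x))) + (2/3) * (nB * nC * norm Z * norm x * (p * norm x))"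
    by (intro add_mono mult_left_mono zRk bPa1 bPa2) auto
  also have "\<dots> = \<epsilon> * norm Z * (norm x)\<^sup>2"
    unfolding \<epsilon>_def \<omega>_def[symmetric] by (simp add: power2_eq_square field_simps)
  also have "\<dots> = \<epsilon> / \<sigma> * norm Z * (\<sigma> * (norm x)\<^sup>2)"
    using sigma_pos by simp
  also have "\<dots> \<le> \<epsilon> / \<sigma> * norm Z * (x \<bullet> (QK K *v x))"
  proof (intro mult_left_mono sigma_le_QK mult_nonneg_nonneg divide_nonneg_pos sigma_pos norm_ge_zero)
    show "0 \<le> \<epsilon>" unfolding \<epsilon>_def \<omega>_def[symmetric]
      using \<omega> p_pos gam_nonneg by (simp add: op_norm_nonneg)
  qed
  finally show ?thesis .
qed

text \<open>Both bounds on the first derivative are retained: \<open>\<zeta>1\<close> gives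
  \<open>L\<close>, while \<open>M\<close> needs \<open>\<zeta>1\<close> and
  \<open>\<epsilon> / \<sigma>\<close> together.\<close>

definition "\<theta> = min \<zeta>1 (\<epsilon> / \<sigma>)"

lemma S1_le: "\<bar>x \<bullet> (S1 K Z *v x)\<bar> \<le> \<theta> * norm Z * (x \<bullet> (QK K *v x))"
  using S1_le_zeta1[of x Z] S1_le_eps[of x Z] by (simp add: \<theta>_def min_def)

lemma theta_nonneg: "0 \<le> \<theta>"
proof -
  let ?x = "axis undefined 1 :: real ^ 'n" and ?Z = "axis undefined (axis undefined 1) :: real ^ 'd ^ 'm"
  have "0 \<le> \<theta> * norm ?Z * (?x \<bullet> (QK K *v ?x))"
    using S1_le[of ?x ?Z] abs_ge_zero order_trans by blast
  moreover have "0 < ?x \<bullet> (QK K *v ?x)" using sigma_le_QK[of ?x] sigma_pos by simp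
  ultimately show ?thesis by (simp add: zero_le_mult_iff norm_axis)
qed

lemma norm_P1_le: "norm (P1 K Z *v x) \<le> \<theta> * p * norm Z * norm x"
proof (rule symmetric_norm_le)
  show "transpose (P1 K Z) = P1 K Z" by (rule P1_sym[OF stable])
  show "\<bar>x \<bullet> (P1 K Z *v x)\<bar> \<le> \<theta> * p * norm Z * (norm x)\<^sup>2" for x
  proof -
    have "\<bar>x \<bullet> (P1 K Z *v x)\<bar> \<le> \<theta> * norm Z * (x \<bullet> (P K *v x))"
      unfolding P1_def P_def by (rule abs_lyap_le[OF stable S1_le])
    also have "\<dots> \<le> \<theta> * norm Z * (p * (norm x)\<^sup>2)"
      by (intro mult_left_mono P_le mult_nonneg_nonneg theta_nonneg norm_ge_zero)
    finally show ?thesis by (simp add: algebra_simps)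
  qed
qed

text \<open>Controls \<open>S2\<close> relative to \<open>QK\<close>, as \<open>\<theta>\<close>
  controls \<open>S1\<close>. It has the shape of \<open>zeta3\<close> and \<open>zeta4\<close>,
  with \<open>2 * \<theta>\<close> where these have \<open>\<zeta>1 + \<zeta>2\<close> and
  \<open>\<zeta>1\<close>.\<close>

definition "\<kappa> = 2 * nC / \<sigma> * (nR * nC + p * nB * (nB * nC) + 2 * nB * \<gamma> * \<theta> * p)"

lemma chi_nonneg: "0 \<le> \<kappa>"
  unfolding \<kappa>_def using p_pos gam_nonneg theta_nonneg sigma_pos by (simp add: op_norm_nonneg)

lemma S2_le: "\<bar>x \<bullet> (S2 K Z W *v x)\<bar> \<le> \<kappa> * norm Z * norm W * (x \<bullet> (QK K *v x))"
proof -
  let ?z = "Z *v (C *v x)" and ?w = "W *v (C *v x)" and ?a = "cl K *v x"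
  have cs: "\<bar>u \<bullet> v\<bar> \<le> c * d" if "norm u \<le> c" "norm v \<le> d" "0 \<le> c" for u v :: "real ^ 'k" and c d
    by (rule order_trans[OF Cauchy_Schwarz_ineq2 mult_mono]) (use that in auto)
  have 1: "\<bar>?z \<bullet> (R *v ?w)\<bar> \<le> (norm Z * nC * norm x) * (nR * (norm W * nC * norm x))"
    by (intro cs norm_Z_le order_trans[OF norm_le_op_norm mult_left_mono[OF norm_Z_le]])
      (auto simp: op_norm_nonneg)
  have 2: "\<bar>(B *v ?z) \<bullet> (P K *v (B *v ?w))\<bar> \<le> (nB * nC * norm Z * norm x) * (p * (nB * nC * norm W * norm x))"
    by (intro cs norm_BZ_le order_trans[OF norm_P_le mult_left_mono[OF norm_BZ_le]])
      (use p_pos in \<open>auto simp: op_norm_nonneg\<close>)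
  have 3: "\<bar>(B *v (Z *v (C *v x))) \<bullet> (P1 K W *v ?a)\<bar> \<le> (nB * nC * norm Z * norm x) * (\<theta> * p * norm W * (\<gamma> * norm x))" for Z W
    by (intro cs norm_BZ_le order_trans[OF norm_P1_le mult_left_mono[OF gam]])
      (use p_pos theta_nonneg in \<open>auto simp: op_norm_nonneg\<close>)
  have "\<bar>2 * (a + b - c - d)\<bar> \<le> 2 * (\<bar>a\<bar> + \<bar>b\<bar> + \<bar>c\<bar> + \<bar>d\<bar>)" for a b c d :: real
    by (smt (verit))
  then have "\<bar>x \<bullet> (S2 K Z W *v x)\<bar> \<le> 2 * (\<bar>?z \<bullet> (R *v ?w)\<bar> + \<bar>(B *v ?z) \<bullet> (P K *v (B *v ?w))\<bar>
     + \<bar>(B *v ?z) \<bullet> (P1 K W *v ?a)\<bar> + \<bar>(B *v ?w) \<bullet> (P1 K Z *v ?a)\<bar>)"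
    unfolding quadratic_form_S2[OF stable] by blast
  also have "\<dots> \<le> 2 * ((norm Z * nC * norm x) * (nR * (norm W * nC * norm x))
     + (nB * nC * norm Z * norm x) * (p * (nB * nC * norm W * norm x))
     + (nB * nC * norm Z * norm x) * (\<theta> * p * norm W * (\<gamma> * norm x))
     + (nB * nC * norm W * norm x) * (\<theta> * p * norm Z * (\<gamma> * norm x)))"
    by (intro mult_left_mono add_mono 1 2 3) simp
  also have "\<dots> = \<kappa> * norm Z * norm W * (\<sigma> * (norm x)\<^sup>2)"
    using sigma_pos unfolding \<kappa>_def by (simp add: power2_eq_square field_simps)
  also have "\<dots> \<le> \<kappa> * norm Z * norm W * (x \<bullet> (QK K *v x))"
    by (intro mult_left_mono sigma_le_QK mult_nonneg_nonneg chi_nonneg norm_ge_zero)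
  finally show ?thesis .
qed

lemma norm_P2_le: "norm (P2 K Z W *v x) \<le> \<kappa> * p * norm Z * norm W * norm x"
proof (rule symmetric_norm_le)
  show "transpose (P2 K Z W) = P2 K Z W" by (rule P2_sym[OF stable])
  show "\<bar>x \<bullet> (P2 K Z W *v x)\<bar> \<le> \<kappa> * p * norm Z * norm W * (norm x)\<^sup>2" for x
  proof -
    have "\<bar>x \<bullet> (P2 K Z W *v x)\<bar> \<le> \<kappa> * norm Z * norm W * (x \<bullet> (P K *v x))"
      unfolding P2_def P_def by (rule abs_lyap_le[OF stable S2_le])
    also have "\<dots> \<le> \<kappa> * norm Z * norm W * (p * (norm x)\<^sup>2)"
      by (intro mult_left_mono P_le mult_nonneg_nonneg chi_nonneg norm_ge_zero)
    finally show ?thesis by (simp add: algebra_simps)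
  qed
qed

text \<open>Unlike in the pointwise bound \<open>S2_le\<close>, the factor \<open>cl K\<close> is
  averaged by \<open>\<Phi>\<close> and contributes 1, so \<gamma> does not multiply the last
  term.\<close>

lemma Phi_S2_le: "\<bar>\<Phi> K (S2 K Z Z)\<bar> \<le> 2 * (nR * nC\<^sup>2 + p * (nB * nC)\<^sup>2 + 2 * (nB * nC) * \<theta> * p) * \<tau> * (norm Z)\<^sup>2"
proof -
  have 1: "\<bar>\<Phi> K (transpose (Z ** C) ** (R ** (Z ** C)))\<bar> \<le> (norm Z * nC) * (nR * (norm Z * nC)) * \<tau>"
    by (intro abs_Phi_prod_le stable norm_mult_vec_le norm_matrix_vector_le norm_le_op_norm)
      (auto simp: op_norm_nonneg)
  have 2: "\<bar>\<Phi> K (transpose (Y Z) ** (P K ** Y Z))\<bar> \<le> (nB * nC * norm Z) * (p * (nB * nC * norm Z)) * \<tau>"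
    by (intro abs_Phi_prod_le stable norm_mult_vec_le norm_Y_le norm_P_le)
      (use p_pos in \<open>auto simp: op_norm_nonneg\<close>)
  have 3: "\<bar>\<Phi> K (transpose (P1 K Z ** Y Z) ** cl K)\<bar> \<le> (\<theta> * p * norm Z * (nB * nC * norm Z)) * \<tau>"
    by (intro abs_Phi_closed_loop_le stable norm_mult_vec_le norm_Y_le norm_P1_le)
      (use p_pos theta_nonneg in \<open>auto simp: op_norm_nonneg\<close>)
  have bound: "\<bar>2 * (a + b - 2 * c)\<bar> \<le> 2 * (a' + b' + 2 * c')"
    if "\<bar>a\<bar> \<le> a'" "\<bar>b\<bar> \<le> b'" "\<bar>c\<bar> \<le> c'" for a b c a' b' c' :: real
    using that by (smt (verit))
  have "\<Phi> K (S2 K Z Z) = 2 * (\<Phi> K (transpose (Z ** C) ** (R ** (Z ** C))) + \<Phi> K (transpose (Y Z) ** (P K ** Y Z))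
     - 2 * \<Phi> K (transpose (P1 K Z ** Y Z) ** cl K))"
    unfolding S2_def Phi_symm[OF stable] Phi_diff[OF stable] Phi_add[OF stable]
    by (simp add: matrix_simps P1_sym[OF stable])
  then have "\<bar>\<Phi> K (S2 K Z Z)\<bar> \<le> 2 * ((norm Z * nC) * (nR * (norm Z * nC)) * \<tau> + (nB * nC * norm Z) * (p * (nB * nC * norm Z)) * \<tau>
     + 2 * ((\<theta> * p * norm Z * (nB * nC * norm Z)) * \<tau>))"
    using bound[OF 1 2 3] by simp
  then show ?thesis by (simp add: power2_eq_square algebra_simps)
qed

text \<open>The terms with \<open>P1\<close> and those with \<open>P2\<close> each have total weight
  2 * (1 + 2) = 6.\<close>

lemma Phi_S3_le: "\<bar>\<Phi> K (S3 K Z W)\<bar> \<le> 6 * (\<theta> * (nB * nC) + \<kappa>) * (nB * nC) * p * \<tau> * (norm Z)\<^sup>2 * norm W"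
proof -
  have 1: "\<bar>\<Phi> K (transpose (Y Z) ** (P1 K V ** Y W))\<bar> \<le> (nB * nC * norm Z) * (\<theta> * p * norm V * (nB * nC * norm W)) * \<tau>" for V W
    by (intro abs_Phi_prod_le stable norm_mult_vec_le norm_Y_le norm_P1_le)
      (use p_pos theta_nonneg in \<open>auto simp: op_norm_nonneg\<close>)
  have 2: "\<bar>\<Phi> K (transpose (P2 K U V ** Y W) ** cl K)\<bar> \<le> (\<kappa> * p * norm U * norm V * (nB * nC * norm W)) * \<tau>" for U V W
    by (intro abs_Phi_closed_loop_le stable norm_mult_vec_le norm_Y_le norm_P2_le)
      (use p_pos chi_nonneg in \<open>auto simp: op_norm_nonneg\<close>)
  have bound: "\<bar>2 * (a - 2 * b + 2 * c - d)\<bar> \<le> 2 * (a' + 2 * b' + 2 * c' + d')"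
    if "\<bar>a\<bar> \<le> a'" "\<bar>b\<bar> \<le> b'" "\<bar>c\<bar> \<le> c'" "\<bar>d\<bar> \<le> d'" for a b c d a' b' c' d' :: real
    using that by (smt (verit))
  have "\<Phi> K (S3 K Z W) = 2 * (\<Phi> K (transpose (Y Z) ** (P1 K W ** Y Z)) - 2 * \<Phi> K (transpose (P2 K Z W ** Y Z) ** cl K)
     + 2 * \<Phi> K (transpose (Y Z) ** (P1 K Z ** Y W)) - \<Phi> K (transpose (P2 K Z Z ** Y W) ** cl K))"
    by (simp add: S3_def Phi_symm[OF stable] Phi_add[OF stable] Phi_diff[OF stable] Phi_scaleR[OF stable]
        matrix_simps P2_sym[OF stable])
  then have "\<bar>\<Phi> K (S3 K Z W)\<bar> \<le> 2 * ((nB * nC * norm Z) * (\<theta> * p * norm W * (nB * nC * norm Z)) * \<tau>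
     + 2 * ((\<kappa> * p * norm Z * norm W * (nB * nC * norm Z)) * \<tau>)
     + 2 * ((nB * nC * norm Z) * (\<theta> * p * norm Z * (nB * nC * norm W)) * \<tau>)
     + (\<kappa> * p * norm Z * norm Z * (nB * nC * norm W)) * \<tau>)"
    using bound[OF 1[of W Z] 2[of Z W Z] 1[of Z W] 2[of Z Z W]] by simp
  then show ?thesis by (simp add: power2_eq_square algebra_simps)
qed

end

section \<open>Comparison with the constants \<open>L\<close> and \<open>M\<close>\<close>

context sof_sublevel begin

abbreviation "\<zeta>2 \<equiv> zeta2 A B C Q R D \<alpha>"
abbreviation "\<zeta>3 \<equiv> zeta3 A B C Q R D \<alpha>"
abbreviation "\<zeta>4 \<equiv> zeta4 A B C Q R D \<alpha>"
abbreviation "\<psi> \<equiv> psi A B R D \<alpha>"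

lemma Phi_id_le: "\<tau> \<le> \<alpha> / \<sigma>"
  using trace_bound sigma_pos by (simp add: field_simps)

text \<open>Clears the quotient by \<open>nB * nC\<close>. If that product is 0, the quotient is 0
  by convention, and it is multiplied by \<open>nB\<^sup>2 * nC\<^sup>2 = 0\<close> in any
  case.\<close>

lemma L_const_eq:
  "L_const B C Q R D \<alpha> = 2 * (nR * nC\<^sup>2 + p * (nB * nC)\<^sup>2 + 2 * (nB * nC) * \<zeta>1 * p) * (\<alpha> / \<sigma>)"
proof (cases "nB * nC = 0")
  case True
  then show ?thesis unfolding L_const_def p_def by (auto simp: power2_eq_square)
next
  case False
  then have "(1 + 2 * \<zeta>1 / (nB * nC)) * nB\<^sup>2 * nC\<^sup>2 = (nB * nC)\<^sup>2 + 2 * (nB * nC) * \<zeta>1"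
    by (simp add: field_simps power2_eq_square)
  moreover have "L_const B C Q R D \<alpha> = 2 * (\<alpha> / \<sigma>) * (nR * nC\<^sup>2 + p * ((1 + 2 * \<zeta>1 / (nB * nC)) * nB\<^sup>2 * nC\<^sup>2))"
    unfolding L_const_def p_def by (simp only: distrib_right distrib_left mult_ac times_divide_eq_right times_divide_eq_left)
  ultimately show ?thesis by (simp add: algebra_simps)
qed

lemma Phi_S2_le_L: "\<bar>\<Phi> K (S2 K Z Z)\<bar> \<le> L_const B C Q R D \<alpha> * (norm Z)\<^sup>2"
proof -
  have \<tau>: "0 \<le> \<tau>" by (rule Phi_id_nonneg[OF stable])
  have \<theta>: "\<theta> \<le> \<zeta>1" by (simp add: \<theta>_def)
  have "2 * (nR * nC\<^sup>2 + p * (nB * nC)\<^sup>2 + 2 * (nB * nC) * \<theta> * p) * \<tau> \<le> L_const B C Q R D \<alpha>"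
    unfolding L_const_eq
    using p_pos theta_nonneg \<theta> \<tau> Phi_id_le zeta1_nonneg
    by (intro mult_mono add_mono mult_nonneg_nonneg add_nonneg_nonneg order_refl)
      (simp_all add: op_norm_nonneg)
  then have "2 * (nR * nC\<^sup>2 + p * (nB * nC)\<^sup>2 + 2 * (nB * nC) * \<theta> * p) * \<tau> * (norm Z)\<^sup>2 \<le> L_const B C Q R D \<alpha> * (norm Z)\<^sup>2"
    by (rule mult_right_mono) simp
  then show ?thesis using Phi_S2_le[of Z] by linarith
qed

text \<open>The first summand of \<open>\<psi>\<close>, multiplied by \<open>nR\<close>, is already
  large enough, since \<open>sigma_min R \<le> nR\<close>; the second is nonnegative.\<close>

lemma psi_ge: "sqrt (nR * p + (nB * p)\<^sup>2) \<le> \<psi> * nR"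
proof -
  let ?s = "sigma_min R"
  have s: "0 < ?s" by (rule sigma_min_pos[OF R])
  let ?x = "axis undefined 1 :: real ^ 'm"
  have "?s * (norm ?x)\<^sup>2 \<le> ?x \<bullet> (R *v ?x)" by (rule sigma_min_le[OF R])
  also have "\<dots> \<le> norm ?x * norm (R *v ?x)" using Cauchy_Schwarz_ineq2 abs_le_D1 by blast
  also have "\<dots> \<le> nR" using norm_le_op_norm[of R ?x] by simp
  finally have "1 \<le> nR / ?s" using s by simp
  have "nR * p + (nB * p)\<^sup>2 = (nR * \<alpha> + nB\<^sup>2 * \<alpha>\<^sup>2 / mu D) / mu D"
    using mu_pos by (simp add: p_def field_simps power2_eq_square)
  then have "sqrt (nR * p + (nB * p)\<^sup>2) = sqrt (nR * \<alpha> + nB\<^sup>2 * \<alpha>\<^sup>2 / mu D) / sqrt (mu D)"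
    by (simp add: real_sqrt_divide)
  also have "\<dots> \<le> sqrt (nR * \<alpha> + nB\<^sup>2 * \<alpha>\<^sup>2 / mu D) / sqrt (mu D) * (nR / ?s)" (is "?w \<le> _")
  proof -
    have "0 \<le> ?w" using mu_pos alpha_pos by (simp add: op_norm_nonneg)
    from mult_left_mono[OF \<open>1 \<le> nR / ?s\<close> this] show ?thesis by (simp only: mult_1_right)
  qed
  also have "\<dots> \<le> \<psi> * nR"
    unfolding psi_def using mu_pos alpha_pos s by (simp add: distrib_right op_norm_nonneg)
  finally show ?thesis .
qed

text \<open>With \<open>t = \<sigma> * \<tau> / \<alpha>\<close> the control slack is a multiple of
  \<open>1 - t\<close>, and \<open>t * sqrt (1 - t) \<le> 1 / 2\<close> halves the first term of
  \<open>\<epsilon>\<close>. The result is \<open>3 * u + 2 * v\<close> plus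
  \<open>4 * \<gamma> * v\<close>; the last part matches the \<gamma> term of
  \<open>\<zeta>2\<close>, the rest is absorbed by \<open>\<psi>\<close>.\<close>

lemma epsilon_zeta2: "6 * (\<sigma> * \<tau> / \<alpha>) * (\<epsilon> / \<sigma>) \<le> 4 * \<zeta>2"
proof -
  define t where "t = \<sigma> * \<tau> / \<alpha>"
  have t: "0 \<le> t" "t \<le> 1"
    using trace_bound alpha_pos sigma_pos Phi_id_nonneg[OF stable] by (auto simp: t_def)
  have \<omega>: "nR * ((\<alpha> - \<sigma> * \<tau>) / mu D) = (1 - t) * (nR * p)"
    using alpha_pos mu_pos by (simp add: t_def p_def field_simps)
  define u where "u = sqrt (nR * p)"
  define v where "v = nB * p"
  have u: "0 \<le> u" and v: "0 \<le> v" and u2: "u\<^sup>2 = nR * p"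
    using p_pos by (simp_all add: u_def v_def op_norm_nonneg)
  have "t * sqrt (1 - t) \<le> 1 / 2"
  proof (rule power2_le_imp_le)
    have "(t * sqrt (1 - t))\<^sup>2 = t * (t * (1 - t))"
      using t by (simp add: power_mult_distrib power2_eq_square)
    also have "\<dots> \<le> 1 * (1 / 4)"
    proof (rule mult_mono)
      have "0 \<le> (t - 1 / 2)\<^sup>2" by simp
      then show "t * (1 - t) \<le> 1 / 4" by (simp add: power2_eq_square algebra_simps)
    qed (use t in auto)
    finally show "(t * sqrt (1 - t))\<^sup>2 \<le> (1 / 2)\<^sup>2" by (simp add: power2_eq_square)
  qed simp
  then have 1: "t * sqrt (1 - t) * u \<le> 1 / 2 * u" using u by (rule mult_right_mono)
  have "3 * u + 2 * v \<le> 4 * sqrt (u\<^sup>2 + v\<^sup>2)"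
  proof (rule power2_le_imp_le)
    \<comment> \<open>This sum of squares is the difference of
      \<open>16 * (u\<^sup>2 + v\<^sup>2)\<close> and
      \<open>(3 * u + 2 * v)\<^sup>2\<close>.\<close>
    have "0 \<le> (2 * u - 3 * v)\<^sup>2 + 3 * u\<^sup>2 + 3 * v\<^sup>2" by simp
    then have "(3 * u + 2 * v)\<^sup>2 \<le> 16 * (u\<^sup>2 + v\<^sup>2)" by (simp add: power2_eq_square algebra_simps)
    then show "(3 * u + 2 * v)\<^sup>2 \<le> (4 * sqrt (u\<^sup>2 + v\<^sup>2))\<^sup>2" by (simp add: power_mult_distrib)
  qed simp
  also have "sqrt (u\<^sup>2 + v\<^sup>2) \<le> \<psi> * nR" using psi_ge by (simp add: u2 v_def)
  finally have 2: "3 * u + 2 * v \<le> 4 * (\<psi> * nR)" by simp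
  have "0 \<le> v * (2 * \<gamma> + 1)" using v gam_nonneg by simp
  then have 3: "t * (v * (2 * \<gamma> + 1)) \<le> v * (2 * \<gamma> + 1)" using t mult_left_le_one_le by blast
  have \<epsilon>: "\<epsilon> = 2 * nC * (sqrt (1 - t) * u + v * (2 * \<gamma> + 1) / 3)"
    unfolding \<epsilon>_def \<omega> u_def v_def by (simp add: real_sqrt_mult)
  have "6 * t * \<epsilon> = 2 * nC * (6 * (t * sqrt (1 - t) * u) + 2 * (t * (v * (2 * \<gamma> + 1))))"
    unfolding \<epsilon> by (simp add: algebra_simps)
  also have "\<dots> \<le> 2 * nC * (4 * (\<gamma> * v + \<psi> * nR))"
    using 1 2 3 by (intro mult_left_mono) (auto simp: op_norm_nonneg algebra_simps)
  also have "\<dots> = 4 * \<zeta>2 * \<sigma>"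
    unfolding zeta2_def using sigma_pos mu_pos by (simp add: v_def p_def field_simps)
  finally have "6 * t * \<epsilon> \<le> 4 * \<zeta>2 * \<sigma>" .
  then show ?thesis using sigma_pos unfolding t_def[symmetric] by (simp add: field_simps)
qed

text \<open>Since \<open>\<tau> = t * \<alpha> / \<sigma>\<close>, only \<open>t * \<theta>\<close>
  and \<open>t * \<kappa>\<close> have to be compared with the constants. The two are matched
  separately, with \<open>4 * \<zeta>1 + 2 * \<zeta>2\<close> and with
  \<open>4 * \<zeta>3 + 2 * \<zeta>4\<close>.\<close>

lemma Phi_S3_le_M: "\<bar>\<Phi> K (S3 K Z W)\<bar> \<le> M_const A B C Q R D \<alpha> * (norm Z)\<^sup>2 * norm W"
proof -
  define t where "t = \<sigma> * \<tau> / \<alpha>"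
  have t: "0 \<le> t" "t \<le> 1"
    using trace_bound alpha_pos sigma_pos Phi_id_nonneg[OF stable] by (auto simp: t_def)
  define b where "b = nB * nC"
  have b: "0 \<le> b" by (simp add: b_def op_norm_nonneg)
  have t\<theta>1: "t * \<theta> \<le> \<zeta>1"
    using t theta_nonneg mult_left_le_one_le[of \<theta> t] by (simp add: \<theta>_def)
  have "6 * (t * \<theta>) \<le> 6 * (t * (\<epsilon> / \<sigma>))" using t by (intro mult_left_mono) (auto simp: \<theta>_def)
  then have t\<theta>2: "6 * (t * \<theta>) \<le> 4 * \<zeta>2" using epsilon_zeta2 unfolding t_def[symmetric] by linarith
  have t\<theta>: "0 \<le> t * \<theta>" using t theta_nonneg by simp
  have \<zeta>2: "0 \<le> \<zeta>2" using t\<theta>2 t\<theta> by linarith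
  define c where "c = 2 * nC / \<sigma>"
  have c: "0 \<le> c" using sigma_pos by (simp add: c_def op_norm_nonneg)
  define g where "g = p * nB * \<gamma>"
  have g: "0 \<le> g" using p_pos gam_nonneg by (simp add: g_def op_norm_nonneg)
  define h where "h = nR * nC + p * nB * b"
  have h: "0 \<le> h" using p_pos b by (simp add: h_def op_norm_nonneg)
  have \<kappa>: "\<kappa> = c * (h + 2 * g * \<theta>)" unfolding \<kappa>_def c_def g_def h_def b_def by (simp add: algebra_simps)
  have 34: "4 * \<zeta>3 + 2 * \<zeta>4 = c * (6 * h + g * (6 * \<zeta>1 + 4 * \<zeta>2))"
    unfolding zeta3_def zeta4_def p_def[symmetric] c_def[symmetric] g_def h_def b_def by (simp add: algebra_simps)
  have "6 * (t * \<theta>) * b \<le> (4 * \<zeta>1 + 2 * \<zeta>2) * b"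
    using t\<theta>1 t\<theta>2 \<zeta>2 by (intro mult_right_mono b) linarith
  moreover have "6 * (t * \<kappa>) = c * (6 * (t * h) + g * (12 * (t * \<theta>)))"
    unfolding \<kappa> by (simp add: algebra_simps)
  \<comment> \<open>Of the twelve copies of \<open>t * \<theta>\<close>, six are bounded by
    \<open>6 * \<zeta>1\<close> and six by \<open>4 * \<zeta>2\<close>.\<close>
  moreover have "\<dots> \<le> c * (6 * h + g * (6 * \<zeta>1 + 4 * \<zeta>2))"
    using t\<theta>1 t\<theta>2 mult_left_le_one_le[OF h t] by (intro mult_left_mono add_mono c g) auto
  ultimately have key: "6 * (t * \<theta> * b + t * \<kappa>) \<le> 4 * ((\<zeta>1 + \<zeta>2 / 2) * b + \<zeta>3 + \<zeta>4 / 2)"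
    using 34 by (simp add: algebra_simps)
  have nn: "0 \<le> t * \<theta> * b + t * \<kappa>" using t\<theta> b t chi_nonneg by simp
  have \<tau>: "p * \<tau> = \<alpha>\<^sup>2 / (mu D * \<sigma>) * t"
    using alpha_pos mu_pos sigma_pos by (simp add: p_def t_def power2_eq_square)
  define N where "N = \<alpha>\<^sup>2 / (mu D * \<sigma>)"
  have N: "0 \<le> N" using mu_pos sigma_pos by (simp add: N_def)
  define y where "y = (\<zeta>1 + \<zeta>2 / 2) * b + \<zeta>3 + \<zeta>4 / 2"
  have y: "0 \<le> y" using key nn by (simp add: y_def)
  have "6 * (\<theta> * b + \<kappa>) * b * p * \<tau> = 6 * (\<theta> * b + \<kappa>) * b * (p * \<tau>)" by simp
  also have "\<dots> = N * b * (6 * (t * \<theta> * b + t * \<kappa>))"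
    unfolding \<tau> N_def[symmetric] by (simp add: algebra_simps)
  also have "\<dots> \<le> N * b * (4 * y)" using key unfolding y_def by (intro mult_left_mono mult_nonneg_nonneg N b)
  also have "\<dots> \<le> sqrt (real (CARD('m) * CARD('d))) * (N * b * (4 * y))"
  proof -
    have "1 \<le> sqrt (real (CARD('m) * CARD('d)))"
    proof -
      have "1 \<le> CARD('m) * CARD('d)" by (simp add: Suc_le_eq)
      then have "real 1 \<le> real (CARD('m) * CARD('d))" by (rule of_nat_mono)
      then show ?thesis by (simp only: of_nat_1 real_sqrt_ge_1_iff)
    qed
    moreover have "0 \<le> N * b * (4 * y)" using N b y by simp
    ultimately have "1 * (N * b * (4 * y)) \<le> sqrt (real (CARD('m) * CARD('d))) * (N * b * (4 * y))"
      by (rule mult_right_mono)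
    then show ?thesis by (simp only: mult_1_left)
  qed
  also have "\<dots> = M_const A B C Q R D \<alpha>"
    unfolding M_const_def N_def y_def b_def by (simp add: algebra_simps)
  finally have "6 * (\<theta> * b + \<kappa>) * b * p * \<tau> \<le> M_const A B C Q R D \<alpha>" .
  then have "6 * (\<theta> * b + \<kappa>) * b * p * \<tau> * ((norm Z)\<^sup>2 * norm W) \<le> M_const A B C Q R D \<alpha> * ((norm Z)\<^sup>2 * norm W)"
    by (rule mult_right_mono) simp
  then show ?thesis using Phi_S3_le[of Z W] unfolding b_def by (simp add: mult.assoc)
qed

end

section \<open>Sublevel sets\<close>

lemma norm_le_op_norm_card:
  fixes M :: "real ^ 'l ^ 'k"
  shows "norm M \<le> sqrt (real CARD('l)) * op_norm M"
proof (rule power2_le_imp_le)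
  have "(norm M)\<^sup>2 = (\<Sum>j\<in>UNIV. (norm (M *v axis j 1))\<^sup>2)" by (rule norm_sq_columns)
  also have "\<dots> \<le> (\<Sum>j\<in>(UNIV :: 'l set). (op_norm M)\<^sup>2)"
  proof (intro sum_mono power_mono)
    show "norm (M *v axis j 1) \<le> op_norm M" for j using norm_le_op_norm[of M "axis j 1"] by simp
  qed simp
  finally show "(norm M)\<^sup>2 \<le> (sqrt (real CARD('l)) * op_norm M)\<^sup>2" by (simp add: power_mult_distrib)
qed (simp add: op_norm_nonneg)

context sof begin

text \<open>The finite-horizon cost matrix: polynomial in \<open>K\<close>, hence continuous and
  meaningful without stability.\<close>

definition "partial_sum T K = (\<Sum>t<T. transpose (mpow (cl K) t) ** QK K ** mpow (cl K) t)"

lemma partial_sum_form: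
  "x \<bullet> (partial_sum T K *v x) = (\<Sum>t<T. (mpow (cl K) t *v x) \<bullet> (QK K *v (mpow (cl K) t *v x)))"
  unfolding partial_sum_def
  by (subst linear_sum[OF bounded_linear.linear[OF bounded_linear_quadratic_form]]) (simp add: inner_conj_vec)

lemma psd_partial_sum: "psd (partial_sum T K)"
proof (induction T)
  case (Suc T)
  then show ?case using psd_add[OF Suc psd_conj[OF psd_QK, of "mpow (cl K) T" K]]
    by (simp add: partial_sum_def)
qed (simp add: partial_sum_def psd_def transpose_zero)

lemma QK_form_ge: "sigma_min Q * (norm x)\<^sup>2 \<le> x \<bullet> (QK K *v x)"
  using sigma_min_le[OF Q, of x] psd_R by (simp add: quadratic_form_QK psd_def add_increasing2)

lemma partial_sum_le_cost:
  assumes "stable (cl K)" shows "partial_sum T K \<bullet> X \<le> J K"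
  unfolding cost_eq[OF assms] integral_quadratic_form[symmetric]
proof (intro integral_mono integrable_quadratic_form)
  fix x
  note sums = lyap_quadratic_form[OF assms, of x "QK K"]
  show "x \<bullet> (partial_sum T K *v x) \<le> x \<bullet> (P K *v x)"
    unfolding partial_sum_form P_def sums_unique[OF sums]
    by (rule sum_le_suminf[OF sums_summable[OF sums]]) (use psd_QK in \<open>auto simp: psd_def\<close>)
qed

text \<open>Hence a sublevel set is cut out by the conditions \<open>partial_sum T K \<bullet> X \<le> a\<close>, which are closed
  in \<open>K\<close>; stability need not be imposed separately.\<close>

lemma stable_if_partial_sums_bounded:
  assumes "\<And>T. partial_sum T K \<bullet> X \<le> a"
  shows "stable (cl K)" and "J K \<le> a"
proof -
  have "(\<Sum>t<T. (norm (mpow (cl K) t *v x))\<^sup>2) \<le> a / (mu D * sigma_min Q) * (norm x)\<^sup>2" for T x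
  proof -
    have "mu D * (sigma_min Q * (\<Sum>t<T. (norm (mpow (cl K) t *v x))\<^sup>2)) \<le> mu D * (x \<bullet> (partial_sum T K *v x))"
      unfolding partial_sum_form sum_distrib_left[of "sigma_min Q"]
      by (intro mult_left_mono sum_mono QK_form_ge less_imp_le[OF mu_pos])
    also have "\<dots> \<le> (partial_sum T K \<bullet> X) * (norm x)\<^sup>2" by (rule mu_le_inner_X[OF psd_partial_sum])
    also have "\<dots> \<le> a * (norm x)\<^sup>2" by (intro mult_right_mono assms) simp
    finally show ?thesis using mu_pos sigma_min_pos[OF Q] by (simp add: field_simps)
  qed
  then show st: "stable (cl K)" by (rule stableI)
  have "(\<lambda>T. partial_sum T K) \<longlonglongrightarrow> P K"
    using summable_LIMSEQ[OF summable_lyap[OF st, of "QK K"]]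
    unfolding partial_sum_def P_def lyap_def .
  then have "(\<lambda>T. partial_sum T K \<bullet> X) \<longlonglongrightarrow> P K \<bullet> X" by (intro tendsto_intros)
  then show "J K \<le> a" unfolding cost_eq[OF st]
    by (rule LIMSEQ_le_const2) (use assms in blast)
qed

lemma sublevel_iff: "K \<in> sublevel A B C Q R D a \<longleftrightarrow> (\<forall>T. partial_sum T K \<bullet> X \<le> a)"
  using partial_sum_le_cost stable_if_partial_sums_bounded
  by (auto simp: sublevel_def stabilizing_iff intro: order_trans)

lemma continuous_mpow_cl: "continuous_on UNIV (\<lambda>K. mpow (cl K) t)"
  by (induction t) (auto intro!: continuous_intros matrix_mult.continuous_on continuous_cl)

lemma continuous_QK: "continuous_on UNIV QK"
  by (simp add: continuous_on_eq_continuous_within has_derivative_continuous[OF has_derivative_QK])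

lemma closed_sublevel: "closed (sublevel A B C Q R D a)"
proof -
  have "sublevel A B C Q R D a = {K. \<forall>T. partial_sum T K \<bullet> X \<le> a}" using sublevel_iff by blast
  moreover have "closed {K. \<forall>T. partial_sum T K \<bullet> X \<le> a}"
    unfolding partial_sum_def
    by (intro closed_Collect_all closed_Collect_le continuous_intros matrix_mult.continuous_on
        continuous_mpow_cl continuous_QK
        bounded_linear.continuous_on[OF bounded_linear_transpose])
  ultimately show ?thesis by simp
qed

text \<open>The cost of the first time step alone bounds \<open>K ** C\<close>; the right inverse
  \<open>G\<close> of \<open>C\<close> recovers \<open>K\<close> from it.\<close>

lemma bounded_sublevel:
  assumes G: "C ** G = mat 1"
  shows "bounded (sublevel A B C Q R D a)"
proof -
  let ?c = "a / (mu D * sigma_min R)"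
  have "norm K \<le> sqrt (real CARD('d)) * (sqrt ?c * op_norm G)" if K: "K \<in> sublevel A B C Q R D a" for K
  proof -
    have le: "sigma_min R * mu D * (norm ((K ** C) *v x))\<^sup>2 \<le> a * (norm x)\<^sup>2" for x
    proof -
      have ps1: "partial_sum 1 K = QK K" by (simp add: partial_sum_def)
      have "sigma_min R * (norm ((K ** C) *v x))\<^sup>2 \<le> (K *v (C *v x)) \<bullet> (R *v (K *v (C *v x)))"
        using sigma_min_le[OF R, of "K *v (C *v x)"] by (simp add: matrix_vector_mul_assoc)
      also have "\<dots> \<le> x \<bullet> (QK K *v x)" using psd_Q by (simp add: quadratic_form_QK psd_def)
      finally have "mu D * (sigma_min R * (norm ((K ** C) *v x))\<^sup>2) \<le> mu D * (x \<bullet> (QK K *v x))"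
        using mu_pos by simp
      also have "\<dots> \<le> (QK K \<bullet> X) * (norm x)\<^sup>2" by (rule mu_le_inner_X[OF psd_QK])
      also have "\<dots> \<le> a * (norm x)\<^sup>2"
        using K[unfolded sublevel_iff, rule_format, of 1] unfolding ps1 by (rule mult_right_mono) simp
      finally show ?thesis by (simp add: mult_ac)
    qed
    have pos: "0 < mu D * sigma_min R" using mu_pos sigma_min_pos[OF R] by simp
    have "0 \<le> a"
    proof -
      have "0 \<le> sigma_min R * mu D * (norm ((K ** C) *v axis undefined 1))\<^sup>2" using pos by (simp add: mult.commute)
      then show ?thesis using le[of "axis undefined 1"] by simp
    qed
    have KC: "norm ((K ** C) *v x) \<le> sqrt ?c * norm x" for x
    proof (rule power2_le_imp_le)
      show "(norm ((K ** C) *v x))\<^sup>2 \<le> (sqrt ?c * norm x)\<^sup>2"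
        using le[of x] pos \<open>0 \<le> a\<close> by (simp add: power_mult_distrib field_simps)
    qed (use pos \<open>0 \<le> a\<close> in simp)
    have "op_norm K \<le> sqrt ?c * op_norm G"
      unfolding op_norm_def[of K]
    proof (rule onorm_bound)
      show "norm (K *v y) \<le> sqrt ?c * op_norm G * norm y" for y
      proof -
        have "K *v y = (K ** C) *v (G *v y)" by (simp add: matrix_vector_mul_assoc G flip: matrix_mul_assoc)
        also have "norm \<dots> \<le> sqrt ?c * norm (G *v y)" by (rule KC)
        also have "\<dots> \<le> sqrt ?c * (op_norm G * norm y)"
          using pos \<open>0 \<le> a\<close> by (intro mult_left_mono norm_le_op_norm) simp
        finally show ?thesis by simp
      qed
    qed (use pos \<open>0 \<le> a\<close> in \<open>simp add: op_norm_nonneg\<close>)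
    then show ?thesis
      using norm_le_op_norm_card[of K] by (meson mult_left_mono order_trans real_sqrt_ge_zero of_nat_0_le_iff)
  qed
  then show ?thesis unfolding bounded_iff by blast
qed

section \<open>Derivative of the cost and separation of its sublevel sets\<close>

lemma cost_has_derivative:
  assumes "stable (cl K)"
  shows "(J has_derivative (\<lambda>Z. P1 K Z \<bullet> X)) (at K)"
proof (rule has_derivative_transform_within_open[OF _ open_stabilizing])
  show "((\<lambda>K. P K \<bullet> X) has_derivative (\<lambda>Z. P1 K Z \<bullet> X)) (at K)"
    by (rule has_derivative_inner_left[OF has_derivative_P[OF assms]])
  show "K \<in> stabilizing A B C" using assms by (simp add: stabilizing_iff)
  show "\<And>K. K \<in> stabilizing A B C \<Longrightarrow> P K \<bullet> X = J K" by (simp add: stabilizing_iff cost_eq)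
qed

lemma open_strict_sublevel: "open (strict_sublevel A B C Q R D a)"
proof -
  have "continuous_on (stabilizing A B C) J"
    using has_derivative_continuous[OF cost_has_derivative]
    by (intro continuous_at_imp_continuous_on) (auto simp: stabilizing_iff)
  then have "open (stabilizing A B C \<inter> J -` {..<a})"
    by (rule continuous_open_preimage[OF _ open_stabilizing open_lessThan])
  also have "stabilizing A B C \<inter> J -` {..<a} = strict_sublevel A B C Q R D a"
    by (auto simp: strict_sublevel_def)
  finally show ?thesis .
qed

lemma d_bar_le:
  assumes "K \<in> sublevel A B C Q R D \<beta>" "K' \<notin> strict_sublevel A B C Q R D \<alpha>"
  shows "d_bar A B C Q R D \<alpha> \<beta> \<le> op_norm (K - K')"
  unfolding d_bar_def
  by (rule cInf_lower) (use assms op_norm_nonneg in \<open>auto intro!: bdd_belowI[of _ 0]\<close>)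

text \<open>A compact set and a disjoint closed set have positive Frobenius distance, which
  equivalence of norms transfers to \<open>op_norm\<close>. The infimum is over a nonempty set
  because a bounded sublevel set cannot be the whole space.\<close>

lemma d_bar_pos:
  assumes G: "C ** G = mat 1" and ne: "sublevel A B C Q R D \<beta> \<noteq> {}" and "\<beta> < \<alpha>"
  shows "0 < d_bar A B C Q R D \<alpha> \<beta>"
proof -
  let ?S = "sublevel A B C Q R D \<beta>" and ?T = "- strict_sublevel A B C Q R D \<alpha>"
  have "compact ?S" using bounded_sublevel[OF G] closed_sublevel by (simp add: compact_eq_bounded_closed)
  moreover have "closed ?T" using open_strict_sublevel by (simp add: closed_Compl)
  moreover have "?S \<inter> ?T = {}" using \<open>\<beta> < \<alpha>\<close> by (auto simp: sublevel_def strict_sublevel_def)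
  ultimately obtain d where d: "0 < d" "\<And>x y. x \<in> ?S \<Longrightarrow> y \<in> ?T \<Longrightarrow> d \<le> dist x y"
    using separate_compact_closed by metis
  have "?T \<noteq> {}"
  proof
    assume "?T = {}"
    then have "strict_sublevel A B C Q R D \<alpha> = UNIV" by blast
    moreover have "strict_sublevel A B C Q R D \<alpha> \<subseteq> sublevel A B C Q R D \<alpha>"
      by (auto simp: sublevel_def strict_sublevel_def)
    ultimately have "bounded (UNIV :: (real ^ 'd ^ 'm) set)" using bounded_sublevel[OF G, of \<alpha>] by (simp add: top.extremum_unique)
    then show False using not_bounded_UNIV by blast
  qed
  have "d / sqrt (real CARD('d)) \<le> d_bar A B C Q R D \<alpha> \<beta>"
    unfolding d_bar_def
  proof (rule cInf_greatest)
    show "{op_norm (K - K') | K K'. K \<in> ?S \<and> K' \<in> ?T} \<noteq> {}" using ne \<open>?T \<noteq> {}\<close> by blast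
    fix r assume "r \<in> {op_norm (K - K') | K K'. K \<in> ?S \<and> K' \<in> ?T}"
    then obtain K K' where r: "r = op_norm (K - K')" "K \<in> ?S" "K' \<in> ?T" by blast
    have "d \<le> norm (K - K')" using d(2)[OF r(2,3)] by (simp add: dist_norm)
    also have "\<dots> \<le> sqrt (real CARD('d)) * r" unfolding r(1) by (rule norm_le_op_norm_card)
    finally show "d / sqrt (real CARD('d)) \<le> r" by (simp add: field_simps)
  qed
  moreover have "0 < d / sqrt (real CARD('d))" using d(1) by simp
  ultimately show ?thesis by linarith
qed

lemma gam_bound:
  assumes G: "C ** G = mat 1" and K: "K \<in> sublevel A B C Q R D \<alpha>"
  shows "norm (cl K *v x) \<le> gam A B C Q R D \<alpha> * norm x"
proof -
  have "compact (cl ` sublevel A B C Q R D \<alpha>)"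
    using bounded_sublevel[OF G] closed_sublevel
    by (intro compact_continuous_image continuous_on_subset[OF continuous_cl]) (auto simp: compact_eq_bounded_closed)
  then obtain b where b: "\<And>K. K \<in> sublevel A B C Q R D \<alpha> \<Longrightarrow> norm (cl K) \<le> b"
    using compact_imp_bounded bounded_iff by (metis (no_types, lifting) imageI)
  have "op_norm (cl K) \<le> gam A B C Q R D \<alpha>"
    unfolding gam_def
    by (intro cSUP_upper K bdd_aboveI2[of _ _ b]) (use b op_norm_le_norm order_trans in blast)
  then show ?thesis using norm_le_op_norm[of "cl K" x] by (meson mult_right_mono norm_ge_zero order_trans)
qed

end

section \<open>Gradient and Hessian\<close>

text \<open>\<open>adjoint f' 1\<close> is the Riesz representative of the derivative. Its
  uniqueness is required because \<open>gradient\<close> is defined by \<open>THE\<close>.\<close>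

lemma gradient_inner:
  fixes f :: "'a::euclidean_space \<Rightarrow> real"
  assumes "(f has_derivative f') (at x)"
  shows "gradient f x \<bullet> h = f' h"
proof -
  have lin: "linear f'" using assms by (rule has_derivative_linear)
  have "(f has_derivative (\<lambda>h. h \<bullet> adjoint f' 1)) (at x)"
    using assms by (simp add: adjoint_works[OF lin])
  then have "GDERIV f x :> adjoint f' 1" by (simp add: gderiv_def)
  moreover have "g = adjoint f' 1" if "GDERIV f x :> g" for g
  proof -
    have "(\<lambda>h. h \<bullet> g) = f'"
      using that assms unfolding gderiv_def by (rule has_derivative_unique)
    then have "h \<bullet> g = h \<bullet> adjoint f' 1" for h by (auto simp: adjoint_works[OF lin])
    then show ?thesis using vector_eq_ldot by blast
  qed
  ultimately have "gradient f x = adjoint f' 1" unfolding gradient_def by (rule the_equality)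
  then show ?thesis by (simp add: inner_commute[of _ h] adjoint_works[OF lin])
qed

lemma bounded_linear_unvectorize: "bounded_linear (unvectorize :: real ^ ('d \<times> 'm) \<Rightarrow> real ^ 'd ^ 'm)"
  unfolding linear_conv_bounded_linear[symmetric]
  by (rule linearI) (simp_all add: unvectorize_def vec_eq_iff)

lemma norm_vectorize: "norm (vectorize K) = norm K"
proof -
  have "vectorize K \<bullet> vectorize K = (\<Sum>(j, i)\<in>UNIV \<times> UNIV. K $ i $ j * K $ i $ j)"
    by (simp add: vectorize_def inner_vec_def case_prod_beta)
  also have "\<dots> = (\<Sum>j\<in>UNIV. \<Sum>i\<in>UNIV. K $ i $ j * K $ i $ j)" by (rule sum.cartesian_product[symmetric])
  also have "\<dots> = K \<bullet> K" by (subst sum.swap) (simp add: inner_vec_def)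
  finally show ?thesis by (simp add: norm_eq_sqrt_inner)
qed

context sof begin

lemma gradient_cost: "stable (cl K) \<Longrightarrow> gradient J K \<bullet> Z = P1 K Z \<bullet> X"
  by (rule gradient_inner[OF cost_has_derivative])

text \<open>A \<open>jacobian\<close> represents the derivative only where the map is
  differentiable, so differentiability of the gradient is first shown coordinate by coordinate from
  the formula with \<open>P2\<close>.\<close>

lemma hessian_form:
  assumes st: "stable (cl K)"
  defines "H \<equiv> hessian (\<lambda>v. J (unvectorize v)) (vectorize K)"
  shows "k \<bullet> (H *v h) = P2 K (unvectorize k) (unvectorize h) \<bullet> X"
proof -
  define g where "g = (\<lambda>v :: real ^ ('d \<times> 'm). J (unvectorize v))"
  define S where "S = (unvectorize :: real ^ ('d \<times> 'm) \<Rightarrow> real ^ 'd ^ 'm) -` stabilizing A B C"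
  have "continuous_on UNIV (unvectorize :: real ^ ('d \<times> 'm) \<Rightarrow> real ^ 'd ^ 'm)"
    by (rule linear_continuous_on[OF bounded_linear_unvectorize])
  then have openS: "open S" unfolding S_def by (rule open_vimage[OF open_stabilizing])
  have vS: "vectorize K \<in> S" using st by (simp add: S_def stabilizing_iff)
  have unv: "(unvectorize has_derivative unvectorize) (at v)" for v :: "real ^ ('d \<times> 'm)"
    by (rule bounded_linear_imp_has_derivative[OF bounded_linear_unvectorize])
  have grad: "gradient g v \<bullet> h = P1 (unvectorize v) (unvectorize h) \<bullet> X" if "v \<in> S" for v h
  proof (rule gradient_inner)
    show "(g has_derivative (\<lambda>h. P1 (unvectorize v) (unvectorize h) \<bullet> X)) (at v)"
      unfolding g_def using that has_derivative_compose[OF unv cost_has_derivative]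
      by (simp add: S_def stabilizing_iff)
  qed
  have comp: "((\<lambda>v. gradient g v \<bullet> k) has_derivative (\<lambda>h. P2 K (unvectorize k) (unvectorize h) \<bullet> X)) (at (vectorize K))" for k
  proof (rule has_derivative_transform_within_open[OF _ openS vS])
    have "((\<lambda>v. P1 (unvectorize v) (unvectorize k)) has_derivative (\<lambda>h. P2 K (unvectorize k) (unvectorize h))) (at (vectorize K))"
      using has_derivative_compose[OF unv, of "\<lambda>K. P1 K (unvectorize k)"] has_derivative_P1[OF st] by simp
    then show "((\<lambda>v. P1 (unvectorize v) (unvectorize k) \<bullet> X) has_derivative (\<lambda>h. P2 K (unvectorize k) (unvectorize h) \<bullet> X)) (at (vectorize K))"
      by (rule has_derivative_inner_left)
  qed (simp add: grad)
  have "gradient g = (\<lambda>v. \<Sum>b\<in>Basis. (gradient g v \<bullet> b) *\<^sub>R b)" by (simp add: euclidean_representation)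
  moreover have "((\<lambda>v. \<Sum>b\<in>Basis. (gradient g v \<bullet> b) *\<^sub>R b) has_derivative
      (\<lambda>h. \<Sum>b\<in>Basis. (P2 K (unvectorize b) (unvectorize h) \<bullet> X) *\<^sub>R b)) (at (vectorize K))"
    by (intro has_derivative_sum has_derivative_scaleR_left comp)
  ultimately have "gradient g differentiable (at (vectorize K))"
    unfolding differentiable_def by metis
  then have "(gradient g has_derivative (\<lambda>h. H *v h)) (at (vectorize K))"
    unfolding H_def hessian_def g_def[symmetric] jacobian_works .
  then have "((\<lambda>v. gradient g v \<bullet> k) has_derivative (\<lambda>h. (H *v h) \<bullet> k)) (at (vectorize K))"
    by (rule has_derivative_inner_left)
  from has_derivative_unique[OF this comp[of k]] show ?thesis
    by (metis inner_commute)
qed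

lemma P2_commute: "stable (cl K) \<Longrightarrow> P2 K Z W = P2 K W Z"
  by (simp add: P2_def S2_commute)

lemma lambda_min_hessian_le:
  assumes st: "stable (cl K)"
  shows "lambda_min (hessian (\<lambda>v. J (unvectorize v)) (vectorize K)) * (norm Z)\<^sup>2 \<le> P2 K Z Z \<bullet> X"
proof -
  let ?H = "hessian (\<lambda>v. J (unvectorize v)) (vectorize K)"
  have "(transpose ?H *v k) \<bullet> h = (?H *v k) \<bullet> h" for h k
    using hessian_form[OF st, of k h] hessian_form[OF st, of h k] P2_commute[OF st]
    by (metis inner_commute inner_transpose_vec)
  then have "transpose ?H *v k = ?H *v k" for k using vector_eq_rdot by blast
  then have "transpose ?H = ?H" unfolding matrix_eq by blast
  then show ?thesis
    using lambda_min_le[of ?H "vectorize Z"] hessian_form[OF st, of "vectorize Z" "vectorize Z"]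
    by (simp add: norm_vectorize)
qed

end

section \<open>The gradient step\<close>

text \<open>Takes the place of integrating an inequality along a segment.\<close>

lemma DERIV_le_imp_diff_le:
  fixes f g :: "real \<Rightarrow> real"
  assumes "a \<le> b" and "\<And>t. a \<le> t \<Longrightarrow> t \<le> b \<Longrightarrow> (f has_real_derivative f' t) (at t)"
    and "\<And>t. a \<le> t \<Longrightarrow> t \<le> b \<Longrightarrow> (g has_real_derivative g' t) (at t)"
    and "\<And>t. a \<le> t \<Longrightarrow> t \<le> b \<Longrightarrow> f' t \<le> g' t"
  shows "f b - f a \<le> g b - g a"
proof -
  have "(\<lambda>t. g t - f t) a \<le> (\<lambda>t. g t - f t) b"
  proof (rule DERIV_nonneg_imp_nondecreasing[OF assms(1)])
    fix t assume t: "a \<le> t" "t \<le> b"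
    have "((\<lambda>t. g t - f t) has_real_derivative g' t - f' t) (at t)"
      by (intro derivative_intros assms t)
    then show "\<exists>y. ((\<lambda>t. g t - f t) has_real_derivative y) (at t) \<and> 0 \<le> y"
      using assms(4)[OF t] by (intro exI[of _ "g' t - f' t"]) simp
  qed
  then show ?thesis by simp
qed

lemma has_derivative_along_line:
  fixes F :: "'a::real_normed_vector \<Rightarrow> 'b::real_inner"
  assumes "(F has_derivative F') (at (x + t *\<^sub>R e))"
  shows "((\<lambda>t. F (x + t *\<^sub>R e) \<bullet> y) has_real_derivative F' e \<bullet> y) (at t)"
proof -
  have "((\<lambda>t. x + t *\<^sub>R e) has_derivative (\<lambda>h. 0 + h *\<^sub>R e)) (at t)"
    by (intro derivative_intros)
  from has_derivative_compose[OF this assms]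
  have "((\<lambda>t. F (x + t *\<^sub>R e)) has_derivative (\<lambda>h. F' (h *\<^sub>R e))) (at t)" by simp
  then have "((\<lambda>t. F (x + t *\<^sub>R e) \<bullet> y) has_derivative (\<lambda>h. F' (h *\<^sub>R e) \<bullet> y)) (at t)"
    by (rule has_derivative_inner_left)
  then show ?thesis
    unfolding has_field_derivative_def
    by (simp add: linear_scale[OF has_derivative_linear[OF assms]] mult.commute[of _ "F' e \<bullet> y"])
qed

context sof begin

lemma bilinear_hessian:
  assumes "stable (cl K)"
  shows "bilinear (\<lambda>Z W. P2 K Z W \<bullet> X)"
proof -
  have "linear (\<lambda>W. P2 K Z W \<bullet> X)" for Z
    by (rule linear_compose[OF has_derivative_linear[OF has_derivative_P1[OF assms]]
          bounded_linear.linear[OF bounded_linear_inner_left], unfolded o_def])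
  then show ?thesis unfolding bilinear_def using P2_commute[OF assms] by simp
qed

text \<open>Here \<open>e\<close> is the error before the step and \<open>w\<close> the one after.
  With H_t the Hessian at \<open>K + t *\<^sub>R e\<close>, the square of \<open>norm w\<close> is
  the integral over t in [0,1] of w . (1 - \<eta> H_t) e. The form of 1 - \<eta> H_t lies between 0,
  as \<eta> L is at most 1, and \<open>c t\<close>, as the third derivative lets the Hessian drop
  below \<open>l\<close> by at most \<open>M * norm e * t\<close>. Cauchy--Schwarz bounds the
  integrand by \<open>c t * (norm w * norm e)\<close>, and \<open>c\<close> integrates to the stated
  factor.\<close>

lemma gradient_step_contracts:
  fixes K e :: "real ^ 'd ^ 'm"
  assumes G: "C ** G = mat 1"
    and seg: "\<And>t. 0 \<le> t \<Longrightarrow> t \<le> 1 \<Longrightarrow> K + t *\<^sub>R e \<in> sublevel A B C Q R D \<alpha>"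
    and l: "\<And>Z. l * (norm Z)\<^sup>2 \<le> P2 K Z Z \<bullet> X"
    and crit: "gradient J K = 0"
    and \<eta>: "0 < \<eta>" "\<eta> * L_const B C Q R D \<alpha> \<le> 1"
  defines "M \<equiv> M_const A B C Q R D \<alpha>"
  shows "norm (e - \<eta> *\<^sub>R gradient J (K + e)) \<le> (1 - \<eta> * l + \<eta> * M * norm e / 2) * norm e"
proof -
  define w where "w = e - \<eta> *\<^sub>R gradient J (K + e)"
  define c where "c t = 1 - \<eta> * l + \<eta> * M * norm e * t" for t
  have sub: "sof_sublevel A B C Q R D (K + t *\<^sub>R e) \<alpha>" if "0 \<le> t" "t \<le> 1" for t
    using seg[OF that] gam_bound[OF G seg[OF that]]
    by unfold_locales (auto simp: sublevel_def stabilizing_iff)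
  note st = sof_sublevel.stable[OF sub]
  have P2_lower: "P2 (K + t *\<^sub>R e) Z Z \<bullet> X \<ge> (l - M * norm e * t) * (norm Z)\<^sup>2" if t: "0 \<le> t" "t \<le> 1" for t Z
  proof -
    let ?f = "\<lambda>t. - (P2 (K + t *\<^sub>R e) Z Z \<bullet> X)"
    have "?f t - ?f 0 \<le> M * (norm Z)\<^sup>2 * norm e * t - M * (norm Z)\<^sup>2 * norm e * 0"
    proof (rule DERIV_le_imp_diff_le[OF t(1)])
      fix s assume "0 \<le> s" "s \<le> t"
      then have s: "0 \<le> s" "s \<le> 1" using t by auto
      show "(?f has_real_derivative - (lyap (cl (K + s *\<^sub>R e)) (S3 (K + s *\<^sub>R e) Z e) \<bullet> X)) (at s)"
        by (intro DERIV_minus has_derivative_along_line has_derivative_P2 st s)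
      show "((\<lambda>t. M * (norm Z)\<^sup>2 * norm e * t) has_real_derivative M * (norm Z)\<^sup>2 * norm e) (at s)"
        by (auto intro!: derivative_eq_intros)
      show "- (lyap (cl (K + s *\<^sub>R e)) (S3 (K + s *\<^sub>R e) Z e) \<bullet> X) \<le> M * (norm Z)\<^sup>2 * norm e"
        using sof_sublevel.Phi_S3_le_M[OF sub[OF s], of Z e] unfolding M_def \<Phi>_def by linarith
    qed
    then show ?thesis using l[of Z] by (simp add: algebra_simps)
  qed
  have P2_upper: "P2 (K + t *\<^sub>R e) Z Z \<bullet> X \<le> L_const B C Q R D \<alpha> * (norm Z)\<^sup>2" if t: "0 \<le> t" "t \<le> 1" for t Z
    using sof_sublevel.Phi_S2_le_L[OF sub[OF t], of Z] unfolding \<Phi>_def P2_def[symmetric] by linarith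
  have H_le: "\<bar>Z \<bullet> Z - \<eta> * (P2 (K + t *\<^sub>R e) Z Z \<bullet> X)\<bar> \<le> c t * (Z \<bullet> Z)" if t: "0 \<le> t" "t \<le> 1" for t Z
  proof -
    have "\<eta> * (P2 (K + t *\<^sub>R e) Z Z \<bullet> X) \<le> \<eta> * (L_const B C Q R D \<alpha> * (norm Z)\<^sup>2)"
      using \<eta>(1) P2_upper[OF t] by (intro mult_left_mono) auto
    also have "\<dots> \<le> 1 * (norm Z)\<^sup>2" unfolding mult.assoc[symmetric] by (rule mult_right_mono[OF \<eta>(2)]) simp
    finally have 1: "0 \<le> Z \<bullet> Z - \<eta> * (P2 (K + t *\<^sub>R e) Z Z \<bullet> X)" by (simp add: power2_norm_eq_inner)
    have "\<eta> * ((l - M * norm e * t) * (norm Z)\<^sup>2) \<le> \<eta> * (P2 (K + t *\<^sub>R e) Z Z \<bullet> X)"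
      using \<eta>(1) P2_lower[OF t] by (intro mult_left_mono) auto
    then have "Z \<bullet> Z - \<eta> * (P2 (K + t *\<^sub>R e) Z Z \<bullet> X) \<le> c t * (Z \<bullet> Z)"
      unfolding c_def power2_norm_eq_inner by (simp add: algebra_simps)
    with 1 show ?thesis by simp
  qed
  have c_nonneg: "0 \<le> c t" if t: "0 \<le> t" "t \<le> 1" for t
  proof -
    let ?Z = "axis undefined (axis undefined 1) :: real ^ 'd ^ 'm"
    have "0 \<le> c t * (?Z \<bullet> ?Z)" by (rule order_trans[OF abs_ge_zero H_le[OF t]])
    then show ?thesis by (simp add: inner_axis_axis)
  qed
  have H_bound: "w \<bullet> e - \<eta> * (P2 (K + t *\<^sub>R e) w e \<bullet> X) \<le> c t * (norm w * norm e)" if t: "0 \<le> t" "t \<le> 1" for t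
  proof -
    have "(w \<bullet> e - \<eta> * (P2 (K + t *\<^sub>R e) w e \<bullet> X))\<^sup>2 \<le> (c t * (w \<bullet> w)) * (c t * (e \<bullet> e))"
    proof (rule form_Cauchy_Schwarz[where s = "\<lambda>Z W. Z \<bullet> W - \<eta> * (P2 (K + t *\<^sub>R e) Z W \<bullet> X)" and q = "\<lambda>Z W. c t * (Z \<bullet> W)"])
      note bl = bilinear_hessian[OF st[OF t]]
      have "linear (\<lambda>W. Z \<bullet> W - \<eta> *\<^sub>R (P2 (K + t *\<^sub>R e) Z W \<bullet> X))" for Z
        by (intro linear_compose_sub linear_compose_scale_right bounded_linear.linear[OF bounded_linear_inner_right])
          (use bl in \<open>simp add: bilinear_def\<close>)
      then show "bilinear (\<lambda>Z W. Z \<bullet> W - \<eta> * (P2 (K + t *\<^sub>R e) Z W \<bullet> X))"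
        unfolding bilinear_def real_scaleR_def by (simp add: inner_commute P2_commute[OF st[OF t]])
      show "bilinear (\<lambda>Z W :: real ^ 'd ^ 'm. c t * (Z \<bullet> W))"
        unfolding bilinear_def
        by (intro conjI allI linearI) (simp_all add: inner_add_left inner_add_right distrib_left)
    qed (rule H_le[OF t] | simp add: inner_commute P2_commute[OF st[OF t]])+
    also have "\<dots> = (c t * (norm w * norm e))\<^sup>2"
      unfolding power2_norm_eq_inner[symmetric] by (simp only: power2_eq_square mult_ac)
    finally have "\<bar>w \<bullet> e - \<eta> * (P2 (K + t *\<^sub>R e) w e \<bullet> X)\<bar> \<le> \<bar>c t * (norm w * norm e)\<bar>"
      by (simp only: abs_le_square_iff)
    also have "\<dots> = c t * (norm w * norm e)"
      by (intro abs_of_nonneg mult_nonneg_nonneg c_nonneg t norm_ge_zero)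
    finally show ?thesis by linarith
  qed
  \<comment> \<open>Antiderivatives of the two sides of \<open>H_bound\<close>. The gradient term of
    \<open>?f 0\<close> vanishes because \<open>K\<close> is critical.\<close>
  let ?f = "\<lambda>t. t * (w \<bullet> e) - \<eta> * (P1 (K + t *\<^sub>R e) w \<bullet> X)"
  let ?g = "\<lambda>t. ((1 - \<eta> * l) * t + \<eta> * M * norm e * t\<^sup>2 / 2) * (norm w * norm e)"
  have "?f 1 - ?f 0 \<le> ?g 1 - ?g 0"
  proof (rule DERIV_le_imp_diff_le)
    fix t :: real assume t: "0 \<le> t" "t \<le> 1"
    have "((\<lambda>t. P1 (K + t *\<^sub>R e) w \<bullet> X) has_real_derivative P2 (K + t *\<^sub>R e) w e \<bullet> X) (at t)"
      by (intro has_derivative_along_line has_derivative_P1 st t)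
    then show "(?f has_real_derivative w \<bullet> e - \<eta> * (P2 (K + t *\<^sub>R e) w e \<bullet> X)) (at t)"
      by (auto intro!: derivative_eq_intros)
    show "(?g has_real_derivative c t * (norm w * norm e)) (at t)"
      unfolding c_def by (auto intro!: derivative_eq_intros)
    show "w \<bullet> e - \<eta> * (P2 (K + t *\<^sub>R e) w e \<bullet> X) \<le> c t * (norm w * norm e)" by (rule H_bound[OF t])
  qed simp
  moreover have "P1 (K + e) w \<bullet> X = gradient J (K + e) \<bullet> w"
    using gradient_cost[OF st[of 1]] by simp
  moreover have "P1 K w \<bullet> X = 0" using gradient_cost[OF st[of 0], of w] crit by simp
  moreover have "w \<bullet> w = w \<bullet> e - \<eta> * (gradient J (K + e) \<bullet> w)"
    by (subst (2) w_def) (simp add: inner_diff_right inner_commute)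
  ultimately have "norm w * norm w \<le> norm w * ((1 - \<eta> * l + \<eta> * M * norm e / 2) * norm e)"
    by (simp add: algebra_simps power2_eq_square flip: power2_norm_eq_inner)
  \<comment> \<open>The factor is the value of \<open>c\<close> at the midpoint, so
    \<open>c_nonneg\<close> applies.\<close>
  moreover have "0 \<le> (1 - \<eta> * l + \<eta> * M * norm e / 2) * norm e"
    using c_nonneg[of "1 / 2"] by (simp add: c_def)
  ultimately have "norm w \<le> (1 - \<eta> * l + \<eta> * M * norm e / 2) * norm e"
    by (cases "norm w = 0") auto
  then show ?thesis unfolding w_def .
qed

lemma gradient_zero_at_local_min:
  assumes st: "stable (cl K)" and min: "\<forall>\<^sub>F K' in at K within stabilizing A B C. J K \<le> J K'"
  shows "gradient J K = 0"
proof -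
  have "K \<in> stabilizing A B C" using st by (simp add: stabilizing_iff)
  then have "\<forall>\<^sub>F K' in at K. J K \<le> J K'"
    using min at_within_open[OF _ open_stabilizing] by metis
  then obtain d where "0 < d" "\<And>K'. K' \<noteq> K \<Longrightarrow> dist K' K < d \<Longrightarrow> J K \<le> J K'"
    unfolding eventually_at by blast
  then have "\<And>K'. K' \<in> ball K d \<Longrightarrow> J K \<le> J K'" by (metis dist_commute mem_ball order_refl)
  then have "(\<lambda>Z. P1 K Z \<bullet> X) = (\<lambda>Z. 0)"
    using differential_zero_maxmin[OF _ open_ball cost_has_derivative[OF st], of K d] \<open>0 < d\<close> by auto
  then have "gradient J K \<bullet> gradient J K = 0"
    using gradient_cost[OF st, of "gradient J K"] by (simp only: fun_eq_iff)
  then show ?thesis by simp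
qed

end

section \<open>The recursion for the distances\<close>

text \<open>For \<open>u > 0\<close> and \<open>x = rbar * u / (u + v)\<close>, the quantity 1/x -
  1/rbar equals v / (rbar u), so the claim is its growth by the factor \<open>1 + q\<close>. It
  comes down to \<open>(u + (1 - q) * v) * (u + (1 + q) * v) = (u + v)\<^sup>2 - q\<^sup>2 *
  v\<^sup>2\<close>. The form with \<open>u\<close> and \<open>v\<close> also covers a start at the
  minimum itself, \<open>u = 0\<close>.\<close>

lemma contraction_step:
  fixes q rbar u v x :: real
  assumes q: "0 \<le> q" "q \<le> 1" and rbar: "0 < rbar" and u: "0 \<le> u" and v: "0 < v"
    and x: "0 \<le> x" "x \<le> rbar * u / (u + v)"
  shows "(1 - q + q * x / rbar) * x \<le> rbar * u / (u + (1 + q) * v)"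
proof -
  let ?y = "rbar * u / (u + v)"
  have "0 \<le> q * u / (u + v)" using q u v by simp
  then have "(1 - q + q * x / rbar) * x \<le> (1 - q + q * ?y / rbar) * ?y"
    using q x rbar by (intro mult_mono add_mono divide_right_mono mult_left_mono) auto
  also have "1 - q + q * ?y / rbar = (u + (1 - q) * v) / (u + v)"
  proof -
    have "u + v \<noteq> 0" using u v by simp
    moreover have "q * ?y / rbar = q * u / (u + v)" using rbar by simp
    ultimately show ?thesis by (simp add: field_simps)
  qed
  also have "(u + (1 - q) * v) / (u + v) * ?y \<le> rbar * u / (u + (1 + q) * v)"
  proof -
    have "(u + (1 - q) * v) * (u + (1 + q) * v) \<le> (u + v) * (u + v)"
      using mult_nonneg_nonneg[of "q * v" "q * v"] q v by (simp add: algebra_simps)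
    then have "rbar * u * ((u + (1 - q) * v) * (u + (1 + q) * v)) \<le> rbar * u * ((u + v) * (u + v))"
      using rbar u by (intro mult_left_mono) auto
    moreover have "0 < u + v" "0 < u + (1 + q) * v" using u v q by (auto intro: add_nonneg_pos)
    ultimately show ?thesis by (simp add: divide_le_eq le_divide_eq mult_ac)
  qed
  finally show ?thesis .
qed

lemma contraction_rate:
  fixes q rbar r0 :: real
  assumes "0 \<le> q" "0 \<le> r0" "r0 < rbar"
  shows "rbar * r0 / (r0 + (1 + q) ^ i * (rbar - r0)) \<le> rbar * r0 / (rbar - r0) * (1 / (1 + q)) ^ i"
proof -
  have "rbar * r0 / (r0 + (1 + q) ^ i * (rbar - r0)) \<le> rbar * r0 / ((1 + q) ^ i * (rbar - r0))"
    using assms by (intro divide_left_mono mult_pos_pos add_nonneg_pos mult_nonneg_nonneg) auto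
  then show ?thesis by (simp add: power_one_over field_simps)
qed

text \<open>Keeps the iterates in the ball of radius \<open>r0\<close>, where segments to the
  minimum stay in the sublevel set. The final geometric bound may exceed \<open>r0\<close> and
  cannot serve this purpose.\<close>

lemma contraction_le_initial:
  fixes q rbar r0 :: real
  assumes "0 \<le> q" "0 \<le> r0" "r0 < rbar"
  shows "rbar * r0 / (r0 + (1 + q) ^ i * (rbar - r0)) \<le> r0"
proof -
  have "1 * (rbar - r0) \<le> (1 + q) ^ i * (rbar - r0)"
    using assms by (intro mult_right_mono one_le_power) auto
  then have "rbar \<le> r0 + (1 + q) ^ i * (rbar - r0)" by simp
  then have "rbar * r0 \<le> r0 * (r0 + (1 + q) ^ i * (rbar - r0))"
    using assms(2) by (metis mult.commute mult_left_mono)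
  then show ?thesis using assms \<open>rbar \<le> _\<close> by (simp add: divide_le_eq)
qed

theorem theorem2:
  fixes A :: "real ^ 'n ^ 'n" and B :: "real ^ 'm ^ 'n" and C :: "real ^ 'n ^ 'd"
    and Q :: "real ^ 'n ^ 'n" and R :: "real ^ 'm ^ 'm"
    and D :: "(real ^ 'n) measure"
    and Kstar :: "real ^ 'd ^ 'm"
    and \<alpha> \<beta> :: real
  assumes "controllable A B" and "observable C A" and "lin_indep_rows C"
    and "pos_def Q" and "pos_def R"
    and "prob_space D" and "sets D = sets borel"
    and "integrable D outer" and "pos_def (second_moment D)"
    and "stabilizing A B C \<noteq> {}"
    and "Kstar \<in> stabilizing A B C"
    and "\<forall>K \<in> stabilizing A B C. cost A B C Q R D Kstar \<le> cost A B C Q R D K"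
    and "\<alpha> > \<beta>" and "\<beta> \<ge> cost A B C Q R D Kstar"
  shows "d_bar A B C Q R D \<alpha> \<beta> > 0 \<and>
    (\<forall>(Ksharp :: real ^ 'd ^ 'm) l rbar r0 (K :: nat \<Rightarrow> real ^ 'd ^ 'm) \<eta>.
       Ksharp \<in> sublevel A B C Q R D \<beta> \<longrightarrow>
       (\<forall>\<^sub>F K' in at Ksharp within stabilizing A B C.
          cost A B C Q R D Ksharp \<le> cost A B C Q R D K') \<longrightarrow>
       l = lambda_min (hessian (\<lambda>v. cost A B C Q R D (unvectorize v)) (vectorize Ksharp)) \<longrightarrow>
       l > 0 \<longrightarrow>
       rbar = 2 * l / M_const A B C Q R D \<alpha> \<longrightarrow>
       r0 = norm (K 0 - Ksharp) \<longrightarrow>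
       r0 < rbar \<longrightarrow>
       rbar * r0 / (rbar - r0) \<le> d_bar A B C Q R D \<alpha> \<beta> \<longrightarrow>
       \<eta> \<in> {0 <.. 1 / L_const B C Q R D \<alpha>} \<longrightarrow>
       (\<forall>i. K (Suc i) = K i - \<eta> *\<^sub>R gradient (cost A B C Q R D) (K i)) \<longrightarrow>
       (\<forall>i. norm (K i - Ksharp) \<le> rbar * r0 / (rbar - r0) * (1 / (1 + \<eta> * l)) ^ i))"
proof -
  interpret sof A B C Q R D
    by (rule sof.intro) (fact assms)+
  have "(\<exists>G. C ** G = mat 1)"
    unfolding matrix_right_invertible_independent_rows
  proof (intro allI impI)
    fix c i assume 0: "(\<Sum>i\<in>UNIV. c i *s row i C) = 0"
    have inj: "inj (\<lambda>i. row i C)" and ind: "independent (rows C)"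
      using assms(3) unfolding lin_indep_rows_def by auto
    \<comment> \<open>Moves the coefficients from row indices to the rows themselves, which
      injectivity of the row map allows.\<close>
    let ?u = "\<lambda>v. c (the_inv (\<lambda>i. row i C) v)"
    have rows: "rows C = range (\<lambda>i. row i C)" by (auto simp: rows_def)
    have "(\<Sum>v\<in>rows C. ?u v *\<^sub>R v) = (\<Sum>i\<in>UNIV. c i *\<^sub>R row i C)"
      unfolding rows by (subst sum.reindex[OF inj]) (simp add: the_inv_f_f[OF inj])
    also have "\<dots> = 0" using 0 by (simp add: scalar_mult_eq_scaleR)
    finally have "?u (row i C) = 0"
      using ind rows by (intro independentD[OF ind, of "rows C"]) auto
    then show "c i = 0" by (simp add: the_inv_f_f[OF inj])
  qed
  then obtain G where G: "C ** G = mat 1" by blast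
  have "Kstar \<in> sublevel A B C Q R D \<beta>" using assms(11,14) by (simp add: sublevel_def)
  then have dpos: "0 < d_bar A B C Q R D \<alpha> \<beta>" using d_bar_pos[OF G _ \<open>\<alpha> > \<beta>\<close>] by blast
  {
    fix Ksharp :: "real ^ 'd ^ 'm" and l rbar r0 and K :: "nat \<Rightarrow> real ^ 'd ^ 'm" and \<eta> :: real and i :: nat
    define M where "M = M_const A B C Q R D \<alpha>"
    define L where "L = L_const B C Q R D \<alpha>"
    assume sharp: "Ksharp \<in> sublevel A B C Q R D \<beta>"
      and min: "\<forall>\<^sub>F K' in at Ksharp within stabilizing A B C. J Ksharp \<le> J K'"
      and l_def: "l = lambda_min (hessian (\<lambda>v. J (unvectorize v)) (vectorize Ksharp))"
      and l: "l > 0" and rbar: "rbar = 2 * l / M" and r0: "r0 = norm (K 0 - Ksharp)" "r0 < rbar"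
      and dist: "rbar * r0 / (rbar - r0) \<le> d_bar A B C Q R D \<alpha> \<beta>"
      and \<eta>: "0 < \<eta>" "\<eta> \<le> 1 / L"
      and step: "\<And>i. K (Suc i) = K i - \<eta> *\<^sub>R gradient J (K i)"
    have st: "stable (cl Ksharp)" using sharp by (simp add: sublevel_def stabilizing_iff)
    have r0_nonneg: "0 \<le> r0" and rbar_pos: "0 < rbar" using r0 by (auto intro: le_less_trans[OF norm_ge_zero])
    \<comment> \<open>Positivity is forced by \<open>r0 < rbar\<close>: with \<open>M = 0\<close>
      the quotient \<open>rbar\<close> would be 0 by convention.\<close>
    have M: "0 < M" using rbar_pos l unfolding rbar by (simp add: zero_less_divide_iff)
    \<comment> \<open>Likewise the nonempty range of step sizes forces \<open>L\<close> to be
      positive.\<close>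
    have "0 < 1 / L" using \<eta> by linarith
    then have \<eta>L: "\<eta> * L \<le> 1" using \<eta> by (simp add: field_simps)
    have hess: "l * (norm Z)\<^sup>2 \<le> P2 Ksharp Z Z \<bullet> X" for Z
      unfolding l_def by (rule lambda_min_hessian_le[OF st])
    have crit: "gradient J Ksharp = 0" by (rule gradient_zero_at_local_min[OF st min])
    \<comment> \<open>For \<open>r0 > 0\<close> the radius in the hypothesis is strictly larger than
      \<open>r0\<close>; for \<open>r0 = 0\<close> positivity of \<open>d_bar\<close> is what gives
      the strict inequality.\<close>
    have r0_lt: "r0 < d_bar A B C Q R D \<alpha> \<beta>"
    proof (cases "r0 = 0")
      case False
      then have "0 < r0 * r0" using r0_nonneg by (auto simp: zero_less_mult_iff)
      then have "r0 * (rbar - r0) < rbar * r0" by (simp add: algebra_simps)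
      then have "r0 < rbar * r0 / (rbar - r0)" using r0(2) by (simp add: less_divide_eq)
      then show ?thesis using dist by linarith
    qed (use dpos in simp)
    have near: "K' \<in> sublevel A B C Q R D \<alpha>" if "norm (K' - Ksharp) \<le> r0" for K'
    proof -
      have "op_norm (Ksharp - K') < d_bar A B C Q R D \<alpha> \<beta>"
        using op_norm_le_norm[of "Ksharp - K'"] that r0_lt by (simp add: norm_minus_commute)
      then have "K' \<in> strict_sublevel A B C Q R D \<alpha>" using d_bar_le[OF sharp] by (meson not_less)
      then show ?thesis by (simp add: sublevel_def strict_sublevel_def)
    qed
    have "Ksharp \<in> sublevel A B C Q R D \<alpha>" by (rule near) (simp add: r0_nonneg)
    then interpret sharp: sof_sublevel A B C Q R D Ksharp \<alpha>
      using gam_bound[OF G] by unfold_locales (auto simp: sublevel_def stabilizing_iff)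
    \<comment> \<open>Needed for \<open>q \<le> 1\<close>: both numbers bound the second derivative
      at \<open>Ksharp\<close> in a direction of norm 1.\<close>
    have "l \<le> L"
    proof -
      let ?Z = "axis undefined (axis undefined 1) :: real ^ 'd ^ 'm"
      have "l * (norm ?Z)\<^sup>2 \<le> L * (norm ?Z)\<^sup>2"
        using hess[of ?Z] sharp.Phi_S2_le_L[of ?Z] unfolding L_def P2_def \<Phi>_def by linarith
      then show ?thesis by (simp add: norm_axis)
    qed
    define q where "q = \<eta> * l"
    have q: "0 \<le> q" "q \<le> 1"
      using \<eta>(1) l order_trans[OF mult_left_mono[OF \<open>l \<le> L\<close>] \<eta>L] by (simp_all add: q_def)
    \<comment> \<open>This sharper bound is the one that propagates: it equals \<open>r0\<close> at
      \<open>i = 0\<close> and fits \<open>contraction_step\<close> with \<open>u = r0\<close>,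
      \<open>v = (1 + q) ^ i * (rbar - r0)\<close>. Dropping the summand \<open>r0\<close> from the
      denominator then gives the stated rate.\<close>
    have "norm (K i - Ksharp) \<le> rbar * r0 / (r0 + (1 + q) ^ i * (rbar - r0))"
    proof (induction i)
      case 0
      show ?case using rbar_pos by (simp add: r0(1))
    next
      case (Suc i)
      let ?e = "K i - Ksharp"
      have "norm ?e \<le> r0"
        using Suc contraction_le_initial[OF q(1) r0_nonneg r0(2), of i] by linarith
      then have seg: "Ksharp + t *\<^sub>R ?e \<in> sublevel A B C Q R D \<alpha>" if "0 \<le> t" "t \<le> 1" for t
        using that mult_left_le_one_le[of "norm ?e" t] by (intro near) (simp add: mult.commute)
      have "norm (K (Suc i) - Ksharp) = norm (?e - \<eta> *\<^sub>R gradient J (Ksharp + ?e))"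
        unfolding step by (simp add: algebra_simps)
      also have "\<dots> \<le> (1 - \<eta> * l + \<eta> * M * norm ?e / 2) * norm ?e"
        unfolding M_def
        by (rule gradient_step_contracts[OF G seg hess crit \<eta>(1) \<eta>L[unfolded L_def]])
      also have "\<eta> * M * norm ?e / 2 = q * norm ?e / rbar"
        unfolding rbar q_def using M l by (simp add: field_simps)
      also have "(1 - \<eta> * l + q * norm ?e / rbar) * norm ?e \<le> rbar * r0 / (r0 + (1 + q) * ((1 + q) ^ i * (rbar - r0)))"
        unfolding q_def[symmetric]
        by (rule contraction_step[OF q rbar_pos r0_nonneg _ _ Suc]) (use r0(2) q(1) in simp_all)
      finally show ?case by (simp add: mult.assoc)
    qed
    also have "\<dots> \<le> rbar * r0 / (rbar - r0) * (1 / (1 + \<eta> * l)) ^ i"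
      using contraction_rate[OF q(1) r0_nonneg r0(2)] by (simp add: q_def)
    finally have "norm (K i - Ksharp) \<le> rbar * r0 / (rbar - r0) * (1 / (1 + \<eta> * l)) ^ i" .
  }
  then show ?thesis using dpos by auto
qed

end
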